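(* Let $a\in(0,\infty)$, $\beta\in(0,1)$, $1<p<q<\infty$ and $1/q=1/p-\beta$. Then (i) both $I_a^\beta$ and $\widetilde I_a^\beta$ are bounded from $H^1(\gamma)$ to $L^{1/(1-\beta)}(\gamma)$; (ii) both $I_a^\beta$ and $\widetilde I_a^\beta$ are bounded from $\{f\in L^{1/\beta}(\gamma):\ f\ge0\}$ to $\mathrm{BLO}_a(\gamma)$; (iii) both $I_a^\beta$ and $\widetilde I_a^\beta$ are bounded from $L^{1/\beta}(\gamma)$ to $\mathrm{BMO}(\gamma)$.
   Context: Fix $n\in\{1,2,\dots\}$. Let $d\gamma(x)=\pi^{-n/2}e^{-|x|^2}dx$ be the Gauss measure on $\mathbb R^n$, where $|\cdot|$ is the Euclidean norm. $B(x,r)=\{y\in\mathbb R^n:|x-y|<r\}$; for a ball $B$, $c_B$ and $r_B$ denote its center and radius. Let $m(x)=\min\{1,1/|x|\}$ (with $m(0)=1$) and $V(x,y)=\gamma(B(x,|x-y|))$. For $a\in(0,\infty)$, $\mathcal B_a$ is the set of all balls $B\subset\mathbb R^n$ with $r_B\le a\,m(c_B)$. For $a\in(0,\infty)$, $\beta\in(0,1)$, the local fractional integral operators are $$I_a^\beta(f)(x)=\int_{B(x,\,am(x))}\frac{f(y)}{[V(x,y)]^{1-\beta}}\,d\gamma(y),\qquad \widetilde I_a^\beta(f)(x)=\int_{B(x,\,am(x))}\frac{f(y)}{[e^{-|x|^2}|x-y|^n]^{1-\beta}}\,d\gamma(y),$$ the same formulas being used for every $f$ in the space on which the operator is considered.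 Hardy space: for $r\in(1,\infty)$, a $(1,r)$ atom is either the constant function $1$, or a function $g\in L^1(\gamma)$ supported in a ball $B\in\mathcal B_1$ with $\|g\|_{L^r(\gamma)}\le[\gamma(B)]^{1/r-1}$ and $\int_B g\,d\gamma=0$. $H^{1,r}(\gamma)$ is the space of all $g\in L^1(\gamma)$ admitting a decomposition $g=\sum_{k=1}^\infty\lambda_ka_k$ with $(1,r)$ atoms $a_k$ and $\lambda_k\in\mathbb C$, $\sum_k|\lambda_k|<\infty$; $\|g\|_{H^{1,r}(\gamma)}$ is the infimum of $\sum_k|\lambda_k|$ over all such decompositions. The spaces $H^{1,r}(\gamma)$, $r\in(1,\infty)$, coincide with equivalent norms (a known fact), and are denoted by $H^1(\gamma)$. $\mathrm{BMO}(\gamma)$ is the set of $f\in L^1(\gamma)$ with $\|f\|_\ast=\sup_{B\in\mathcal B_1}\frac1{\gamma(B)}\int_B|f-f_B|\,d\gamma<\infty$, where $f_B=\frac1{\gamma(B)}\int_Bf\,d\gamma$, with norm $\|f\|_{\mathrm{BMO}(\gamma)}=\|f\|_\ast+\|f\|_{L^1(\gamma)}$. $\mathrm{BLO}_a(\gamma)$ is the set of locally integrable $f$ with $$\|f\|_{\mathrm{BLO}_a(\gamma)}=\|f\|_{L^1(\gamma)}+\sup_{B\in\mathcal B_a}\left[\frac1{\gamma(B)}\int_Bf\,d\gamma-\operatorname*{ess\,inf}_{x\in B}f(x)\right]<\infty.$$ An operator $T$ is bounded from $\mathcal X$ to $\mathcal Y$ ("normed" spaces or subsets thereof, as in (ii),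 where $f$ is measured in the $L^{1/\beta}(\gamma)$ norm) if there is a constant $C\ge0$ with $T(f)\in\mathcal Y$ and $\|T(f)\|_{\mathcal Y}\le C\|f\|_{\mathcal X}$ for all $f\in\mathcal X$. *)

theory Defs
  imports "HOL-Analysis.Analysis" "HOL-Probability.Essential_Supremum"
begin

text \<open>
  The dimension is \<open>n = CARD('n)\<close>. Function classes modulo equality almost everywhere are
  represented by Borel functions; all conditions below are invariant under changes on null sets.
\<close>

definition gauss :: "(real ^ 'n) measure" where
  "gauss = density lborel
     (\<lambda>x. ennreal (pi powr (- real CARD('n) / 2) * exp (- (norm x)\<^sup>2)))"

definition m_fun :: "real ^ 'n \<Rightarrow> real" where
  "m_fun x = (if x = 0 then 1 else min 1 (1 / norm x))"

definition V_fun :: "real ^ 'n \<Rightarrow> real ^ 'n \<Rightarrow> real" where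
  "V_fun x y = measure gauss (ball x (dist x y))"

definition adm_balls :: "real \<Rightarrow> (real ^ 'n) set set" where
  "adm_balls a = {ball c r | c r. 0 < r \<and> r \<le> a * m_fun c}"

definition avg :: "(real ^ 'n) set \<Rightarrow> (real ^ 'n \<Rightarrow> 'b) \<Rightarrow> 'b::{banach, second_countable_topology}" where
  "avg B f = (LINT x:B|gauss. f x) /\<^sub>R measure gauss B"

subsection \<open>Local fractional integrals\<close>

text \<open>
  Both kernels vanish on the diagonal here, where the mathematical kernel is infinite; this
  affects only a null set. The Bochner integral is \<open>0\<close> where the integrand is not
  integrable, so that convergence of the defining integral for almost every \<open>x\<close> is expressed
  separately by the predicates \<open>frac_int_exists\<close> and \<open>frac_int'_exists\<close>.
\<close>

definition frac_int ::
  "real \<Rightarrow> real \<Rightarrow> (real ^ 'n \<Rightarrow> 'b) \<Rightarrow> real ^ 'n \<Rightarrow> 'b::{banach, second_countable_topology}" where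
  "frac_int a \<beta> f x =
     (LINT y:ball x (a * m_fun x)|gauss. f y /\<^sub>R (V_fun x y powr (1 - \<beta>)))"

definition frac_int_exists ::
  "real \<Rightarrow> real \<Rightarrow> (real ^ 'n \<Rightarrow> 'b::{banach, second_countable_topology}) \<Rightarrow> bool" where
  "frac_int_exists a \<beta> f \<longleftrightarrow>
     (AE x in gauss. set_integrable gauss (ball x (a * m_fun x))
        (\<lambda>y. f y /\<^sub>R (V_fun x y powr (1 - \<beta>))))"

definition frac_int' ::
  "real \<Rightarrow> real \<Rightarrow> (real ^ 'n \<Rightarrow> 'b) \<Rightarrow> real ^ 'n \<Rightarrow> 'b::{banach, second_countable_topology}" where
  "frac_int' a \<beta> f x =
     (LINT y:ball x (a * m_fun x)|gauss.
        f y /\<^sub>R ((exp (- (norm x)\<^sup>2) * dist x y ^ CARD('n)) powr (1 - \<beta>)))"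

definition frac_int'_exists ::
  "real \<Rightarrow> real \<Rightarrow> (real ^ 'n \<Rightarrow> 'b::{banach, second_countable_topology}) \<Rightarrow> bool" where
  "frac_int'_exists a \<beta> f \<longleftrightarrow>
     (AE x in gauss. set_integrable gauss (ball x (a * m_fun x))
        (\<lambda>y. f y /\<^sub>R ((exp (- (norm x)\<^sup>2) * dist x y ^ CARD('n)) powr (1 - \<beta>))))"

subsection \<open>Function spaces\<close>

definition Lp :: "real \<Rightarrow> (real ^ 'n \<Rightarrow> 'b::{banach, second_countable_topology}) set" where
  "Lp p = {f \<in> borel_measurable gauss. integrable gauss (\<lambda>x. norm (f x) powr p)}"

definition Lp_norm :: "real \<Rightarrow> (real ^ 'n \<Rightarrow> 'b::{banach, second_countable_topology}) \<Rightarrow> real" where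
  "Lp_norm p f = (LINT x|gauss. norm (f x) powr p) powr (1 / p)"

definition atoms :: "real \<Rightarrow> (real ^ 'n \<Rightarrow> complex) set" where
  "atoms r = {g \<in> Lp 1. (AE x in gauss. g x = 1) \<or>
     (\<exists>B \<in> adm_balls 1. (AE x in gauss. x \<notin> B \<longrightarrow> g x = 0) \<and>
        g \<in> Lp r \<and> Lp_norm r g \<le> measure gauss B powr (1 / r - 1) \<and>
        (LINT x:B|gauss. g x) = 0)}"

text \<open>
  Atoms have \<open>L\<^sup>1\<close> norm at most \<open>1\<close>, so the series converges absolutely in \<open>L\<^sup>1(\<gamma>)\<close>.
\<close>

definition atomic_decomp ::
  "real \<Rightarrow> (real ^ 'n \<Rightarrow> complex) \<Rightarrow> (nat \<Rightarrow> complex) \<Rightarrow> (nat \<Rightarrow> real ^ 'n \<Rightarrow> complex) \<Rightarrow> bool" where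
  "atomic_decomp r g l b \<longleftrightarrow>
     (\<forall>k. b k \<in> atoms r) \<and> summable (\<lambda>k. norm (l k)) \<and>
     (\<lambda>N. Lp_norm 1 (\<lambda>x. g x - (\<Sum>k<N. l k * b k x))) \<longlonglongrightarrow> 0"

definition H1 :: "real \<Rightarrow> (real ^ 'n \<Rightarrow> complex) set" where
  "H1 r = {g \<in> Lp 1. \<exists>l b. atomic_decomp r g l b}"

definition H1_norm :: "real \<Rightarrow> (real ^ 'n \<Rightarrow> complex) \<Rightarrow> real" where
  "H1_norm r g = Inf {(\<Sum>k. norm (l k)) | l b. atomic_decomp r g l b}"

definition BMO_norm :: "(real ^ 'n \<Rightarrow> complex) \<Rightarrow> ereal" where
  "BMO_norm f =
     (SUP B\<in>adm_balls 1. ereal (avg B (\<lambda>x. norm (f x - avg B f)))) + ereal (Lp_norm 1 f)"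

definition BMO :: "(real ^ 'n \<Rightarrow> complex) set" where
  "BMO = {f \<in> Lp 1. BMO_norm f < \<infinity>}"

definition ess_inf_on :: "(real ^ 'n) set \<Rightarrow> (real ^ 'n \<Rightarrow> real) \<Rightarrow> ereal" where
  "ess_inf_on B f = - esssup (restrict_space gauss B) (\<lambda>x. - ereal (f x))"

definition BLO_norm :: "real \<Rightarrow> (real ^ 'n \<Rightarrow> real) \<Rightarrow> ereal" where
  "BLO_norm a f =
     ereal (Lp_norm 1 f) + (SUP B\<in>adm_balls a. ereal (avg B f) - ess_inf_on B f)"

text \<open>
  Finiteness of the norm includes \<open>f \<in> L\<^sup>1(\<gamma>)\<close>, which implies local integrability because the
  density of \<open>\<gamma>\<close> is bounded below on compact sets.
\<close>

definition BLO :: "real \<Rightarrow> (real ^ 'n \<Rightarrow> real) set" where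
  "BLO a = {f \<in> Lp 1. BLO_norm a f < \<infinity>}"

definition bounded_op ::
  "'f set \<Rightarrow> ('f \<Rightarrow> ereal) \<Rightarrow> 'g set \<Rightarrow> ('g \<Rightarrow> ereal) \<Rightarrow> ('f \<Rightarrow> 'g) \<Rightarrow> bool" where
  "bounded_op X NX Y NY T \<longleftrightarrow>
     (\<exists>C::real. C \<ge> 0 \<and> (\<forall>f\<in>X. T f \<in> Y \<and> NY (T f) \<le> ereal C * NX f))"

end

theory Submission
  imports Defs
begin

text \<open>
  Both operators have the form \<open>T f x = \<integral> k x y f y d\<gamma>(y)\<close>, where \<open>k x y\<close> is \<open>w x y powr (\<beta> - 1)\<close> cut off at
  \<open>dist x y < a * m_fun x\<close>, and \<open>w x y\<close> is the measure of a ball about \<open>x\<close> through \<open>y\<close> or its model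
  \<open>exp (- (norm x)\<^sup>2) * dist x y ^ n\<close>. At the scale \<open>m_fun x\<close> the density of the Gauss measure is constant up to
  bounded factors. So \<open>k\<close> is the kernel of a Riesz potential of order \<open>n * \<beta>\<close> in a rescaled Euclidean space, and the
  classical proofs at the two endpoints \<open>p = 1\<close> and \<open>p = 1 / \<beta>\<close> apply, with constants that do not depend on the place.

  Only two properties of the kernel matter, both required in either variable: it is bounded by the Riesz
  kernel, and its increments gain a factor \<open>|x - c| / |y - c| + |y - c| / m_fun c\<close>, the second term of which absorbs the
  jump at the cut-off (locale \<open>fractional_kernel\<close>; \<open>fractional_kernel_truncated\<close> shows that both kernels qualify).
  Integration in dyadic shells gives two consequences, with the exponent \<open>q = 1 / (1 - \<beta>)\<close>: powers of the kernel
  below the \<open>q\<close>-th are integrable (\<open>power_integral\<close>), and its increments satisfy Hoermander's condition at the exponent \<open>q\<close>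
  itself (\<open>hoermander\<close>).

  On \<open>Lp (1 / \<beta>)\<close>, split \<open>f\<close> at twice a given ball. As \<open>q\<close> is conjugate to \<open>1 / \<beta>\<close>, Hoermander's condition
  and Hoelder's inequality show that the image of the far part is constant on the ball up to a multiple of the norm of \<open>f\<close>;
  the image of the near part is small in the mean by Fubini's theorem (\<open>oscillation\<close>). This is the \<open>BMO\<close> estimate. If
  \<open>f \<ge> 0\<close>, the near part can only raise the image of \<open>f\<close>, so that the lower bound needed for \<open>BLO\<close> remains.

  On the Hardy space it is enough to bound the images of atoms in \<open>L\<^sup>q\<close> uniformly. Near its ball an atom
  is treated by its size (\<open>atom_near\<close>), far from it by its cancellation and Hoermander's condition in the other
  variable (\<open>atom_far\<close>). Boundedness on \<open>L\<^sup>1\<close> identifies the image of a sum of atoms, and convexity sums the bounds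
  (\<open>decomposition_bound\<close>).
\<close>

section \<open>The local scale of the Gauss measure\<close>

abbreviation wt :: "real ^ 'n \<Rightarrow> real" where
  "wt x \<equiv> exp (- (norm x)\<^sup>2)"

text \<open>Up to constants, the Gauss measure of a ball about \<open>x\<close> whose radius is at most of order \<open>m_fun x\<close>.\<close>

abbreviation vol :: "real ^ 'n \<Rightarrow> real \<Rightarrow> real" where
  "vol x r \<equiv> wt x * r ^ CARD('n)"

lemma m_fun_eq: "m_fun x = 1 / max 1 (norm x)"
  by (auto simp: m_fun_def min_def max_def field_simps)

lemma m_fun_pos [simp]: "0 < m_fun x"
  by (simp add: m_fun_eq)

lemma m_fun_nonneg [simp]: "0 \<le> m_fun x"
  by (simp add: less_imp_le)

lemma m_fun_nonzero [simp]: "m_fun x \<noteq> 0"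
  by (metis less_irrefl m_fun_pos)

lemma m_fun_le_1: "m_fun x \<le> 1"
  by (simp add: m_fun_eq)

lemma norm_mult_m_fun_le: "norm x * m_fun x \<le> 1"
  by (simp add: m_fun_eq field_simps)

lemma m_fun_near:
  fixes x y :: "real ^ 'n"
  assumes "0 \<le> A" "dist x y \<le> A * m_fun x"
  shows "m_fun x \<le> (1 + A) * m_fun y"
proof -
  let ?M = "max 1 (norm x)"
  have "norm y \<le> norm x + dist x y"
    by (metis dist_commute dist_norm norm_triangle_sub)
  also have "\<dots> \<le> ?M + A * 1"
    using assms mult_left_mono[OF m_fun_le_1[of x] assms(1)] by linarith
  also have "\<dots> \<le> ?M + A * ?M"
    using assms by (intro add_mono mult_left_mono) auto
  finally have "max 1 (norm y) \<le> (1 + A) * ?M"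
    using assms mult_mono[of 1 "1+A" 1 ?M] by (auto simp: algebra_simps)
  then show ?thesis
    using assms by (simp add: m_fun_eq field_simps)
qed

lemma near_sym:
  assumes "0 \<le> A" "dist x y \<le> A * m_fun x"
  shows "dist y x \<le> (A * (1 + A)) * m_fun y"
proof -
  have "dist x y \<le> A * ((1 + A) * m_fun y)"
    using assms m_fun_near[OF assms] by (meson mult_left_mono order_trans)
  then show ?thesis by (simp add: dist_commute mult.assoc)
qed

text \<open>
  Near \<open>x\<close> the square of the norm varies with slope of order \<open>norm x \<le> 1 / m_fun x\<close>. Thus \<open>m_fun\<close> is the scale on
  which the Gaussian density is constant up to bounded factors.
\<close>

lemma norm_square_diff_near:
  fixes x y :: "real ^ 'n"
  assumes "0 \<le> A" "0 \<le> d" "d \<le> 1" "dist x y \<le> d * (A * m_fun x)"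
  shows "\<bar>(norm x)\<^sup>2 - (norm y)\<^sup>2\<bar> \<le> d * (2 * A + A\<^sup>2)"
proof -
  have *: "dist x y \<le> A * m_fun x"
    using assms mult_right_mono[of d 1 "A * m_fun x"] by simp
  have "(norm x)\<^sup>2 - (norm y)\<^sup>2 = (norm x - norm y) * (norm x + norm y)"
    by (simp add: power2_eq_square algebra_simps)
  then have "\<bar>(norm x)\<^sup>2 - (norm y)\<^sup>2\<bar> = \<bar>norm x - norm y\<bar> * (norm x + norm y)"
    by (simp only: abs_mult) simp
  also have "\<dots> \<le> dist x y * (2 * norm x + dist x y)"
  proof (rule mult_mono)
    show "\<bar>norm x - norm y\<bar> \<le> dist x y" by (simp add: dist_norm norm_triangle_ineq3)
    have "norm y \<le> norm x + dist x y" by (metis dist_commute dist_norm norm_triangle_sub)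
    then show "norm x + norm y \<le> 2 * norm x + dist x y" by simp
  qed auto
  also have "\<dots> \<le> (d * (A * m_fun x)) * (2 * norm x + A * m_fun x)"
    using assms * by (intro mult_mono) auto
  also have "\<dots> = d * (2 * A * (norm x * m_fun x) + A\<^sup>2 * (m_fun x * m_fun x))"
    by (simp add: algebra_simps power2_eq_square)
  also have "\<dots> \<le> d * (2 * A * 1 + A\<^sup>2 * (1 * 1))"
    using assms by (intro mult_left_mono add_mono mult_mono norm_mult_m_fun_le m_fun_le_1) auto
  finally show ?thesis by simp
qed

lemma wt_near:
  fixes x y :: "real ^ 'n"
  assumes "0 \<le> A" "0 \<le> d" "d \<le> 1" "dist x y \<le> d * (A * m_fun x)"
  shows "wt y \<le> exp (d * (2 * A + A\<^sup>2)) * wt x" "wt x \<le> exp (d * (2 * A + A\<^sup>2)) * wt y"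
  using norm_square_diff_near[OF assms] unfolding exp_add[symmetric] exp_le_cancel_iff by linarith+

lemma wt_near1:
  fixes x y :: "real ^ 'n"
  assumes "0 \<le> A" "dist x y \<le> A * m_fun x"
  shows "wt y \<le> exp (2 * A + A\<^sup>2) * wt x" "wt x \<le> exp (2 * A + A\<^sup>2) * wt y"
  using wt_near[of A 1 x y] assms by auto

section \<open>Integrals of powers of the distance\<close>

lemma powr_dyadic_bound:
  fixes d t e :: real
  assumes "0 < t" "t / 2 \<le> d" "d \<le> t"
  shows "d powr e \<le> 2 powr \<bar>e\<bar> * t powr e"
proof (cases "0 \<le> e")
  case True
  then have "d powr e \<le> t powr e" using assms by (intro powr_mono2) auto
  also have "\<dots> \<le> 2 powr \<bar>e\<bar> * t powr e"
    using ge_one_powr_ge_zero[of 2 "\<bar>e\<bar>"] mult_right_mono[of 1 "2 powr \<bar>e\<bar>" "t powr e"] by simp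
  finally show ?thesis .
next
  case False
  then have "d powr e \<le> (t / 2) powr e" using assms by (intro powr_mono2') auto
  also have "\<dots> = 2 powr \<bar>e\<bar> * t powr e"
  proof -
    have e: "\<bar>e\<bar> = - e" using False by simp
    have "(t / 2) powr e = t powr e / 2 powr e" by (rule powr_divide)
    then show ?thesis
      unfolding e powr_minus by (simp only: divide_inverse mult.commute)
  qed
  finally show ?thesis .
qed

lemma term_le_suminf_ennreal: "f k \<le> suminf f" for f :: "nat \<Rightarrow> ennreal"
  using sum_le_suminf[of f "{k}"] by simp

text \<open>
  On the shell \<open>t k / 2 \<le> dist c y \<le> t k\<close> the integrand is comparable with \<open>t k powr e\<close>, and the
  shell lies in a ball of volume proportional to \<open>t k ^ n\<close>. If the shells cover the range \<open>D\<close> of distances, the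
  integral is dominated by a series.
\<close>

lemma nn_integral_dist_powr_dyadic:
  fixes c :: "real ^ 'n" and D :: "real set" and t :: "nat \<Rightarrow> real" and e :: real
  assumes D: "\<And>d. d \<in> D \<Longrightarrow> 0 < d \<Longrightarrow> \<exists>k. t k / 2 \<le> d \<and> d \<le> t k"
    and t: "\<And>k. 0 < t k"
    and S: "(\<lambda>k. t k powr (e + CARD('n))) sums S"
  shows "(\<integral>\<^sup>+ y. ennreal (dist c y powr e * indicator D (dist c y)) \<partial>lborel)
    \<le> ennreal (2 powr \<bar>e\<bar> * unit_ball_vol CARD('n) * S)"
proof -
  define K where "K = 2 powr \<bar>e\<bar>"
  define \<omega> where "\<omega> = unit_ball_vol CARD('n)"
  have K: "0 \<le> K" and \<omega>: "0 \<le> \<omega>" by (auto simp: K_def \<omega>_def)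
  let ?b = "\<lambda>k y. ennreal (K * t k powr e) * indicator (cball c (t k)) y"
  have "(\<integral>\<^sup>+ y. ennreal (dist c y powr e * indicator D (dist c y)) \<partial>lborel)
      \<le> (\<integral>\<^sup>+ y. (\<Sum>k. ?b k y) \<partial>lborel)"
  proof (rule nn_integral_mono)
    fix y
    show "ennreal (dist c y powr e * indicator D (dist c y)) \<le> (\<Sum>k. ?b k y)"
    proof (cases "dist c y \<in> D \<and> 0 < dist c y")
      case True
      then obtain k where k: "t k / 2 \<le> dist c y" "dist c y \<le> t k" using D by blast
      have "dist c y powr e \<le> K * t k powr e"
        unfolding K_def by (rule powr_dyadic_bound[OF t k])
      then have "ennreal (dist c y powr e * indicator D (dist c y)) \<le> ?b k y"
        using True k by (simp add: ennreal_leI)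
      from order_trans[OF this term_le_suminf_ennreal[of "\<lambda>k. ?b k y" k]] show ?thesis .
    next
      case False
      then have "dist c y powr e * indicator D (dist c y) = 0" by (cases "dist c y = 0") auto
      then show ?thesis by (simp only: ennreal_0 zero_le)
    qed
  qed
  also have "\<dots> = (\<Sum>k. \<integral>\<^sup>+ y. ?b k y \<partial>lborel)"
  proof (rule nn_integral_suminf)
    fix k
    have "cball c (t k) \<in> sets lborel" by simp
    then show "?b k \<in> borel_measurable lborel"
      by (intro borel_measurable_times_ennreal borel_measurable_const borel_measurable_indicator)
  qed
  also have "\<dots> = (\<Sum>k. ennreal (K * \<omega> * t k powr (e + CARD('n))))"
  proof (rule suminf_cong)
    fix k
    have "(\<integral>\<^sup>+ y. ?b k y \<partial>lborel) = ennreal (K * t k powr e) * emeasure lborel (cball c (t k))"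
      by (simp add: nn_integral_cmult_indicator)
    also have "emeasure lborel (cball c (t k)) = ennreal (\<omega> * t k ^ CARD('n))"
      using less_imp_le[OF t[of k]] by (simp add: emeasure_cball \<omega>_def)
    also have "ennreal (K * t k powr e) * \<dots> = ennreal ((K * t k powr e) * (\<omega> * t k ^ CARD('n)))"
      using less_imp_le[OF t[of k]] \<omega> by (simp add: ennreal_mult'')
    also have "(K * t k powr e) * (\<omega> * t k ^ CARD('n)) = K * \<omega> * t k powr (e + CARD('n))"
      using t[of k] by (simp add: powr_add powr_realpow)
    finally show "(\<integral>\<^sup>+ y. ?b k y \<partial>lborel) = ennreal (K * \<omega> * t k powr (e + CARD('n)))" .
  qed
  also have "\<dots> = ennreal (K * \<omega> * S)"
    by (rule suminf_ennreal_eq) (use K \<omega> in \<open>auto intro!: sums_mult S\<close>)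
  finally show ?thesis by (simp only: K_def \<omega>_def)
qed

text \<open>
  The sign \<open>\<sigma>\<close> selects the range of distances: for \<open>\<sigma> = - 1\<close> those below \<open>\<rho>\<close>, with convergence at the centre, and for
  \<open>\<sigma> = 1\<close> those above \<open>\<rho>\<close>, with convergence at infinity. In both cases the shells have the radii
  \<open>\<rho> * 2 powr (\<sigma> * k)\<close>, and the dominating series is geometric with ratio \<open>2 powr (- \<kappa>)\<close>.
\<close>

lemma nn_integral_dist_powr_half_line:
  fixes \<kappa> \<sigma> :: real
  assumes \<kappa>: "0 < \<kappa>" and \<sigma>: "\<sigma> = 1 \<or> \<sigma> = - 1"
  shows "\<exists>C>0. \<forall>(c :: real ^ 'n) \<rho>. 0 < \<rho> \<longrightarrow>
    (\<integral>\<^sup>+ y. ennreal (dist c y powr (- \<sigma> * \<kappa> - CARD('n)) * indicator {d. 0 \<le> \<sigma> * (d - \<rho>)} (dist c y)) \<partial>lborel)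
      \<le> ennreal (C * \<rho> powr (- \<sigma> * \<kappa>))"
proof -
  let ?e = "- \<sigma> * \<kappa> - CARD('n)"
  let ?q = "2 powr (- \<kappa>)"
  have "?q < 2 powr 0" using \<kappa> by (intro powr_less_mono) auto
  then have q: "0 < ?q" "?q < 1" by simp_all
  let ?C = "2 powr \<bar>?e\<bar> * unit_ball_vol CARD('n) * (1 / (1 - ?q))"
  have "(\<integral>\<^sup>+ y. ennreal (dist c y powr ?e * indicator {d. 0 \<le> \<sigma> * (d - \<rho>)} (dist c y)) \<partial>lborel)
      \<le> ennreal (?C * \<rho> powr (- \<sigma> * \<kappa>))"
    if \<rho>: "0 < \<rho>" for c :: "real ^ 'n" and \<rho>
  proof -
    have "(\<integral>\<^sup>+ y. ennreal (dist c y powr ?e * indicator {d. 0 \<le> \<sigma> * (d - \<rho>)} (dist c y)) \<partial>lborel)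
      \<le> ennreal (2 powr \<bar>?e\<bar> * unit_ball_vol CARD('n) * (\<rho> powr (- \<sigma> * \<kappa>) * (1 / (1 - ?q))))"
    proof (rule nn_integral_dist_powr_dyadic[where t = "\<lambda>k. \<rho> * 2 powr (\<sigma> * real k)"])
      fix d assume d: "d \<in> {d. 0 \<le> \<sigma> * (d - \<rho>)}" "0 < d"
      define L where "L = log 2 (d / \<rho>)"
      define m where "m = \<lceil>L\<rceil>"
      have dL: "d = \<rho> * 2 powr L" using d \<rho> by (simp add: L_def)
      have "real_of_int m - 1 \<le> L" "L \<le> real_of_int m" unfolding m_def by linarith+
      then have "\<rho> * 2 powr (m - 1) \<le> d" "d \<le> \<rho> * 2 powr m"
        unfolding dL using \<rho> by (auto intro!: mult_left_mono powr_mono)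
      then have bounds: "\<rho> * 2 powr m / 2 \<le> d" "d \<le> \<rho> * 2 powr m" by (simp_all add: powr_diff)
      have "\<sigma> * real (nat \<bar>m\<bar>) = m"
      proof (cases "\<sigma> = 1")
        case True
        then have "0 \<le> L" using d \<rho> by (simp add: L_def)
        then have "0 \<le> m" unfolding m_def by linarith
        then show ?thesis using True by simp
      next
        case False
        then have "L \<le> 0" using d \<rho> \<sigma> by (simp add: L_def)
        then have "m \<le> 0" unfolding m_def by linarith
        then show ?thesis using False \<sigma> by simp
      qed
      with bounds show "\<exists>k. \<rho> * 2 powr (\<sigma> * real k) / 2 \<le> d \<and> d \<le> \<rho> * 2 powr (\<sigma> * real k)"
        by metis
    next
      have "(\<lambda>k. \<rho> powr (- \<sigma> * \<kappa>) * ?q ^ k) sums (\<rho> powr (- \<sigma> * \<kappa>) * (1 / (1 - ?q)))"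
        using q by (intro sums_mult geometric_sums) simp
      moreover have "(\<rho> * 2 powr (\<sigma> * real k)) powr (?e + CARD('n)) = \<rho> powr (- \<sigma> * \<kappa>) * ?q ^ k" for k :: nat
      proof -
        have "(2 powr (\<sigma> * real k)) powr (- \<sigma> * \<kappa>) = ?q powr real k"
          using \<sigma> by (auto simp: powr_powr mult.commute)
        then show ?thesis by (simp add: powr_mult powr_realpow)
      qed
      ultimately show "(\<lambda>k. (\<rho> * 2 powr (\<sigma> * real k)) powr (?e + CARD('n))) sums (\<rho> powr (- \<sigma> * \<kappa>) * (1 / (1 - ?q)))"
        by simp
    qed (use \<rho> in simp)
    then show ?thesis by (simp only: mult_ac)
  qed
  moreover have "0 < ?C" using q by (intro mult_pos_pos divide_pos_pos unit_ball_vol_pos) simp_all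
  ultimately show ?thesis by blast
qed

lemma nn_integral_dist_powr_inside:
  fixes \<kappa> :: real
  assumes "0 < \<kappa>"
  shows "\<exists>C>0. \<forall>(c :: real ^ 'n) \<rho>. 0 < \<rho> \<longrightarrow>
    (\<integral>\<^sup>+ y. ennreal (dist c y powr (\<kappa> - CARD('n)) * indicator {..\<rho>} (dist c y)) \<partial>lborel)
      \<le> ennreal (C * \<rho> powr \<kappa>)"
proof -
  have "{d. 0 \<le> - 1 * (d - \<rho>)} = {..\<rho>}" for \<rho> :: real by auto
  then show ?thesis using nn_integral_dist_powr_half_line[OF assms, of "- 1", where ?'n = 'n] by simp
qed

lemma nn_integral_dist_powr_outside:
  fixes \<kappa> :: real
  assumes "0 < \<kappa>"
  shows "\<exists>C>0. \<forall>(c :: real ^ 'n) \<rho>. 0 < \<rho> \<longrightarrow>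
    (\<integral>\<^sup>+ y. ennreal (dist c y powr (- \<kappa> - CARD('n)) * indicator {\<rho>..} (dist c y)) \<partial>lborel)
      \<le> ennreal (C * \<rho> powr (- \<kappa>))"
proof -
  have "{d. 0 \<le> 1 * (d - \<rho>)} = {\<rho>..}" for \<rho> :: real by auto
  then show ?thesis using nn_integral_dist_powr_half_line[OF assms, of 1, where ?'n = 'n] by simp
qed

section \<open>The Gauss measure on small balls\<close>

lemma sets_gauss [simp, measurable_cong]: "sets (gauss :: (real^'n) measure) = sets borel"
  by (simp add: gauss_def)

lemma borel_measurable_gauss_iff:
  fixes f :: "real ^ 'n \<Rightarrow> 'b :: topological_space"
  shows "f \<in> borel_measurable gauss \<longleftrightarrow> f \<in> borel_measurable borel"
  by (simp add: measurable_cong_sets[OF sets_gauss refl])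

lemma space_gauss [simp]: "space (gauss :: (real^'n) measure) = UNIV"
  by (simp add: gauss_def)

definition gauss_norm :: "'n::finite itself \<Rightarrow> real" where
  "gauss_norm _ = pi powr (- real CARD('n) / 2)"

lemma gauss_norm_pos [simp]: "0 < gauss_norm TYPE('n::finite)"
  by (simp add: gauss_norm_def)

lemma gauss_norm_nonneg [simp]: "0 \<le> gauss_norm TYPE('n::finite)"
  by (simp add: gauss_norm_def)

lemma nn_integral_gauss:
  fixes h :: "real ^ 'n \<Rightarrow> ennreal"
  assumes [measurable]: "h \<in> borel_measurable borel"
  shows "(\<integral>\<^sup>+ y. h y \<partial>gauss) = (\<integral>\<^sup>+ y. ennreal (gauss_norm TYPE('n) * wt y) * h y \<partial>lborel)"
  unfolding gauss_def gauss_norm_def by (subst nn_integral_density) auto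

text \<open>
  Functions living at distance \<open>O(m_fun c)\<close> from \<open>c\<close> see the Gauss measure as \<open>wt c\<close> times Lebesgue
  measure, by the comparison of densities in \<open>wt_near1\<close>.
\<close>

lemma nn_integral_gauss_local:
  fixes h :: "real ^ 'n \<Rightarrow> ennreal"
  assumes [measurable]: "h \<in> borel_measurable borel" and A: "0 \<le> A"
    and supp: "\<And>y. h y \<noteq> 0 \<Longrightarrow> dist c y \<le> A * m_fun c"
  shows nn_integral_gauss_local_le: "(\<integral>\<^sup>+ y. h y \<partial>gauss)
      \<le> ennreal (gauss_norm TYPE('n) * exp (2 * A + A\<^sup>2) * wt c) * (\<integral>\<^sup>+ y. h y \<partial>lborel)" (is ?le)
    and nn_integral_gauss_local_ge: "ennreal (gauss_norm TYPE('n) * exp (- (2 * A + A\<^sup>2)) * wt c) * (\<integral>\<^sup>+ y. h y \<partial>lborel)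
      \<le> (\<integral>\<^sup>+ y. h y \<partial>gauss)" (is ?ge)
proof -
  let ?G = "gauss_norm TYPE('n)" and ?L = "2 * A + A\<^sup>2"
  have "ennreal (?G * wt y) * h y \<le> ennreal (?G * exp ?L * wt c) * h y \<and>
      ennreal (?G * exp (- ?L) * wt c) * h y \<le> ennreal (?G * wt y) * h y" for y
  proof (cases "h y = 0")
    case False
    note near = wt_near1[OF A supp[OF False]]
    have "exp (- ?L) * wt c \<le> exp (- ?L) * (exp ?L * wt y)" using near(2) by (rule mult_left_mono) simp
    also have "\<dots> = wt y" by (simp only: mult.assoc[symmetric] exp_add[symmetric]) simp
    finally have "?G * (exp (- ?L) * wt c) \<le> ?G * wt y" by (rule mult_left_mono) simp
    moreover have "?G * wt y \<le> ?G * (exp ?L * wt c)" using near(1) by (rule mult_left_mono) simp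
    ultimately show ?thesis
      by (intro conjI mult_right_mono ennreal_leI) (simp_all only: mult.assoc zero_le)
  qed simp
  then have "(\<integral>\<^sup>+ y. h y \<partial>gauss) \<le> (\<integral>\<^sup>+ y. ennreal (?G * exp ?L * wt c) * h y \<partial>lborel)"
    "(\<integral>\<^sup>+ y. ennreal (?G * exp (- ?L) * wt c) * h y \<partial>lborel) \<le> (\<integral>\<^sup>+ y. h y \<partial>gauss)"
    unfolding nn_integral_gauss[OF assms(1)] by (simp_all add: nn_integral_mono)
  then show ?le ?ge by (simp_all add: nn_integral_cmult)
qed

lemma powr_le_exp_square:
  fixes t :: real
  assumes "0 < t" "0 \<le> N"
  shows "t powr N \<le> exp (N\<^sup>2) * exp (t\<^sup>2)"
proof -
  have "N * ln t \<le> N * t"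
    using assms(2) ln_le_minus_one[OF assms(1)] by (intro mult_left_mono) auto
  also have "\<dots> \<le> N\<^sup>2 + t\<^sup>2"
    using sum_squares_bound[of N t] assms mult_nonneg_nonneg[of N t] by linarith
  finally show ?thesis using assms by (simp add: powr_def exp_add[symmetric])
qed

text \<open>
  The density is at most \<open>1\<close> on the unit ball and decays faster than \<open>norm y powr (- 1 - n)\<close> outside,
  so that the integral of a power of the distance suffices and no Gaussian integral is computed.
\<close>

lemma emeasure_gauss_finite: "emeasure gauss (UNIV :: (real ^ 'n) set) < \<infinity>"
proof -
  obtain C where C: "\<And>(c :: real ^ 'n) \<rho>. 0 < \<rho> \<Longrightarrow>
    (\<integral>\<^sup>+ y. ennreal (dist c y powr (- 1 - CARD('n)) * indicator {\<rho>..} (dist c y)) \<partial>lborel)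
      \<le> ennreal (C * \<rho> powr (- 1))"
    using nn_integral_dist_powr_outside[of 1, where ?'n = 'n] by auto
  let ?N = "1 + real CARD('n)"
  let ?b = "\<lambda>y :: real ^ 'n. dist 0 y powr (- 1 - CARD('n)) * indicator {1..} (dist 0 y)"
  have bound: "ennreal (wt y) \<le> indicator (cball 0 1) y + ennreal (exp (?N\<^sup>2)) * ennreal (?b y)"
    for y :: "real ^ 'n"
  proof (cases "norm y \<le> 1")
    case True
    have "ennreal (wt y) \<le> 1" by simp
    then show ?thesis using True by (simp add: add_increasing2)
  next
    case False
    then have "norm y powr ?N \<le> exp (?N\<^sup>2) * exp ((norm y)\<^sup>2)"
      by (intro powr_le_exp_square) auto
    then have *: "norm y powr ?N * norm y powr (- ?N) \<le> (exp (?N\<^sup>2) * exp ((norm y)\<^sup>2)) * norm y powr (- ?N)"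
      by (rule mult_right_mono) simp
    have "wt y = wt y * (norm y powr ?N * norm y powr (- ?N))"
      using False by (auto simp: powr_add[symmetric])
    also have "\<dots> \<le> wt y * ((exp (?N\<^sup>2) * exp ((norm y)\<^sup>2)) * norm y powr (- ?N))"
      using * by (rule mult_left_mono) simp
    also have "\<dots> = (wt y * exp ((norm y)\<^sup>2)) * (exp (?N\<^sup>2) * norm y powr (- ?N))"
      by (simp only: mult_ac)
    also have "wt y * exp ((norm y)\<^sup>2) = 1" by (simp only: exp_add[symmetric]) simp
    finally have "wt y \<le> exp (?N\<^sup>2) * (norm y powr (- ?N))" by (simp only: mult_1)
    also have "\<dots> = exp (?N\<^sup>2) * ?b y" using False by simp
    finally show ?thesis
      by (simp add: ennreal_mult'[symmetric] add_increasing ennreal_leI)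
  qed
  have "(\<integral>\<^sup>+ y. ennreal (wt (y :: real ^ 'n)) \<partial>lborel)
      \<le> (\<integral>\<^sup>+ y. indicator (cball (0 :: real ^ 'n) 1) y + ennreal (exp (?N\<^sup>2)) * ennreal (?b y) \<partial>lborel)"
    by (intro nn_integral_mono bound)
  also have "\<dots> = emeasure lborel (cball (0 :: real ^ 'n) 1)
      + ennreal (exp (?N\<^sup>2)) * (\<integral>\<^sup>+ y. ennreal (?b y) \<partial>lborel)"
    by (subst nn_integral_add) (auto simp: nn_integral_cmult borel_measurable_indicator)
  also have "\<dots> < \<infinity>"
  proof -
    have "(\<integral>\<^sup>+ y. ennreal (?b y) \<partial>lborel) < \<infinity>"
      using C[of 1 0] by (auto intro: le_less_trans)
    then show ?thesis
      using emeasure_lborel_cball_finite[of "0 :: real ^ 'n" 1] by (auto simp: ennreal_mult_less_top)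
  qed
  finally have *: "(\<integral>\<^sup>+ y. ennreal (wt (y :: real ^ 'n)) \<partial>lborel) < \<infinity>" .
  have "emeasure gauss (UNIV :: (real ^ 'n) set) = (\<integral>\<^sup>+ y. 1 \<partial>(gauss :: (real ^ 'n) measure))"
    by simp
  also have "\<dots> = ennreal (gauss_norm TYPE('n)) * (\<integral>\<^sup>+ y. ennreal (wt (y :: real ^ 'n)) \<partial>lborel)"
    by (subst nn_integral_gauss) (auto simp: nn_integral_cmult ennreal_mult')
  finally show ?thesis using * by (simp add: ennreal_mult_less_top)
qed

abbreviation gauss_integral :: "(real ^ 'n \<Rightarrow> real) \<Rightarrow> ennreal" (binder "\<integral>\<^sub>\<gamma>" 10) where
  "gauss_integral h \<equiv> (\<integral>\<^sup>+ x. ennreal (h x) \<partial>gauss)"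

interpretation gauss: finite_measure "gauss :: (real ^ 'n) measure"
  by (rule finite_measureI) (use emeasure_gauss_finite[where 'n = 'n] in auto)

lemma measure_gauss_ball_bounds:
  assumes "0 < A"
  shows "\<exists>C1>0. \<exists>C2>0. \<forall>(c :: real ^ 'n) r. 0 < r \<and> r \<le> A * m_fun c \<longrightarrow>
    C1 * vol c r \<le> measure gauss (ball c r) \<and>
    measure gauss (ball c r) \<le> C2 * vol c r"
proof -
  define \<omega> where "\<omega> = unit_ball_vol CARD('n)"
  have \<omega>: "0 < \<omega>" by (auto simp: \<omega>_def)
  let ?G = "gauss_norm TYPE('n)" and ?L = "2 * A + A\<^sup>2"
  have "(?G * exp (- ?L) * \<omega>) * vol c r \<le> measure gauss (ball c r) \<and>
    measure gauss (ball c r) \<le> (?G * exp ?L * \<omega>) * vol c r"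
    if r: "0 < r" "r \<le> A * m_fun c" for c :: "real ^ 'n" and r
  proof -
    have e: "emeasure lborel (ball c r) = ennreal (\<omega> * r ^ CARD('n))"
      using r by (simp add: emeasure_ball \<omega>_def)
    have g: "emeasure gauss (ball c r) = (\<integral>\<^sup>+ y. indicator (ball c r) y \<partial>gauss)"
      by simp
    have l: "(\<integral>\<^sup>+ y. indicator (ball c r) y \<partial>lborel) = ennreal (\<omega> * r ^ CARD('n))"
      using e by simp
    have s: "indicator (ball c r) y \<noteq> (0::ennreal) \<Longrightarrow> dist c y \<le> A * m_fun c" for y
      using r by (auto simp: indicator_def split: if_splits)
    have "emeasure gauss (ball c r) \<le> ennreal (?G * exp ?L * wt c) * ennreal (\<omega> * r ^ CARD('n))"
      using nn_integral_gauss_local_le[of "indicator (ball c r)" A c] s assms unfolding g l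
      by (auto simp: borel_measurable_indicator)
    moreover have "ennreal (?G * exp (- ?L) * wt c) * ennreal (\<omega> * r ^ CARD('n)) \<le> emeasure gauss (ball c r)"
      using nn_integral_gauss_local_ge[of "indicator (ball c r)" A c] s assms unfolding g l
      by (auto simp: borel_measurable_indicator)
    ultimately show ?thesis
      using r \<omega> by (simp add: gauss.emeasure_eq_measure ennreal_mult''[symmetric] mult_ac)
  qed
  then show ?thesis
    using \<omega> by (intro exI[of _ "?G * exp (- ?L) * \<omega>"] exI[of _ "?G * exp ?L * \<omega>"] conjI) auto
qed

section \<open>Jensen's inequality for nonnegative integrals\<close>

text \<open>
  Young's inequality for the pair \<open>s\<close>, \<open>1\<close>; equivalently, \<open>s powr p\<close> lies above its tangent at \<open>1\<close>.
\<close>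

lemma young_one:
  fixes s p :: real
  assumes "0 \<le> s" "1 \<le> p"
  shows "s \<le> s powr p / p + (1 - 1 / p)"
proof (cases "p = 1")
  case False
  then have p: "1 < p" using assms by simp
  define q where "q = p / (p - 1)"
  have "1 < q" "1 / p + 1 / q = 1" using p by (auto simp: q_def field_simps)
  then show ?thesis using Youngs_inequality[of p q s 1] assms p by simp
qed (use assms in auto)

text \<open>
  Jensen's inequality for the measure with density \<open>w\<close>, in the form in which no integral has to be known
  to be finite: only the number \<open>u\<close> below the mean is real. With the tangent of \<open>s powr p\<close> at the point
  \<open>\<tau> = u / W\<close> the terms linear in \<open>u\<close> combine to the claim. By the choice of \<open>w\<close> this one inequality
  yields all inequalities of Hoelder and Minkowski type that are used.
\<close>

lemma nn_integral_jensen: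
  fixes w h :: "'a \<Rightarrow> real"
  assumes [measurable]: "w \<in> borel_measurable M" "h \<in> borel_measurable M"
    and nonneg: "\<And>x. 0 \<le> w x" "\<And>x. 0 \<le> h x" and p: "1 \<le> p" and u: "0 \<le> u"
    and le: "ennreal u \<le> (\<integral>\<^sup>+ x. ennreal (w x * h x) \<partial>M)"
    and W: "(\<integral>\<^sup>+ x. ennreal (w x) \<partial>M) \<le> ennreal W" "0 < W"
  shows "ennreal (u powr p) \<le> ennreal (W powr (p - 1)) * (\<integral>\<^sup>+ x. ennreal (w x * h x powr p) \<partial>M)"
proof (cases "u = 0 \<or> (\<integral>\<^sup>+ x. ennreal (w x * h x powr p) \<partial>M) = \<infinity>")
  case True
  then show ?thesis using W p by (auto simp: ennreal_mult_top)
next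
  case False
  then obtain z where z: "0 \<le> z" "(\<integral>\<^sup>+ x. ennreal (w x * h x powr p) \<partial>M) = ennreal z"
    by (cases "\<integral>\<^sup>+ x. ennreal (w x * h x powr p) \<partial>M") auto
  have u: "0 < u" using u False by simp
  define \<tau> where "\<tau> = u / W"
  have \<tau>: "0 < \<tau>" using u W by (simp add: \<tau>_def)
  define a where "a = \<tau> powr (1 - p) / p"
  define b where "b = \<tau> * (1 - 1 / p)"
  have ab: "0 \<le> a" "0 \<le> b" using \<tau> p by (auto simp: a_def b_def)
  have pt: "w x * h x \<le> a * (w x * h x powr p) + b * w x" for x
  proof -
    have "h x / \<tau> \<le> (h x / \<tau>) powr p / p + (1 - 1 / p)"
      using \<tau> nonneg p by (intro young_one) auto
    then have "\<tau> * (h x / \<tau>) \<le> \<tau> * ((h x / \<tau>) powr p / p + (1 - 1 / p))"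
      using \<tau> by (intro mult_left_mono) auto
    moreover have "\<tau> * ((h x / \<tau>) powr p / p) = a * h x powr p"
      using \<tau> by (simp add: a_def powr_divide powr_diff)
    ultimately have "h x \<le> a * h x powr p + b"
      using \<tau> by (simp add: b_def distrib_left)
    then show ?thesis using mult_left_mono[OF _ nonneg(1)[of x]] by (fastforce simp: algebra_simps)
  qed
  have "ennreal u \<le> (\<integral>\<^sup>+ x. ennreal a * ennreal (w x * h x powr p) + ennreal b * ennreal (w x) \<partial>M)"
    using ab nonneg pt
    by (intro order_trans[OF le nn_integral_mono])
       (simp add: ennreal_mult'[symmetric] ennreal_plus[symmetric] ennreal_leI del: ennreal_plus)
  also have "\<dots> = ennreal a * ennreal z + ennreal b * (\<integral>\<^sup>+ x. ennreal (w x) \<partial>M)"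
    by (simp add: nn_integral_add nn_integral_cmult z)
  also have "\<dots> \<le> ennreal a * ennreal z + ennreal b * ennreal W"
    by (intro add_mono mult_left_mono W order_refl) auto
  also have "\<dots> = ennreal (a * z + b * W)"
    using ab z W by (simp add: ennreal_mult ennreal_plus)
  finally have "u \<le> a * z + b * W"
    using ab z W by (subst (asm) ennreal_le_iff) auto
  moreover have "b * W = u - u / p"
    using W by (simp add: b_def \<tau>_def field_simps)
  ultimately have "u / p \<le> \<tau> powr (1 - p) * z / p"
    by (simp add: a_def)
  then have "u \<le> \<tau> powr (1 - p) * z" using p by (simp add: divide_le_cancel)
  then have "\<tau> powr (p - 1) * u \<le> \<tau> powr (p - 1) * (\<tau> powr (1 - p) * z)"
    by (intro mult_left_mono) auto
  also have "\<dots> = z" using \<tau> by (simp add: powr_add[symmetric] mult.assoc[symmetric])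
  finally have "W powr (p - 1) * (\<tau> powr (p - 1) * u) \<le> W powr (p - 1) * z"
    by (intro mult_left_mono) auto
  moreover have "W powr (p - 1) * (\<tau> powr (p - 1) * u) = u powr p"
  proof -
    have "W powr (p - 1) * \<tau> powr (p - 1) = u powr (p - 1)"
      using u W by (simp add: \<tau>_def powr_divide)
    moreover have "u powr p = u powr (p - 1) * u" using u powr_add[of u "p - 1" 1] by simp
    ultimately show ?thesis by (simp only: mult.assoc[symmetric])
  qed
  ultimately show ?thesis
    using z by (simp add: ennreal_mult'[symmetric] ennreal_leI)
qed

lemma nn_integral_jensen_root:
  fixes w h :: "'a \<Rightarrow> real"
  assumes [measurable]: "w \<in> borel_measurable M" "h \<in> borel_measurable M"
    and nonneg: "\<And>x. 0 \<le> w x" "\<And>x. 0 \<le> h x" and p: "1 \<le> p"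
    and W: "(\<integral>\<^sup>+ x. ennreal (w x) \<partial>M) \<le> ennreal W" "0 < W"
    and Z: "(\<integral>\<^sup>+ x. ennreal (w x * h x powr p) \<partial>M) \<le> ennreal Z" "0 \<le> Z"
  shows "(\<integral>\<^sup>+ x. ennreal (w x * h x) \<partial>M) \<le> ennreal ((W powr (p - 1) * Z) powr (1 / p))"
proof -
  have *: "u powr p \<le> W powr (p - 1) * Z" if "0 \<le> u" "ennreal u \<le> (\<integral>\<^sup>+ x. ennreal (w x * h x) \<partial>M)" for u
  proof -
    have "ennreal (u powr p) \<le> ennreal (W powr (p - 1)) * (\<integral>\<^sup>+ x. ennreal (w x * h x powr p) \<partial>M)"
      by (rule nn_integral_jensen) (use that nonneg p W in auto)
    also have "\<dots> \<le> ennreal (W powr (p - 1)) * ennreal Z"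
      by (intro mult_left_mono Z) auto
    also have "\<dots> = ennreal (W powr (p - 1) * Z)" using Z by (simp add: ennreal_mult)
    finally show ?thesis using Z by (subst (asm) ennreal_le_iff) auto
  qed
  have **: "u \<le> (W powr (p - 1) * Z) powr (1 / p)"
    if "0 \<le> u" "ennreal u \<le> (\<integral>\<^sup>+ x. ennreal (w x * h x) \<partial>M)" for u
  proof -
    have "u = (u powr p) powr (1 / p)" using that p by (simp add: powr_powr)
    also have "\<dots> \<le> (W powr (p - 1) * Z) powr (1 / p)"
      using *[OF that] p by (intro powr_mono2) auto
    finally show ?thesis .
  qed
  show ?thesis
  proof (cases "\<integral>\<^sup>+ x. ennreal (w x * h x) \<partial>M")
    case (real u)
    then show ?thesis using **[of u] by (simp add: ennreal_leI)
  next
    case top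
    then show ?thesis using **[of "(W powr (p - 1) * Z) powr (1 / p) + 1"] by auto
  qed
qed

section \<open>Kernels of Riesz type\<close>

text \<open>
  The kernel of the fractional integral of order \<open>n * \<beta>\<close> for the measure \<open>wt x\<close> times Lebesgue measure, cut
  off at the local scale. On the diagonal it is \<open>0\<close>, since \<open>0 powr _ = 0\<close>.
\<close>

definition riesz :: "real \<Rightarrow> real \<Rightarrow> real ^ 'n \<Rightarrow> real ^ 'n \<Rightarrow> real" where
  "riesz \<beta> A x y =
     (if dist x y \<le> A * m_fun x then vol x (dist x y) powr (\<beta> - 1) else 0)"

lemma riesz_nonneg [simp]: "0 \<le> riesz \<beta> A x y"
  by (simp add: riesz_def)

text \<open>
  Size and regularity as the first variable moves. The second term \<open>dist c y / m_fun c\<close> of the smoothness bound is of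
  order one at the distance where a kernel is cut off. It thus accounts for a jump there, while it is
  small where the kernel is large.
\<close>

locale one_sided_kernel =
  fixes \<beta> A C :: real and k :: "real ^ 'n \<Rightarrow> real ^ 'n \<Rightarrow> real"
  assumes \<beta>: "0 < \<beta>" "\<beta> < 1" and A: "0 < A" and C: "0 < C"
    and kernel_measurable: "(\<lambda>(x, y). k x y) \<in> borel_measurable (borel \<Otimes>\<^sub>M borel)"
    and nonneg: "0 \<le> k x y"
    and size: "k x y \<le> C * riesz \<beta> A x y"
    and smooth: "2 * dist x c \<le> dist c y \<Longrightarrow>
      \<bar>k x y - k c y\<bar> \<le> C * (dist x c / dist c y + dist c y / m_fun c) * riesz \<beta> A c y"
begin

lemma kernel_measurable2 [measurable]:
  assumes [measurable]: "f \<in> borel_measurable M" "g \<in> borel_measurable M"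
  shows "(\<lambda>x. k (f x) (g x)) \<in> borel_measurable M"
proof -
  have "(\<lambda>x. (f x, g x)) \<in> M \<rightarrow>\<^sub>M borel \<Otimes>\<^sub>M borel" by measurable
  from measurable_compose[OF this kernel_measurable] show ?thesis by simp
qed

text \<open>
  The power \<open>s\<close> of the Riesz kernel has the singularity \<open>dist x y powr (- n * s * (1 - \<beta>))\<close>, which is locally
  integrable exactly for \<open>s * (1 - \<beta>) < 1\<close>.
\<close>

lemma power_integral:
  assumes "0 < s" "s * (1 - \<beta>) < 1"
  shows "\<exists>D>0. \<forall>x \<rho>. 0 < \<rho> \<longrightarrow>
    (\<integral>\<^sub>\<gamma>y. k x y powr s * indicator {..\<rho>} (dist x y))
      \<le> ennreal (D * vol x \<rho> powr (1 - s * (1 - \<beta>)))"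
proof -
  define \<theta> where "\<theta> = 1 - s * (1 - \<beta>)"
  define n where "n = real CARD('n)"
  have n: "0 < n" by (simp add: n_def)
  have \<theta>: "0 < \<theta>" using assms by (simp add: \<theta>_def)
  obtain C1 where C1: "0 < C1" "\<And>(c :: real ^ 'n) \<rho>. 0 < \<rho> \<Longrightarrow>
    (\<integral>\<^sup>+ y. ennreal (dist c y powr (n * \<theta> - n) * indicator {..\<rho>} (dist c y)) \<partial>lborel)
      \<le> ennreal (C1 * \<rho> powr (n * \<theta>))"
    using nn_integral_dist_powr_inside[of "n * \<theta>", where ?'n = 'n] \<theta> n unfolding n_def by auto
  define L where "L = gauss_norm TYPE('n) * exp (2 * A + A\<^sup>2)"
  have L: "0 < L" by (simp add: L_def)
  show ?thesis
  proof (intro exI[of _ "L * C powr s * C1"] conjI allI impI)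
    show "0 < L * C powr s * C1" using L C C1 by simp
    fix x :: "real ^ 'n" and \<rho> :: real assume \<rho>: "0 < \<rho>"
    let ?h = "\<lambda>y. (C powr s * wt x powr (\<theta> - 1)) * (dist x y powr (n * \<theta> - n) * indicator {..\<rho>} (dist x y))"
    let ?g = "\<lambda>y. ennreal (?h y * indicator (cball x (A * m_fun x)) y)"
    have pt: "k x y powr s * indicator {..\<rho>} (dist x y) \<le> ?h y * indicator (cball x (A * m_fun x)) y" for y
    proof (cases "dist x y \<le> A * m_fun x")
      case True
      have "k x y powr s \<le> (C * vol x (dist x y) powr (\<beta> - 1)) powr s"
        using size[of x y] nonneg[of x y] True assms by (intro powr_mono2) (auto simp: riesz_def)
      also have "\<dots> = C powr s * (wt x powr (s * (\<beta> - 1)) * (dist x y ^ CARD('n)) powr (s * (\<beta> - 1)))"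
        using C by (simp add: powr_mult powr_powr mult.commute)
      also have "(dist x y ^ CARD('n)) powr (s * (\<beta> - 1)) = dist x y powr (n * \<theta> - n)"
      proof (cases "x = y")
        case False
        then have "dist x y ^ CARD('n) = dist x y powr n" by (simp add: n_def powr_realpow)
        moreover have "n * (s * (\<beta> - 1)) = n * \<theta> - n" by (simp add: \<theta>_def algebra_simps)
        ultimately show ?thesis by (simp only: powr_powr)
      qed simp
      also have "s * (\<beta> - 1) = \<theta> - 1" by (simp add: \<theta>_def algebra_simps)
      finally have "k x y powr s \<le> (C powr s * wt x powr (\<theta> - 1)) * dist x y powr (n * \<theta> - n)"
        by (simp only: mult.assoc)
      then show ?thesis using True by (auto simp: indicator_def)
    next
      case False
      then have "k x y = 0" using size[of x y] nonneg[of x y] by (simp add: riesz_def)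
      then show ?thesis using False by simp
    qed
    have "(\<integral>\<^sup>+ y. ?g y \<partial>lborel) \<le> (\<integral>\<^sup>+ y. ennreal (C powr s * wt x powr (\<theta> - 1)) *
        ennreal (dist x y powr (n * \<theta> - n) * indicator {..\<rho>} (dist x y)) \<partial>lborel)"
      by (intro nn_integral_mono) (auto simp: ennreal_mult'[symmetric] indicator_def intro!: ennreal_leI)
    also have "\<dots> = ennreal (C powr s * wt x powr (\<theta> - 1)) *
        (\<integral>\<^sup>+ y. ennreal (dist x y powr (n * \<theta> - n) * indicator {..\<rho>} (dist x y)) \<partial>lborel)"
      by (rule nn_integral_cmult) measurable
    also have "\<dots> \<le> ennreal (C powr s * wt x powr (\<theta> - 1)) * ennreal (C1 * \<rho> powr (n * \<theta>))"
      by (intro mult_left_mono C1 \<rho>) auto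
    finally have I: "(\<integral>\<^sup>+ y. ?g y \<partial>lborel) \<le>
        ennreal (C powr s * wt x powr (\<theta> - 1)) * ennreal (C1 * \<rho> powr (n * \<theta>))" .
    have "(\<integral>\<^sub>\<gamma>y. k x y powr s * indicator {..\<rho>} (dist x y)) \<le> (\<integral>\<^sup>+ y. ?g y \<partial>gauss)"
      by (intro nn_integral_mono ennreal_leI pt)
    also have "\<dots> \<le> ennreal (L * wt x) * (\<integral>\<^sup>+ y. ?g y \<partial>lborel)"
      unfolding L_def using A by (intro nn_integral_gauss_local_le) (auto simp: indicator_def split: if_splits)
    also have "\<dots> \<le> ennreal (L * wt x) * (ennreal (C powr s * wt x powr (\<theta> - 1)) * ennreal (C1 * \<rho> powr (n * \<theta>)))"
      by (intro mult_left_mono I) auto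
    also have "\<dots> = ennreal ((L * wt x) * ((C powr s * wt x powr (\<theta> - 1)) * (C1 * \<rho> powr (n * \<theta>))))"
      using L C1 by (simp add: ennreal_mult)
    also have "(L * wt x) * ((C powr s * wt x powr (\<theta> - 1)) * (C1 * \<rho> powr (n * \<theta>)))
        = L * C powr s * C1 * ((wt x * wt x powr (\<theta> - 1)) * \<rho> powr (n * \<theta>))"
      by (simp only: mult_ac)
    also have "wt x * wt x powr (\<theta> - 1) = wt x powr \<theta>"
      using powr_add[of "wt x" 1 "\<theta> - 1"] by simp
    also have "\<rho> powr (n * \<theta>) = (\<rho> ^ CARD('n)) powr \<theta>"
      using \<rho> by (simp add: n_def powr_realpow[symmetric] powr_powr)
    also have "wt x powr \<theta> * (\<rho> ^ CARD('n)) powr \<theta> = vol x \<rho> powr \<theta>"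
      using \<rho> by (simp add: powr_mult)
    finally show "(\<integral>\<^sub>\<gamma>y. k x y powr s * indicator {..\<rho>} (dist x y))
      \<le> ennreal (L * C powr s * C1 * vol x \<rho> powr (1 - s * (1 - \<beta>)))"
      by (simp only: \<theta>_def)
  qed
qed

end

lemma ennreal_linear_combination:
  assumes "0 \<le> K" "0 \<le> a" "0 \<le> b" "0 \<le> u" "0 \<le> v"
  shows "ennreal (K * (a * u + b * v)) = ennreal K * (ennreal a * ennreal u + ennreal b * ennreal v)"
  using assms by (simp add: ennreal_mult ennreal_plus)

lemma powr_sum_le:
  fixes u v q :: real
  assumes "0 \<le> u" "0 \<le> v" "0 \<le> q"
  shows "(u + v) powr q \<le> 2 powr q * (u powr q + v powr q)"
proof -
  have "(u + v) powr q \<le> (2 * max u v) powr q" using assms by (intro powr_mono2) auto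
  also have "\<dots> = 2 powr q * (max u v) powr q" using assms by (simp add: powr_mult)
  also have "\<dots> \<le> 2 powr q * (u powr q + v powr q)"
    by (intro mult_left_mono) (auto simp: max_def)
  finally show ?thesis .
qed

context one_sided_kernel
begin

text \<open>
  The conjugate exponent of \<open>1 / \<beta>\<close>, and the critical exponent for the integrability of the Riesz kernel: its
  power \<open>q\<close> has the singularity \<open>dist x y powr (- n)\<close>.
\<close>

definition q where "q = 1 / (1 - \<beta>)"

lemma q: "1 < q" "0 < q" "(\<beta> - 1) * q = - 1" "(1 - \<beta>) * q = 1"
  using \<beta> by (auto simp: q_def field_simps)

text \<open>
  Hoermander's condition at the exponent \<open>q\<close>. The power \<open>q\<close> of the Riesz kernel just fails to be integrable, but
  the factor \<open>r / dist c y\<close> gained from smoothness makes the integral over \<open>dist c y \<ge> 2 * r\<close> converge at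
  infinity, and the factor \<open>dist c y / m_fun c\<close> makes that over \<open>dist c y \<le> A * m_fun c\<close> converge at the
  origin. Both have scale-invariant values.
\<close>

lemma hoermander:
  "\<exists>D>0. \<forall>c x r. 0 < r \<and> dist x c \<le> r \<longrightarrow>
    (\<integral>\<^sub>\<gamma>y. \<bar>k x y - k c y\<bar> powr q * indicator {2 * r..} (dist c y)) \<le> ennreal D"
proof -
  define n where "n = real CARD('n)"
  have n: "0 < n" by (simp add: n_def)
  obtain C1 where C1: "0 < C1" "\<And>(c :: real ^ 'n) \<rho>. 0 < \<rho> \<Longrightarrow>
    (\<integral>\<^sup>+ y. ennreal (dist c y powr (q - n) * indicator {..\<rho>} (dist c y)) \<partial>lborel)
      \<le> ennreal (C1 * \<rho> powr q)"
    using nn_integral_dist_powr_inside[of q, where ?'n = 'n] q n unfolding n_def by auto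
  obtain C2 where C2: "0 < C2" "\<And>(c :: real ^ 'n) \<rho>. 0 < \<rho> \<Longrightarrow>
    (\<integral>\<^sup>+ y. ennreal (dist c y powr (- q - n) * indicator {\<rho>..} (dist c y)) \<partial>lborel)
      \<le> ennreal (C2 * \<rho> powr (- q))"
    using nn_integral_dist_powr_outside[of q, where ?'n = 'n] q n unfolding n_def by auto
  define L where "L = gauss_norm TYPE('n) * exp (2 * A + A\<^sup>2)"
  have L: "0 < L" by (simp add: L_def)
  define K where "K = (2 * C) powr q"
  have K: "0 < K" using C by (simp add: K_def)
  show ?thesis
  proof (intro exI[of _ "L * K * (C2 * 2 powr (- q) + C1 * A powr q)"] conjI allI impI)
    show "0 < L * K * (C2 * 2 powr (- q) + C1 * A powr q)"
      using L K C1 C2 A by (intro mult_pos_pos add_pos_pos) auto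
    fix c x :: "real ^ 'n" and r assume r: "0 < r \<and> dist x c \<le> r"
    let ?m = "m_fun c"
    let ?u = "\<lambda>y. dist c y powr (- q - n) * indicator {2 * r..} (dist c y)"
    let ?v = "\<lambda>y. dist c y powr (q - n) * indicator {..A * ?m} (dist c y)"
    let ?h = "\<lambda>y. (K / wt c) * (r powr q * ?u y + ?m powr (- q) * ?v y)"
    let ?g = "\<lambda>y. ennreal (?h y * indicator (cball c (A * ?m)) y)"
    have pt: "\<bar>k x y - k c y\<bar> powr q * indicator {2 * r..} (dist c y) \<le> ?h y * indicator (cball c (A * ?m)) y" for y
    proof (cases "dist c y \<le> A * ?m \<and> 2 * r \<le> dist c y")
      case True
      define d where "d = dist c y"
      have d: "0 < d" "2 * r \<le> d" "d \<le> A * ?m" using True r by (auto simp: d_def)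
      have "\<bar>k x y - k c y\<bar> \<le> C * (dist x c / d + d / ?m) * riesz \<beta> A c y"
        unfolding d_def using True r by (intro smooth) auto
      also have "\<dots> \<le> C * (r / d + d / ?m) * riesz \<beta> A c y"
        using r C d by (intro mult_right_mono mult_left_mono add_right_mono divide_right_mono) auto
      finally have "\<bar>k x y - k c y\<bar> powr q \<le> (C * (r / d + d / ?m) * riesz \<beta> A c y) powr q"
        using q by (intro powr_mono2) auto
      also have "\<dots> = C powr q * (r / d + d / ?m) powr q * riesz \<beta> A c y powr q"
        using C d r by (simp add: powr_mult add_nonneg_nonneg)
      also have "riesz \<beta> A c y powr q = (1 / wt c) * d powr (- n)"
      proof -
        have "riesz \<beta> A c y = vol c d powr (\<beta> - 1)"
          using True by (simp add: riesz_def d_def)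
        then have "riesz \<beta> A c y powr q = vol c d powr (- 1)"
          by (simp only: powr_powr q)
        also have "\<dots> = 1 / (wt c * d powr n)"
          using d by (simp add: powr_minus_divide n_def powr_realpow)
        finally show ?thesis by (simp add: powr_minus_divide)
      qed
      also have "C powr q * (r / d + d / ?m) powr q * (1 / wt c * d powr - n)
          \<le> C powr q * (2 powr q * ((r / d) powr q + (d / ?m) powr q)) * (1 / wt c * d powr - n)"
        using r d q by (intro mult_right_mono mult_left_mono powr_sum_le) auto
      also have "\<dots> = (K / wt c) * (((r / d) powr q + (d / ?m) powr q) * d powr (- n))"
        using C by (simp add: K_def powr_mult)
      also have "((r / d) powr q + (d / ?m) powr q) * d powr (- n)
          = r powr q * d powr (- q - n) + ?m powr (- q) * d powr (q - n)"
      proof -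
        have "(r / d) powr q = r powr q * d powr (- q)" by (simp add: powr_divide powr_minus_divide)
        moreover have "(d / ?m) powr q = ?m powr (- q) * d powr q" by (simp add: powr_divide powr_minus_divide)
        moreover have "d powr (- q - n) = d powr (- q) * d powr (- n)" "d powr (q - n) = d powr q * d powr (- n)"
          by (simp_all add: powr_add[symmetric])
        ultimately show ?thesis by (simp add: algebra_simps)
      qed
      finally show ?thesis using True unfolding d_def by simp
    next
      case False
      have "riesz \<beta> A c y = 0 \<or> \<not> 2 * r \<le> dist c y" using False by (auto simp: riesz_def)
      then have "\<bar>k x y - k c y\<bar> powr q * indicator {2 * r..} (dist c y) = 0"
        using smooth[of x c y] r by (auto simp: indicator_def)
      moreover have "0 \<le> ?h y * indicator (cball c (A * ?m)) y"
        using K r by (intro mult_nonneg_nonneg add_nonneg_nonneg) auto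
      ultimately show ?thesis by linarith
    qed
    have "(\<integral>\<^sup>+ y. ?g y \<partial>lborel) \<le> (\<integral>\<^sup>+ y. ennreal (K / wt c) *
        (ennreal (r powr q) * ennreal (?u y) + ennreal (?m powr (- q)) * ennreal (?v y)) \<partial>lborel)"
    proof (intro nn_integral_mono)
      fix y
      have "0 \<le> ?h y" using K r by (intro mult_nonneg_nonneg add_nonneg_nonneg) auto
      then have "?g y \<le> ennreal (?h y)" by (intro ennreal_leI mult_left_le indicator_le_1)
      also have "\<dots> = ennreal (K / wt c) *
        (ennreal (r powr q) * ennreal (?u y) + ennreal (?m powr (- q)) * ennreal (?v y))"
        by (rule ennreal_linear_combination) (use K r in simp_all)
      finally show "?g y \<le> ennreal (K / wt c) *
        (ennreal (r powr q) * ennreal (?u y) + ennreal (?m powr (- q)) * ennreal (?v y))" .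
    qed
    also have "\<dots> = ennreal (K / wt c) * (ennreal (r powr q) * (\<integral>\<^sup>+ y. ennreal (?u y) \<partial>lborel)
        + ennreal (?m powr (- q)) * (\<integral>\<^sup>+ y. ennreal (?v y) \<partial>lborel))"
      by (subst nn_integral_cmult, measurable, subst nn_integral_add, measurable,
          subst nn_integral_cmult, measurable, subst nn_integral_cmult, measurable)
    also have "\<dots> \<le> ennreal (K / wt c) * (ennreal (r powr q) * ennreal (C2 * (2 * r) powr (- q))
        + ennreal (?m powr (- q)) * ennreal (C1 * (A * ?m) powr q))"
      using r A by (intro mult_left_mono add_mono C1 C2) auto
    finally have I: "(\<integral>\<^sup>+ y. ?g y \<partial>lborel) \<le> ennreal (K / wt c) * (ennreal (r powr q) * ennreal (C2 * (2 * r) powr (- q))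
        + ennreal (?m powr (- q)) * ennreal (C1 * (A * ?m) powr q))" .
    have "(\<integral>\<^sub>\<gamma>y. \<bar>k x y - k c y\<bar> powr q * indicator {2 * r..} (dist c y)) \<le> (\<integral>\<^sup>+ y. ?g y \<partial>gauss)"
      by (intro nn_integral_mono ennreal_leI pt)
    also have "\<dots> \<le> ennreal (L * wt c) * (\<integral>\<^sup>+ y. ?g y \<partial>lborel)"
      unfolding L_def 
    proof (rule nn_integral_gauss_local_le)
      show "dist c y \<le> A * ?m" if "?g y \<noteq> 0" for y
      proof (rule ccontr)
        assume "\<not> dist c y \<le> A * ?m"
        then have "indicator (cball c (A * ?m)) y = (0 :: real)" by simp
        then have "?g y = 0" by (simp only: mult_zero_right ennreal_0)
        with that show False by contradiction
      qed
      have "(indicator (cball c (A * ?m)) :: _ \<Rightarrow> real) \<in> borel_measurable borel"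
        by (rule borel_measurable_indicator) simp
      then show "?g \<in> borel_measurable borel"
        by (intro measurable_compose[OF _ measurable_ennreal] borel_measurable_times
            borel_measurable_add borel_measurable_const; measurable)
      show "0 \<le> A" using A by simp
    qed
    also have "\<dots> \<le> ennreal (L * wt c) * (ennreal (K / wt c) * (ennreal (r powr q) * ennreal (C2 * (2 * r) powr (- q))
        + ennreal (?m powr (- q)) * ennreal (C1 * (A * ?m) powr q)))"
      by (intro mult_left_mono I) auto
    also have "\<dots> = ennreal ((L * wt c) * ((K / wt c) * (r powr q * (C2 * (2 * r) powr (- q))
        + ?m powr (- q) * (C1 * (A * ?m) powr q))))"
    proof -
      have "ennreal (K / wt c) * (ennreal (r powr q) * ennreal (C2 * (2 * r) powr (- q))
        + ennreal (?m powr (- q)) * ennreal (C1 * (A * ?m) powr q)) =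
          ennreal ((K / wt c) * (r powr q * (C2 * (2 * r) powr (- q)) + ?m powr (- q) * (C1 * (A * ?m) powr q)))"
        by (rule ennreal_linear_combination[symmetric]) (use K C1 C2 in simp_all)
      moreover have "0 \<le> L * wt c" using L by simp
      ultimately show ?thesis by (simp only: ennreal_mult'[symmetric])
    qed
    also have "(L * wt c) * ((K / wt c) * (r powr q * (C2 * (2 * r) powr (- q))
        + ?m powr (- q) * (C1 * (A * ?m) powr q))) = L * K * (C2 * 2 powr (- q) + C1 * A powr q)"
    proof -
      have "r powr q * (2 * r) powr (- q) = 2 powr (- q)"
        using r by (simp add: powr_mult powr_minus)
      moreover have "?m powr (- q) * (A * ?m) powr q = A powr q"
        using A by (simp add: powr_mult powr_minus)
      ultimately have e: "r powr q * (C2 * (2 * r) powr (- q)) = C2 * 2 powr (- q)"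
        "?m powr (- q) * (C1 * (A * ?m) powr q) = C1 * A powr q"
        by (metis mult.left_commute)+
      show ?thesis unfolding e by simp
    qed
    finally show "(\<integral>\<^sub>\<gamma>y. \<bar>k x y - k c y\<bar> powr q * indicator {2 * r..} (dist c y))
      \<le> ennreal (L * K * (C2 * 2 powr (- q) + C1 * A powr q))" .
  qed
qed

end

section \<open>Integral operators and Lebesgue spaces\<close>

lemma ennreal_norm_integral_le:
  fixes g :: "'a \<Rightarrow> 'b::{banach, second_countable_topology}"
  shows "ennreal (norm (LINT x|M. g x)) \<le> (\<integral>\<^sup>+ x. ennreal (norm (g x)) \<partial>M)"
  by (cases "integrable M g") (auto simp: integral_norm_bound_ennreal not_integrable_integral_eq)

interpretation gauss2: pair_sigma_finite "gauss :: (real ^ 'n) measure" "gauss :: (real ^ 'n) measure"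
  by unfold_locales

lemma gauss_Fubini:
  fixes F :: "real ^ 'n \<Rightarrow> real ^ 'n \<Rightarrow> ennreal"
  assumes "(\<lambda>(x, y). F x y) \<in> borel_measurable (borel \<Otimes>\<^sub>M borel)"
  shows "(\<integral>\<^sup>+ x. (\<integral>\<^sup>+ y. F x y \<partial>gauss) \<partial>gauss) = (\<integral>\<^sup>+ y. (\<integral>\<^sup>+ x. F x y \<partial>gauss) \<partial>gauss)"
proof -
  have "sets (borel \<Otimes>\<^sub>M borel :: ((real ^ 'n) \<times> (real ^ 'n)) measure) = sets (gauss \<Otimes>\<^sub>M gauss)"
    by (intro sets_pair_measure_cong) simp_all
  then have "(\<lambda>(x, y). F x y) \<in> borel_measurable (gauss \<Otimes>\<^sub>M gauss)"
    using assms measurable_cong_sets by blast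
  from gauss2.Fubini'[OF this] show ?thesis by simp
qed

lemma borel_measurable_gauss_section:
  fixes F :: "'a \<Rightarrow> real ^ 'n \<Rightarrow> ennreal"
  assumes "(\<lambda>(x, y). F x y) \<in> borel_measurable (M \<Otimes>\<^sub>M borel)"
  shows "(\<lambda>x. \<integral>\<^sup>+ y. F x y \<partial>gauss) \<in> borel_measurable M"
proof -
  have "sets (M \<Otimes>\<^sub>M borel) = sets (M \<Otimes>\<^sub>M (gauss :: (real ^ 'n) measure))"
    by (intro sets_pair_measure_cong) simp_all
  then have "(\<lambda>(x, y). F x y) \<in> borel_measurable (M \<Otimes>\<^sub>M gauss)"
    using assms measurable_cong_sets by blast
  then show ?thesis by (rule gauss.borel_measurable_nn_integral)
qed

definition kernel_op ::
  "(real ^ 'n \<Rightarrow> real ^ 'n \<Rightarrow> real) \<Rightarrow> (real ^ 'n \<Rightarrow> 'b) \<Rightarrow> real ^ 'n \<Rightarrow> 'b::{banach, second_countable_topology}"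
  where "kernel_op k f x = (LINT y|gauss. k x y *\<^sub>R f y)"

lemma Lp_nn_integral:
  assumes "f \<in> Lp p" "0 < p"
  shows "f \<in> borel_measurable borel" "0 \<le> Lp_norm p f"
    "(\<integral>\<^sub>\<gamma>x. norm (f x) powr p) = ennreal (Lp_norm p f powr p)"
proof -
  have f: "f \<in> borel_measurable gauss" "integrable gauss (\<lambda>x. norm (f x) powr p)"
    using assms by (auto simp: Lp_def)
  then show "f \<in> borel_measurable borel" by (simp add: borel_measurable_gauss_iff)
  show "0 \<le> Lp_norm p f" by (simp add: Lp_norm_def)
  show "(\<integral>\<^sub>\<gamma>x. norm (f x) powr p) = ennreal (Lp_norm p f powr p)"
    using f assms(2) by (subst nn_integral_eq_integral) (auto simp: Lp_norm_def powr_powr integral_nonneg_AE)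
qed

text \<open>
  Membership in \<open>Lp\<close> and the bound on the norm follow together from one bound on a nonnegative integral; in this form
  the estimates below never need integrability beforehand.
\<close>

lemma Lp_I:
  assumes f: "f \<in> borel_measurable borel" and p: "0 < p" and N: "0 \<le> N"
    and le: "(\<integral>\<^sub>\<gamma>x. norm (f x) powr p) \<le> ennreal (N powr p)"
  shows "f \<in> Lp p" "Lp_norm p f \<le> N"
proof -
  have fg: "f \<in> borel_measurable gauss" using f by (simp add: borel_measurable_gauss_iff)
  have i: "integrable gauss (\<lambda>x. norm (f x) powr p)"
  proof (rule integrableI_bounded)
    show "(\<lambda>x. norm (f x) powr p) \<in> borel_measurable gauss" using fg by measurable
    show "(\<integral>\<^sub>\<gamma>x. norm (norm (f x) powr p)) < \<infinity>"
      using le by (auto intro: le_less_trans)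
  qed
  then show *: "f \<in> Lp p" using fg by (simp add: Lp_def)
  have "ennreal (Lp_norm p f powr p) \<le> ennreal (N powr p)"
    using le Lp_nn_integral(3)[OF * p] by simp
  then have "Lp_norm p f powr p \<le> N powr p" by (simp add: ennreal_le_iff)
  then have "(Lp_norm p f powr p) powr (1 / p) \<le> (N powr p) powr (1 / p)"
    by (rule powr_mono2[rotated 2]) (use p in simp_all)
  then show "Lp_norm p f \<le> N" using p N by (simp add: powr_powr Lp_norm_def)
qed

lemma Lp_1_nn_integral:
  assumes "f \<in> Lp 1"
  shows "f \<in> borel_measurable borel" "integrable gauss f" "0 \<le> Lp_norm 1 f"
    "(\<integral>\<^sub>\<gamma>x. norm (f x)) = ennreal (Lp_norm 1 f)"
  using Lp_nn_integral[OF assms] assms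
  by (auto simp: Lp_def integrable_norm_iff)

lemma Lp_1_I:
  assumes f: "f \<in> borel_measurable borel" and N: "0 \<le> N"
    and le: "(\<integral>\<^sub>\<gamma>x. norm (f x)) \<le> ennreal N"
  shows "f \<in> Lp 1" "Lp_norm 1 f \<le> N"
  using Lp_I[OF f _ N, of 1] le N by auto

context one_sided_kernel
begin

lemma supp: "k x y \<noteq> 0 \<Longrightarrow> dist x y \<le> A * m_fun x"
  using size[of x y] nonneg[of x y] by (auto simp: riesz_def split: if_splits)

lemma total_integral: "\<exists>D>0. \<forall>x. (\<integral>\<^sub>\<gamma>y. k x y) \<le> ennreal D"
proof -
  obtain D where D: "0 < D" "\<And>x \<rho>. 0 < \<rho> \<Longrightarrow>
    (\<integral>\<^sub>\<gamma>y. k x y powr 1 * indicator {..\<rho>} (dist x y))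
      \<le> ennreal (D * vol x \<rho> powr (1 - 1 * (1 - \<beta>)))"
    using power_integral[of 1] \<beta> by auto
  show ?thesis
  proof (intro exI[of _ "D * (A ^ CARD('n)) powr \<beta>"] conjI allI)
    show "0 < D * (A ^ CARD('n)) powr \<beta>" using D A by simp
    fix x
    have "(\<integral>\<^sub>\<gamma>y. k x y) =
        (\<integral>\<^sub>\<gamma>y. k x y powr 1 * indicator {..A * m_fun x} (dist x y))"
      using supp[of x] nonneg[of x] by (intro nn_integral_cong) (auto simp: indicator_def)
    also have "\<dots> \<le> ennreal (D * vol x (A * m_fun x) powr (1 - 1 * (1 - \<beta>)))"
      using A by (intro D) auto
    also have "\<dots> \<le> ennreal (D * (A ^ CARD('n)) powr \<beta>)"
    proof (intro ennreal_leI mult_left_mono)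
      have "wt x * (A * m_fun x) ^ CARD('n) \<le> 1 * (A * 1) ^ CARD('n)"
        using A by (intro mult_mono power_mono mult_left_mono m_fun_le_1) auto
      then show "vol x (A * m_fun x) powr (1 - 1 * (1 - \<beta>)) \<le> (A ^ CARD('n)) powr \<beta>"
        using A \<beta> by (auto intro!: powr_mono2)
    qed (use D in auto)
    finally show "(\<integral>\<^sub>\<gamma>y. k x y) \<le> ennreal (D * (A ^ CARD('n)) powr \<beta>)" .
  qed
qed

lemma kernel_op_measurable [measurable]:
  fixes f :: "real ^ 'n \<Rightarrow> 'b::{banach, second_countable_topology}"
  assumes [measurable]: "f \<in> borel_measurable borel"
  shows "kernel_op k f \<in> borel_measurable borel"
proof -
  have "(\<lambda>(x, y). k x y *\<^sub>R f y) \<in> borel_measurable (borel \<Otimes>\<^sub>M borel)"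
    by measurable
  moreover have "sets (borel \<Otimes>\<^sub>M borel) = sets (borel \<Otimes>\<^sub>M (gauss :: (real ^ 'n) measure))"
    by (intro sets_pair_measure_cong) simp_all
  ultimately have "(\<lambda>(x, y). k x y *\<^sub>R f y) \<in> borel_measurable (borel \<Otimes>\<^sub>M gauss)"
    using measurable_cong_sets by blast
  then show ?thesis
    unfolding kernel_op_def by (rule gauss.borel_measurable_lebesgue_integral)
qed

lemma norm_kernel_op_le:
  "ennreal (norm (kernel_op k f x)) \<le> (\<integral>\<^sub>\<gamma>y. k x y * norm (f y))"
  using ennreal_norm_integral_le[of gauss "\<lambda>y. k x y *\<^sub>R f y"] nonneg by (simp add: kernel_op_def)

text \<open>
  Away from the singularity the kernel is bounded, so that the integral converges at every such point, not just
  almost everywhere. This gives a meaning to the value at the centre of the ball.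
\<close>

lemma far_integrable:
  fixes f :: "real ^ 'n \<Rightarrow> 'b::{banach, second_countable_topology}"
  assumes f: "integrable gauss f" and r: "0 < r" and x: "dist x c \<le> r"
  shows "integrable gauss (\<lambda>y. k x y *\<^sub>R (indicator {2 * r..} (dist c y) *\<^sub>R f y))"
proof -
  have [measurable]: "f \<in> borel_measurable borel"
    using borel_measurable_integrable[OF f] by (simp add: borel_measurable_gauss_iff)
  let ?M = "C * vol x r powr (\<beta> - 1)"
  show ?thesis
  proof (rule Bochner_Integration.integrable_bound)
    show "integrable gauss (\<lambda>y. ?M *\<^sub>R f y)" using f by simp
    show "(\<lambda>y. k x y *\<^sub>R (indicator {2 * r..} (dist c y) *\<^sub>R f y)) \<in> borel_measurable gauss"
      by measurable
    show "AE y in gauss. norm (k x y *\<^sub>R (indicator {2 * r..} (dist c y) *\<^sub>R f y)) \<le> norm (?M *\<^sub>R f y)"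
    proof (rule AE_I2)
      fix y
      show "norm (k x y *\<^sub>R (indicator {2 * r..} (dist c y) *\<^sub>R f y)) \<le> norm (?M *\<^sub>R f y)"
      proof (cases "2 * r \<le> dist c y")
        case True
        then have d: "r \<le> dist x y"
          using x dist_triangle[of c y x] by (simp add: dist_commute)
        have "k x y \<le> ?M"
        proof (cases "dist x y \<le> A * m_fun x")
          case True
          have "k x y \<le> C * vol x (dist x y) powr (\<beta> - 1)"
            using size[of x y] True by (simp add: riesz_def)
          also have "\<dots> \<le> ?M"
            using d r C \<beta> by (intro mult_left_mono powr_mono2' power_mono mult_pos_pos) auto
          finally show ?thesis .
        next
          case False
          then have "k x y = 0" using supp by blast
          then show ?thesis using C by simp
        qed
        then show ?thesis using True nonneg[of x y] C by (simp add: mult_right_mono)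
      qed simp
    qed
  qed
qed

end

text \<open>
  Regularity in both variables. The first is needed for oscillations of the image of a function, the second for the
  cancellation of atoms, and for bounds on \<open>L\<^sup>1\<close> by Fubini's theorem.
\<close>

locale fractional_kernel = L: one_sided_kernel \<beta> A C k + R: one_sided_kernel \<beta> A' C' "\<lambda>x y. k y x"
  for \<beta> A C A' C' :: real and k :: "real ^ 'n \<Rightarrow> real ^ 'n \<Rightarrow> real"
begin

abbreviation T :: "(real ^ 'n \<Rightarrow> 'b) \<Rightarrow> real ^ 'n \<Rightarrow> 'b::{banach, second_countable_topology}" where
  "T \<equiv> kernel_op k"

lemma nn_integral_L1:
  "\<exists>D>0. \<forall>h. h \<in> borel_measurable borel \<longrightarrow> (\<forall>y. 0 \<le> h y) \<longrightarrow>
    (\<integral>\<^sup>+ x. (\<integral>\<^sub>\<gamma>y. k x y * h y) \<partial>gauss) \<le> ennreal D * (\<integral>\<^sub>\<gamma>y. h y)"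
proof -
  obtain D where D: "0 < D" "\<And>y. (\<integral>\<^sub>\<gamma>x. k x y) \<le> ennreal D"
    using R.total_integral by blast
  show ?thesis
  proof (intro exI[of _ D] conjI allI impI D)
    fix h :: "real ^ 'n \<Rightarrow> real" assume [measurable]: "h \<in> borel_measurable borel" and h: "\<forall>y. 0 \<le> h y"
    have "(\<integral>\<^sup>+ x. (\<integral>\<^sub>\<gamma>y. k x y * h y) \<partial>gauss)
        = (\<integral>\<^sup>+ y. (\<integral>\<^sub>\<gamma>x. k x y * h y) \<partial>gauss)"
      by (rule gauss_Fubini) measurable
    also have "\<dots> = (\<integral>\<^sup>+ y. (\<integral>\<^sub>\<gamma>x. k x y) * ennreal (h y) \<partial>gauss)"
      using h by (intro nn_integral_cong) (simp add: ennreal_mult'' nn_integral_multc)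
    also have "\<dots> \<le> (\<integral>\<^sup>+ y. ennreal D * ennreal (h y) \<partial>gauss)"
      by (intro nn_integral_mono mult_right_mono D) auto
    also have "\<dots> = ennreal D * (\<integral>\<^sub>\<gamma>y. h y)"
      by (rule nn_integral_cmult) measurable
    finally show "(\<integral>\<^sup>+ x. (\<integral>\<^sub>\<gamma>y. k x y * h y) \<partial>gauss) \<le> ennreal D * (\<integral>\<^sub>\<gamma>y. h y)" .
  qed
qed

lemma L1_bound:
  fixes f :: "real ^ 'n \<Rightarrow> 'b::{banach, second_countable_topology}"
  shows "\<exists>D>0. \<forall>f :: real ^ 'n \<Rightarrow> 'b. f \<in> borel_measurable borel \<longrightarrow>
    (\<integral>\<^sub>\<gamma>x. norm (T f x)) \<le> ennreal D * (\<integral>\<^sub>\<gamma>y. norm (f y))"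
proof -
  obtain D where D: "0 < D" "\<And>h. h \<in> borel_measurable borel \<Longrightarrow> (\<forall>y. 0 \<le> h y) \<Longrightarrow>
    (\<integral>\<^sup>+ x. (\<integral>\<^sub>\<gamma>y. k x y * h y) \<partial>gauss) \<le> ennreal D * (\<integral>\<^sub>\<gamma>y. h y)"
    using nn_integral_L1 by blast
  show ?thesis
  proof (intro exI[of _ D] conjI allI impI D(1))
    fix f :: "real ^ 'n \<Rightarrow> 'b" assume [measurable]: "f \<in> borel_measurable borel"
    have "(\<integral>\<^sub>\<gamma>x. norm (T f x))
        \<le> (\<integral>\<^sup>+ x. (\<integral>\<^sub>\<gamma>y. k x y * norm (f y)) \<partial>gauss)"
      by (intro nn_integral_mono L.norm_kernel_op_le)
    also have "\<dots> \<le> ennreal D * (\<integral>\<^sub>\<gamma>y. norm (f y))"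
      by (rule D(2)) auto
    finally show "(\<integral>\<^sub>\<gamma>x. norm (T f x)) \<le> ennreal D * (\<integral>\<^sub>\<gamma>y. norm (f y))" .
  qed
qed

lemma AE_integrable:
  fixes f :: "real ^ 'n \<Rightarrow> 'b::{banach, second_countable_topology}"
  assumes f: "integrable gauss f"
  shows "AE x in gauss. integrable gauss (\<lambda>y. k x y *\<^sub>R f y)"
proof -
  have [measurable]: "f \<in> borel_measurable borel"
    using borel_measurable_integrable[OF f] by (simp add: borel_measurable_gauss_iff)
  obtain D where D: "0 < D" "\<And>h. h \<in> borel_measurable borel \<Longrightarrow> (\<forall>y. 0 \<le> h y) \<Longrightarrow>
    (\<integral>\<^sup>+ x. (\<integral>\<^sub>\<gamma>y. k x y * h y) \<partial>gauss) \<le> ennreal D * (\<integral>\<^sub>\<gamma>y. h y)"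
    using nn_integral_L1 by blast
  have "(\<integral>\<^sub>\<gamma>y. norm (f y)) < \<infinity>"
    using f by (simp add: integrable_iff_bounded)
  then have "(\<integral>\<^sup>+ x. (\<integral>\<^sub>\<gamma>y. k x y * norm (f y)) \<partial>gauss) < \<infinity>"
    using D(2)[of "\<lambda>y. norm (f y)"] by (auto simp: ennreal_mult_less_top intro: le_less_trans)
  moreover have "(\<lambda>x. \<integral>\<^sub>\<gamma>y. k x y * norm (f y)) \<in> borel_measurable borel"
    by (rule borel_measurable_gauss_section) measurable
  then have "(\<lambda>x. \<integral>\<^sub>\<gamma>y. k x y * norm (f y)) \<in> borel_measurable gauss"
    by (simp add: borel_measurable_gauss_iff)
  ultimately have "AE x in gauss. (\<integral>\<^sub>\<gamma>y. k x y * norm (f y)) \<noteq> \<infinity>"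
    by (intro nn_integral_noteq_infinite) auto
  then show ?thesis
  proof eventually_elim
    case (elim x)
    show ?case
    proof (rule integrableI_bounded)
      show "(\<lambda>y. k x y *\<^sub>R f y) \<in> borel_measurable gauss" by measurable
      show "(\<integral>\<^sub>\<gamma>y. norm (k x y *\<^sub>R f y)) < \<infinity>"
        using elim L.nonneg by (simp add: less_top)
    qed
  qed
qed

end

section \<open>Oscillation on balls\<close>

lemma ball_borel [measurable]: "ball (c :: 'a :: metric_space) r \<in> sets borel"
  by simp

lemma set_L1_le_Lp:
  fixes f :: "real ^ 'n \<Rightarrow> 'b::{banach, second_countable_topology}"
  assumes [measurable]: "f \<in> borel_measurable borel" "B \<in> sets borel" and p: "1 \<le> p" and N: "0 \<le> N"
    and f: "(\<integral>\<^sub>\<gamma>y. norm (f y) powr p) \<le> ennreal (N powr p)"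
    and W: "measure gauss B \<le> W" "0 < W"
  shows "(\<integral>\<^sub>\<gamma>y. indicator B y * norm (f y)) \<le> ennreal (W powr (1 - 1 / p) * N)"
proof -
  have "(\<integral>\<^sub>\<gamma>y. indicator B y * norm (f y))
      \<le> ennreal ((W powr (p - 1) * N powr p) powr (1 / p))"
  proof (rule nn_integral_jensen_root)
    show "(\<integral>\<^sub>\<gamma>y. indicator B y) \<le> ennreal W"
      using W by (simp add: ennreal_indicator gauss.emeasure_eq_measure ennreal_leI)
    have "(\<integral>\<^sub>\<gamma>y. indicator B y * norm (f y) powr p) \<le> (\<integral>\<^sub>\<gamma>y. norm (f y) powr p)"
      by (intro nn_integral_mono) (auto simp: indicator_def)
    also note f
    finally show "(\<integral>\<^sub>\<gamma>y. indicator B y * norm (f y) powr p) \<le> ennreal (N powr p)" .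
    show "(indicator B :: _ \<Rightarrow> real) \<in> borel_measurable gauss" "(\<lambda>y. norm (f y)) \<in> borel_measurable gauss"
      by measurable
  qed (use p W in auto)
  also have "(W powr (p - 1) * N powr p) powr (1 / p) = W powr (1 - 1 / p) * N"
    using p W N by (simp add: powr_mult powr_powr diff_divide_distrib)
  finally show ?thesis .
qed

context one_sided_kernel
begin

text \<open>
  \<open>power_integral\<close> with centre and density moved from \<open>x\<close> to the centre \<open>c\<close> of a ball near \<open>x\<close>.
\<close>

lemma ball_power_integral:
  assumes s: "0 < s" "s * (1 - \<beta>) < 1" and b: "0 < b"
  shows "\<exists>D>0. \<forall>c r x. 0 < r \<and> r \<le> b * m_fun c \<and> dist c x < 2 * r \<longrightarrow>
    (\<integral>\<^sub>\<gamma>y. k x y powr s * indicator (ball c (2 * r)) y)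
      \<le> ennreal (D * vol c r powr (1 - s * (1 - \<beta>)))"
proof -
  define \<theta> where "\<theta> = 1 - s * (1 - \<beta>)"
  have \<theta>: "0 < \<theta>" using s by (simp add: \<theta>_def)
  obtain D where D: "0 < D" "\<And>x \<rho>. 0 < \<rho> \<Longrightarrow>
    (\<integral>\<^sub>\<gamma>y. k x y powr s * indicator {..\<rho>} (dist x y))
      \<le> ennreal (D * vol x \<rho> powr \<theta>)"
    using power_integral[OF s] unfolding \<theta>_def by auto
  let ?e = "exp (2 * (2 * b) + (2 * b)\<^sup>2)"
  show ?thesis unfolding \<theta>_def[symmetric]
  proof (intro exI[of _ "D * (?e * 4 ^ CARD('n)) powr \<theta>"] conjI allI impI)
    show "0 < D * (?e * 4 ^ CARD('n)) powr \<theta>" using D by simp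
    fix c x :: "real ^ 'n" and r assume *: "0 < r \<and> r \<le> b * m_fun c \<and> dist c x < 2 * r"
    have "(\<integral>\<^sub>\<gamma>y. k x y powr s * indicator (ball c (2 * r)) y)
        \<le> (\<integral>\<^sub>\<gamma>y. k x y powr s * indicator {..4 * r} (dist x y))"
    proof (intro nn_integral_mono ennreal_leI mult_left_mono)
      fix y
      show "indicator (ball c (2 * r)) y \<le> (indicator {..4 * r} (dist x y) :: real)"
        using * dist_triangle[of x y c] by (auto simp: indicator_def dist_commute)
    qed simp
    also have "\<dots> \<le> ennreal (D * vol x (4 * r) powr \<theta>)"
      using * by (intro D) auto
    also have "\<dots> \<le> ennreal (D * ((?e * wt c) * (4 * r) ^ CARD('n)) powr \<theta>)"
    proof (intro ennreal_leI mult_left_mono powr_mono2 mult_right_mono)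
      show "wt x \<le> ?e * wt c" using * b by (intro wt_near1(1)) auto
    qed (use * D \<theta> in auto)
    also have "D * ((?e * wt c) * (4 * r) ^ CARD('n)) powr \<theta>
        = D * (?e * 4 ^ CARD('n)) powr \<theta> * vol c r powr \<theta>"
    proof -
      have "(?e * wt c) * (4 * r) ^ CARD('n) = (?e * 4 ^ CARD('n)) * vol c r"
        by (simp only: power_mult_distrib mult_ac)
      moreover have "\<dots> powr \<theta> = (?e * 4 ^ CARD('n)) powr \<theta> * vol c r powr \<theta>"
        by (rule powr_mult)
      ultimately show ?thesis by (simp only: mult.assoc)
    qed
    finally show "(\<integral>\<^sub>\<gamma>y. k x y powr s * indicator (ball c (2 * r)) y)
      \<le> ennreal (D * (?e * 4 ^ CARD('n)) powr \<theta> * vol c r powr \<theta>)" .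
  qed
qed

text \<open>
  Hoelder's inequality with the conjugate exponents \<open>1 / \<beta>\<close> and \<open>q\<close>, the second factor being controlled by
  Hoermander's condition. It is derived from \<open>nn_integral_jensen_root\<close> with the weight \<open>d powr q\<close>, where \<open>d\<close>
  is the difference of the kernels, by writing \<open>d * h\<close> as \<open>d powr q * (h * d powr (1 - q))\<close>.
\<close>

lemma far_oscillation:
  "\<exists>D>0. \<forall>c r x h N. 0 < r \<and> dist x c \<le> r \<and> h \<in> borel_measurable borel \<and> (\<forall>y. 0 \<le> h y) \<and> 0 \<le> N \<and>
     (\<integral>\<^sub>\<gamma>y. h y powr (1 / \<beta>)) \<le> ennreal (N powr (1 / \<beta>)) \<longrightarrow>
    (\<integral>\<^sub>\<gamma>y. \<bar>k x y - k c y\<bar> * indicator {2 * r..} (dist c y) * h y) \<le> ennreal (D * N)"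
proof -
  obtain D where D: "0 < D" "\<And>c x r. 0 < r \<and> dist x c \<le> r \<Longrightarrow>
    (\<integral>\<^sub>\<gamma>y. \<bar>k x y - k c y\<bar> powr q * indicator {2 * r..} (dist c y)) \<le> ennreal D"
    using hoermander by blast
  show ?thesis
  proof (intro exI[of _ "D powr (1 - \<beta>)"] conjI allI impI)
    show "0 < D powr (1 - \<beta>)" using D by simp
    fix c x :: "real ^ 'n" and r N :: real and h :: "real ^ 'n \<Rightarrow> real"
    assume *: "0 < r \<and> dist x c \<le> r \<and> h \<in> borel_measurable borel \<and> (\<forall>y. 0 \<le> h y) \<and> 0 \<le> N \<and>
     (\<integral>\<^sub>\<gamma>y. h y powr (1 / \<beta>)) \<le> ennreal (N powr (1 / \<beta>))"
    then have [measurable]: "h \<in> borel_measurable borel" by blast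
    define d where "d y = \<bar>k x y - k c y\<bar> * indicator {2 * r..} (dist c y)" for y
    have [measurable]: "d \<in> borel_measurable borel" unfolding d_def by measurable
    have d: "0 \<le> d y" for y by (simp add: d_def)
    have q1: "(1 - q) * (1 / \<beta>) = - q" using \<beta> by (simp add: q_def field_simps)
    have "(\<integral>\<^sub>\<gamma>y. d y * h y) = (\<integral>\<^sub>\<gamma>y. d y powr q * (h y * d y powr (1 - q)))"
    proof (intro nn_integral_cong arg_cong[where f = ennreal])
      fix y
      show "d y * h y = d y powr q * (h y * d y powr (1 - q))"
      proof (cases "d y = 0")
        case False
        then have "d y powr q * d y powr (1 - q) = d y" using d[of y] by (simp add: powr_add[symmetric])
        then show ?thesis by (metis mult.assoc mult.commute)
      qed simp
    qed
    also have "\<dots> \<le> ennreal ((D powr (1 / \<beta> - 1) * N powr (1 / \<beta>)) powr (1 / (1 / \<beta>)))"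
    proof (rule nn_integral_jensen_root)
      show "(\<integral>\<^sub>\<gamma>y. d y powr q) \<le> ennreal D"
      proof -
        have "d y powr q = \<bar>k x y - k c y\<bar> powr q * indicator {2 * r..} (dist c y)" for y
          by (simp add: d_def indicator_def)
        then show ?thesis using D(2)[of r x c] * by simp
      qed
      have "(\<integral>\<^sub>\<gamma>y. d y powr q * (h y * d y powr (1 - q)) powr (1 / \<beta>))
          \<le> (\<integral>\<^sub>\<gamma>y. h y powr (1 / \<beta>))"
      proof (intro nn_integral_mono ennreal_leI)
        fix y
        show "d y powr q * (h y * d y powr (1 - q)) powr (1 / \<beta>) \<le> h y powr (1 / \<beta>)"
        proof (cases "d y = 0")
          case False
          have "(h y * d y powr (1 - q)) powr (1 / \<beta>) = h y powr (1 / \<beta>) * d y powr (- q)"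
            by (simp only: powr_mult powr_powr q1)
          then have "d y powr q * (h y * d y powr (1 - q)) powr (1 / \<beta>)
              = h y powr (1 / \<beta>) * (d y powr q * d y powr (- q))" by simp
          also have "d y powr q * d y powr (- q) = 1" using False by (simp add: powr_add[symmetric])
          finally show ?thesis by simp
        qed simp
      qed
      also have "\<dots> \<le> ennreal (N powr (1 / \<beta>))" using * by blast
      finally show "(\<integral>\<^sub>\<gamma>y. d y powr q * (h y * d y powr (1 - q)) powr (1 / \<beta>))
          \<le> ennreal (N powr (1 / \<beta>))" .
      show "(\<lambda>y. d y powr q) \<in> borel_measurable gauss" "(\<lambda>y. h y * d y powr (1 - q)) \<in> borel_measurable gauss"
        by measurable
    qed (use * D \<beta> in auto)
    also have "(D powr (1 / \<beta> - 1) * N powr (1 / \<beta>)) powr (1 / (1 / \<beta>)) = D powr (1 - \<beta>) * N"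
      using * \<beta> by (simp add: powr_mult powr_powr left_diff_distrib)
    finally show "(\<integral>\<^sub>\<gamma>y. \<bar>k x y - k c y\<bar> * indicator {2 * r..} (dist c y) * h y)
      \<le> ennreal (D powr (1 - \<beta>) * N)" by (simp add: d_def)
  qed
qed

end

lemma integrable_from_Lp:
  fixes f :: "real ^ 'n \<Rightarrow> 'b::{banach, second_countable_topology}"
  assumes [measurable]: "f \<in> borel_measurable borel" and p: "1 \<le> p" and N: "0 \<le> N"
    and f: "(\<integral>\<^sub>\<gamma>y. norm (f y) powr p) \<le> ennreal (N powr p)"
  shows "integrable gauss f"
proof (rule integrableI_bounded)
  show "f \<in> borel_measurable gauss" by measurable
  have "(\<integral>\<^sub>\<gamma>y. indicator UNIV y * norm (f y))
      \<le> ennreal ((measure gauss (UNIV :: (real^'n) set) + 1) powr (1 - 1 / p) * N)"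
    by (rule set_L1_le_Lp) (use assms in \<open>auto simp: add_nonneg_pos\<close>)
  then show "(\<integral>\<^sub>\<gamma>y. norm (f y)) < \<infinity>"
    by (auto intro: le_less_trans)
qed

context fractional_kernel
begin

lemma near_L1:
  assumes b: "0 < b"
  shows "\<exists>D>0. \<forall>c r h. 0 < r \<and> r \<le> b * m_fun c \<and> h \<in> borel_measurable borel \<and> (\<forall>y. 0 \<le> h y) \<longrightarrow>
    (\<integral>\<^sup>+ x. (\<integral>\<^sub>\<gamma>y. k x y * (indicator (ball c (2 * r)) y * h y)) * indicator (ball c r) x \<partial>gauss)
      \<le> ennreal (D * vol c r powr \<beta>) * (\<integral>\<^sub>\<gamma>y. indicator (ball c (2 * r)) y * h y)"
proof -
  obtain D where D: "0 < D" "\<And>c r x. 0 < r \<and> r \<le> b * m_fun c \<and> dist c x < 2 * r \<Longrightarrow>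
    (\<integral>\<^sub>\<gamma>y. k y x powr 1 * indicator (ball c (2 * r)) y)
      \<le> ennreal (D * vol c r powr (1 - 1 * (1 - \<beta>)))"
    using R.ball_power_integral[of 1 b] R.\<beta> b by auto
  show ?thesis
  proof (intro exI[of _ D] conjI allI impI D(1))
    fix c :: "real ^ 'n" and r and h :: "real ^ 'n \<Rightarrow> real"
    assume *: "0 < r \<and> r \<le> b * m_fun c \<and> h \<in> borel_measurable borel \<and> (\<forall>y. 0 \<le> h y)"
    then have [measurable]: "h \<in> borel_measurable borel" by blast
    let ?B = "ball c (2 * r)"
    let ?J = "\<lambda>x y. k x y * (indicator ?B y * h y)"
    have "(\<integral>\<^sup>+ x. (\<integral>\<^sub>\<gamma>y. ?J x y) * indicator (ball c r) x \<partial>gauss)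
      = (\<integral>\<^sup>+ x. (\<integral>\<^sup>+ y. ennreal (?J x y) * indicator (ball c r) x \<partial>gauss) \<partial>gauss)"
      by (intro nn_integral_cong nn_integral_multc[symmetric]; measurable)
    also have "\<dots> = (\<integral>\<^sup>+ y. (\<integral>\<^sup>+ x. ennreal (?J x y) * indicator (ball c r) x \<partial>gauss) \<partial>gauss)"
      by (rule gauss_Fubini) measurable
    also have "\<dots> \<le> (\<integral>\<^sup>+ y. ennreal (D * vol c r powr \<beta>) * ennreal (indicator ?B y * h y) \<partial>gauss)"
    proof (rule nn_integral_mono)
      fix y
      show "(\<integral>\<^sup>+ x. ennreal (?J x y) * indicator (ball c r) x \<partial>gauss)
        \<le> ennreal (D * vol c r powr \<beta>) * ennreal (indicator ?B y * h y)"
      proof (cases "y \<in> ?B")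
        case True
        have "(\<integral>\<^sup>+ x. ennreal (?J x y) * indicator (ball c r) x \<partial>gauss)
          \<le> (\<integral>\<^sup>+ x. ennreal (k x y powr 1 * indicator ?B x) * ennreal (indicator ?B y * h y) \<partial>gauss)"
          proof (intro nn_integral_mono)
          fix x
          have z: "0 \<le> indicator ?B y * h y" using * by simp
          show "ennreal (?J x y) * indicator (ball c r) x
            \<le> ennreal (k x y powr 1 * indicator ?B x) * ennreal (indicator ?B y * h y)"
          proof (cases "x \<in> ball c r")
            case True
            then have "x \<in> ?B" using * by auto
            then have "k x y powr 1 * indicator ?B x = k x y" using L.nonneg[of x y] by simp
            then show ?thesis using True ennreal_mult''[OF z, of "k x y"] by simp
          qed simp
        qed
        also have "\<dots> = (\<integral>\<^sub>\<gamma>x. k x y powr 1 * indicator ?B x) * ennreal (indicator ?B y * h y)"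
          by (intro nn_integral_multc) measurable
        also have "\<dots> \<le> ennreal (D * vol c r powr (1 - 1 * (1 - \<beta>))) * ennreal (indicator ?B y * h y)"
          using * True by (intro mult_right_mono D(2)) auto
        finally show ?thesis by simp
      qed simp
    qed
    also have "\<dots> = ennreal (D * vol c r powr \<beta>) * (\<integral>\<^sub>\<gamma>y. indicator ?B y * h y)"
      by (rule nn_integral_cmult) measurable
    finally show "(\<integral>\<^sup>+ x. (\<integral>\<^sub>\<gamma>y. ?J x y) * indicator (ball c r) x \<partial>gauss)
      \<le> ennreal (D * vol c r powr \<beta>) * (\<integral>\<^sub>\<gamma>y. indicator ?B y * h y)" .
  qed
qed

text \<open>
  Split \<open>f\<close> at the ball of twice the radius. The far part changes on \<open>ball c r\<close> by at most a multiple of the norm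
  \<open>N\<close> of \<open>f\<close>, and \<open>v\<close> is its value at the centre. The near part is small in the mean, by Fubini's theorem: the kernel
  contributes \<open>\<mu> powr \<beta>\<close> and Hoelder's inequality for \<open>f\<close> contributes \<open>\<mu> powr (1 - \<beta>)\<close>, where \<open>\<mu>\<close> is the
  measure of the ball up to constants. The near part is kept apart in the second statement because its sign is what
  matters for \<open>BLO\<close>.
\<close>

lemma oscillation:
  assumes b: "0 < b"
  shows "\<exists>D>0. \<forall>c r N (f :: real ^ 'n \<Rightarrow> 'b::{banach, second_countable_topology}).
    0 < r \<and> r \<le> b * m_fun c \<and> f \<in> borel_measurable borel \<and> 0 \<le> N \<and>
     (\<integral>\<^sub>\<gamma>y. norm (f y) powr (1 / \<beta>)) \<le> ennreal (N powr (1 / \<beta>)) \<longrightarrow>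
    (\<exists>v. (\<integral>\<^sup>+ x. ennreal (norm (T f x - v)) * indicator (ball c r) x \<partial>gauss)
          \<le> ennreal (D * N * measure gauss (ball c r)) \<and>
      (AE x in gauss. x \<in> ball c r \<longrightarrow>
         norm (T f x - T (\<lambda>y. indicator (ball c (2 * r)) y *\<^sub>R f y) x - v) \<le> D * N))"
proof -
  obtain D1 where D1: "0 < D1" "\<And>c r h. 0 < r \<and> r \<le> b * m_fun c \<and> h \<in> borel_measurable borel \<and> (\<forall>y. 0 \<le> h y) \<Longrightarrow>
    (\<integral>\<^sup>+ x. (\<integral>\<^sub>\<gamma>y. k x y * (indicator (ball c (2 * r)) y * h y)) * indicator (ball c r) x \<partial>gauss)
      \<le> ennreal (D1 * vol c r powr \<beta>) * (\<integral>\<^sub>\<gamma>y. indicator (ball c (2 * r)) y * h y)"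
    using near_L1[OF b] by blast
  obtain D2 where D2: "0 < D2" "\<And>c r x h N. 0 < r \<and> dist x c \<le> r \<and> h \<in> borel_measurable borel \<and> (\<forall>y. 0 \<le> h y) \<and> 0 \<le> N \<and>
     (\<integral>\<^sub>\<gamma>y. h y powr (1 / \<beta>)) \<le> ennreal (N powr (1 / \<beta>)) \<Longrightarrow>
    (\<integral>\<^sub>\<gamma>y. \<bar>k x y - k c y\<bar> * indicator {2 * r..} (dist c y) * h y) \<le> ennreal (D2 * N)"
    using L.far_oscillation by blast
  have b2: "0 < 2 * b" using b by simp
  obtain C1 C2 where C12: "0 < C1" "0 < C2" "\<And>(c :: real ^ 'n) r. 0 < r \<and> r \<le> (2 * b) * m_fun c \<Longrightarrow>
    C1 * vol c r \<le> measure gauss (ball c r) \<and>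
    measure gauss (ball c r) \<le> C2 * vol c r"
    using measure_gauss_ball_bounds[OF b2, where ?'n = 'n] by blast
  define E where "E = D1 * (C2 * 2 ^ CARD('n)) powr (1 - \<beta>) / C1"
  have E: "0 < E" using D1 C12 by (simp add: E_def)
  show ?thesis
  proof (intro exI[of _ "E + D2"] conjI allI impI)
    show "0 < E + D2" using E D2 by simp
    fix c :: "real ^ 'n" and r N :: real and f :: "real ^ 'n \<Rightarrow> 'b"
    assume *: "0 < r \<and> r \<le> b * m_fun c \<and> f \<in> borel_measurable borel \<and> 0 \<le> N \<and>
     (\<integral>\<^sub>\<gamma>y. norm (f y) powr (1 / \<beta>)) \<le> ennreal (N powr (1 / \<beta>))"
    then have [measurable]: "f \<in> borel_measurable borel" by blast
    let ?B = "ball c r" and ?B2 = "ball c (2 * r)"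
    let ?\<mu> = "vol c r"
    let ?f1 = "\<lambda>y. indicator ?B2 y *\<^sub>R f y"
    let ?f2 = "\<lambda>y. indicator {2 * r..} (dist c y) *\<^sub>R f y"
    have \<mu>: "0 < ?\<mu>" using * by simp
    have f: "integrable gauss f"
      by (rule integrable_from_Lp[of _ "1 / \<beta>" N]) (use * L.\<beta> in auto)
    have f12: "f y = ?f1 y + ?f2 y" for y by (auto simp: indicator_def)
    define v where "v = T ?f2 c"
    \<comment> \<open>The centre \<open>x = c\<close> is included.\<close>
    have i2: "integrable gauss (\<lambda>y. k x y *\<^sub>R ?f2 y)" if "dist x c \<le> r" for x
      using L.far_integrable[OF f, of r x c] * that by simp
    have far: "norm (T ?f2 x - v) \<le> D2 * N" if x: "x \<in> ?B" for x
    proof -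
      have xc: "dist x c \<le> r" using x by (simp add: dist_commute)
      have "T ?f2 x - v = (LINT y|gauss. k x y *\<^sub>R ?f2 y - k c y *\<^sub>R ?f2 y)"
        unfolding v_def kernel_op_def by (rule Bochner_Integration.integral_diff[symmetric]) (use i2[OF xc] i2[of c] * in simp_all)
      also have "\<dots> = (LINT y|gauss. (k x y - k c y) *\<^sub>R ?f2 y)"
        by (simp only: scaleR_left_diff_distrib)
      finally have eq: "T ?f2 x - v = (LINT y|gauss. (k x y - k c y) *\<^sub>R ?f2 y)" .
      have "ennreal (norm (T ?f2 x - v)) \<le> (\<integral>\<^sub>\<gamma>y. norm ((k x y - k c y) *\<^sub>R ?f2 y))"
        unfolding eq by (rule ennreal_norm_integral_le)
      also have "\<dots> = (\<integral>\<^sub>\<gamma>y. \<bar>k x y - k c y\<bar> * indicator {2 * r..} (dist c y) * norm (f y))"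
        by (intro nn_integral_cong) (auto simp: indicator_def)
      also have "\<dots> \<le> ennreal (D2 * N)"
        using * xc by (intro D2(2)) auto
      finally show ?thesis using D2 * by (subst (asm) ennreal_le_iff) auto
    qed
    have split: "AE x in gauss. x \<in> ?B \<longrightarrow> T f x = T ?f1 x + T ?f2 x"
      using AE_integrable[OF f]
    proof eventually_elim
      case (elim x)
      show ?case
      proof
        assume x: "x \<in> ?B"
        then have i2': "integrable gauss (\<lambda>y. k x y *\<^sub>R ?f2 y)" by (intro i2) (simp add: dist_commute)
        have "k x y *\<^sub>R ?f1 y = k x y *\<^sub>R f y - k x y *\<^sub>R ?f2 y" for y
          by (subst (2) f12) (simp add: scaleR_add_right)
        then have i1: "integrable gauss (\<lambda>y. k x y *\<^sub>R ?f1 y)"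
          using Bochner_Integration.integrable_diff[OF elim i2'] by simp
        have "T f x = (LINT y|gauss. k x y *\<^sub>R ?f1 y + k x y *\<^sub>R ?f2 y)"
          unfolding kernel_op_def by (subst f12) (simp add: scaleR_add_right)
        also have "\<dots> = T ?f1 x + T ?f2 x"
          unfolding kernel_op_def using i1 i2' by (rule Bochner_Integration.integral_add)
        finally show "T f x = T ?f1 x + T ?f2 x" .
      qed
    qed
    have m: "C1 * ?\<mu> \<le> measure gauss ?B" "measure gauss ?B2 \<le> C2 * 2 ^ CARD('n) * ?\<mu>"
      using C12(3)[of r c] C12(3)[of "2 * r" c] * b by (auto simp: power_mult_distrib mult_ac)
    have near: "(\<integral>\<^sup>+ x. ennreal (norm (T ?f1 x)) * indicator ?B x \<partial>gauss) \<le> ennreal (E * N * measure gauss ?B)"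
    proof -
      have "(\<integral>\<^sup>+ x. ennreal (norm (T ?f1 x)) * indicator ?B x \<partial>gauss)
        \<le> (\<integral>\<^sup>+ x. (\<integral>\<^sub>\<gamma>y. k x y * (indicator ?B2 y * norm (f y))) * indicator ?B x \<partial>gauss)"
        using L.norm_kernel_op_le[of ?f1] by (intro nn_integral_mono mult_right_mono) auto
      also have "\<dots> \<le> ennreal (D1 * ?\<mu> powr \<beta>) * (\<integral>\<^sub>\<gamma>y. indicator ?B2 y * norm (f y))"
        using * by (intro D1(2)) auto
      also have "\<dots> \<le> ennreal (D1 * ?\<mu> powr \<beta>) * ennreal ((C2 * 2 ^ CARD('n) * ?\<mu>) powr (1 - 1 / (1 / \<beta>)) * N)"
        using * L.\<beta> m \<mu> C12 by (intro mult_left_mono set_L1_le_Lp) auto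
      also have "\<dots> = ennreal ((D1 * ?\<mu> powr \<beta>) * ((C2 * 2 ^ CARD('n) * ?\<mu>) powr (1 - 1 / (1 / \<beta>)) * N))"
        using D1 * by (simp add: ennreal_mult)
      also have "\<dots> \<le> ennreal (E * N * measure gauss ?B)"
      proof (rule ennreal_leI)
        have "(D1 * ?\<mu> powr \<beta>) * ((C2 * 2 ^ CARD('n) * ?\<mu>) powr (1 - 1 / (1 / \<beta>)) * N)
          = D1 * (C2 * 2 ^ CARD('n)) powr (1 - \<beta>) * N * (?\<mu> powr \<beta> * ?\<mu> powr (1 - \<beta>))"
          by (simp add: powr_mult[of "C2 * 2 ^ CARD('n)" ?\<mu>])
        also have "?\<mu> powr \<beta> * ?\<mu> powr (1 - \<beta>) = ?\<mu>"
          using \<mu> by (simp add: powr_add[symmetric])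
        also have "D1 * (C2 * 2 ^ CARD('n)) powr (1 - \<beta>) * N * ?\<mu> = E * N * (C1 * ?\<mu>)"
          using C12 by (simp add: E_def)
        also have "\<dots> \<le> E * N * measure gauss ?B"
          using m E * by (intro mult_left_mono) auto
        finally show "(D1 * ?\<mu> powr \<beta>) * ((C2 * 2 ^ CARD('n) * ?\<mu>) powr (1 - 1 / (1 / \<beta>)) * N)
          \<le> E * N * measure gauss ?B" .
      qed
      finally show ?thesis .
    qed
    show "\<exists>v. (\<integral>\<^sup>+ x. ennreal (norm (T f x - v)) * indicator ?B x \<partial>gauss)
          \<le> ennreal ((E + D2) * N * measure gauss ?B) \<and>
      (AE x in gauss. x \<in> ?B \<longrightarrow> norm (T f x - T ?f1 x - v) \<le> (E + D2) * N)"
    proof (intro exI[of _ v] conjI)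
      have "(\<integral>\<^sup>+ x. ennreal (norm (T f x - v)) * indicator ?B x \<partial>gauss)
        \<le> (\<integral>\<^sup>+ x. ennreal (norm (T ?f1 x)) * indicator ?B x + ennreal (D2 * N) * indicator ?B x \<partial>gauss)"
      proof (rule nn_integral_mono_AE, use split in eventually_elim)
        case (elim x)
        show ?case
        proof (cases "x \<in> ?B")
          case True
          then have "norm (T f x - v) \<le> norm (T ?f1 x) + D2 * N"
            using elim far[OF True] norm_triangle_ineq[of "T ?f1 x" "T ?f2 x - v"]
            by (simp add: add_diff_eq)
          then show ?thesis
            using True D2 * by (simp add: ennreal_plus[symmetric] ennreal_leI del: ennreal_plus)
        qed simp
      qed
      also have "\<dots> = (\<integral>\<^sup>+ x. ennreal (norm (T ?f1 x)) * indicator ?B x \<partial>gauss)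
          + ennreal (D2 * N) * emeasure gauss ?B"
        by (subst nn_integral_add) (simp_all add: nn_integral_cmult_indicator)
      also have "\<dots> \<le> ennreal (E * N * measure gauss ?B) + ennreal (D2 * N) * ennreal (measure gauss ?B)"
        using near by (intro add_mono) (simp_all add: gauss.emeasure_eq_measure)
      also have "\<dots> = ennreal ((E + D2) * N * measure gauss ?B)"
        using E D2 * by (simp add: ennreal_mult'[symmetric] ennreal_plus[symmetric] algebra_simps del: ennreal_plus)
      finally show "(\<integral>\<^sup>+ x. ennreal (norm (T f x - v)) * indicator ?B x \<partial>gauss)
          \<le> ennreal ((E + D2) * N * measure gauss ?B)" .
      show "AE x in gauss. x \<in> ?B \<longrightarrow> norm (T f x - T ?f1 x - v) \<le> (E + D2) * N"
        using split
      proof eventually_elim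
        case (elim x)
        have "0 \<le> E * N" using E * by simp
        then show ?case using elim far[of x] by (auto simp: distrib_right)
      qed
    qed
  qed
qed

end

section \<open>Bounds in BMO and BLO\<close>

lemma measure_gauss_ball_pos:
  fixes c :: "real ^ 'n"
  assumes "0 < r"
  shows "0 < measure gauss (ball c r)"
proof -
  have A: "0 < r / m_fun c" using assms by simp
  obtain C1 C2 where C: "0 < C1" "\<And>(c' :: real ^ 'n) r'. 0 < r' \<and> r' \<le> r / m_fun c * m_fun c' \<Longrightarrow>
    C1 * (wt c' * r' ^ CARD('n)) \<le> measure gauss (ball c' r') \<and>
    measure gauss (ball c' r') \<le> C2 * (wt c' * r' ^ CARD('n))"
    using measure_gauss_ball_bounds[OF A, where ?'n = 'n] by blast
  have "0 < C1 * vol c r" using C assms by simp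
  also have "\<dots> \<le> measure gauss (ball c r)" using C(2)[of r c] assms by simp
  finally show ?thesis .
qed

text \<open>
  Being close to any constant in the mean is as good as being close to the average, at the price of a factor \<open>2\<close>.
\<close>

lemma avg_oscillation:
  fixes h :: "real ^ 'n \<Rightarrow> 'b::{banach, second_countable_topology}"
  assumes h: "integrable gauss h" and [measurable]: "B \<in> sets borel" and B: "0 < measure gauss B"
    and D: "0 \<le> D"
    and osc: "(\<integral>\<^sup>+ x. ennreal (norm (h x - v)) * indicator B x \<partial>gauss) \<le> ennreal (D * measure gauss B)"
  shows "norm (avg B h - v) \<le> D" "avg B (\<lambda>x. norm (h x - avg B h)) \<le> 2 * D"
proof -
  have Bg: "B \<in> sets gauss" by simp
  have iB: "integrable gauss (\<lambda>x. indicator B x *\<^sub>R g x)" if "integrable gauss g"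
    for g :: "real ^ 'n \<Rightarrow> 'c::{banach, second_countable_topology}"
    using integrable_mult_indicator[OF Bg that] .
  have i1: "integrable gauss (\<lambda>x. h x - w)" for w
    using h by simp
  have cB: "(LINT x|gauss. indicator B x *\<^sub>R (w :: 'c::{banach, second_countable_topology})) = measure gauss B *\<^sub>R w" for w
    by (simp add: gauss.emeasure_eq_measure)
  have N: "(LINT x|gauss. indicator B x *\<^sub>R norm (h x - v)) \<le> D * measure gauss B"
  proof -
    have "ennreal (LINT x|gauss. indicator B x *\<^sub>R norm (h x - v))
        = (\<integral>\<^sub>\<gamma>x. indicator B x *\<^sub>R norm (h x - v))"
      by (rule nn_integral_eq_integral[symmetric]) (use iB[OF integrable_norm[OF i1]] in auto)
    also have "\<dots> = (\<integral>\<^sup>+ x. ennreal (norm (h x - v)) * indicator B x \<partial>gauss)"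
      by (intro nn_integral_cong) (auto simp: indicator_def)
    also note osc
    finally show ?thesis using D B by (subst (asm) ennreal_le_iff) auto
  qed
  have "avg B h - v = (LINT x|gauss. indicator B x *\<^sub>R (h x - v)) /\<^sub>R measure gauss B"
  proof -
    have "(LINT x|gauss. indicator B x *\<^sub>R (h x - v)) = (LINT x|gauss. indicator B x *\<^sub>R h x - indicator B x *\<^sub>R v)"
      by (simp only: scaleR_right_diff_distrib)
    also have "\<dots> = (LINT x|gauss. indicator B x *\<^sub>R h x) - measure gauss B *\<^sub>R v"
      unfolding cB[symmetric] by (rule Bochner_Integration.integral_diff) (use iB h in auto)
    finally show ?thesis
      using B by (simp add: avg_def set_lebesgue_integral_def scaleR_right_diff_distrib)
  qed
  also have "norm \<dots> \<le> (D * measure gauss B) / measure gauss B"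
  proof -
    have "norm (LINT x|gauss. indicator B x *\<^sub>R (h x - v)) \<le> (LINT x|gauss. norm (indicator B x *\<^sub>R (h x - v)))"
      by (rule integral_norm_bound)
    also have "\<dots> = (LINT x|gauss. indicator B x *\<^sub>R norm (h x - v))"
      by (intro Bochner_Integration.integral_cong) (auto simp: indicator_def)
    also note N
    finally show ?thesis using B by (simp add: divide_inverse_commute mult_left_mono)
  qed
  finally show 1: "norm (avg B h - v) \<le> D" using B by simp
  let ?w = "avg B h"
  have "(LINT x|gauss. indicator B x *\<^sub>R norm (h x - ?w))
      \<le> (LINT x|gauss. indicator B x *\<^sub>R norm (h x - v) + indicator B x *\<^sub>R D)"
  proof (rule integral_mono)
    show "integrable gauss (\<lambda>x. indicator B x *\<^sub>R norm (h x - ?w))"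
      by (intro iB integrable_norm i1)
    show "integrable gauss (\<lambda>x. indicator B x *\<^sub>R norm (h x - v) + indicator B x *\<^sub>R D)"
      by (intro Bochner_Integration.integrable_add iB integrable_norm i1) simp
    fix x
    have "norm (h x - ?w) \<le> norm (h x - v) + norm (?w - v)"
      using norm_triangle_ineq4[of "h x - v" "?w - v"] by simp
    then show "indicator B x *\<^sub>R norm (h x - ?w) \<le> indicator B x *\<^sub>R norm (h x - v) + indicator B x *\<^sub>R D"
      using 1 by (auto simp: indicator_def)
  qed
  also have "\<dots> = (LINT x|gauss. indicator B x *\<^sub>R norm (h x - v)) + measure gauss B *\<^sub>R D"
    unfolding cB[symmetric] by (rule Bochner_Integration.integral_add) (intro iB integrable_norm i1, intro iB, simp)
  also have "\<dots> \<le> 2 * D * measure gauss B" using N by simp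
  finally have "(LINT x|gauss. indicator B x *\<^sub>R norm (h x - ?w)) / measure gauss B \<le> 2 * D"
    using B by (simp add: divide_le_eq)
  then show "avg B (\<lambda>x. norm (h x - avg B h)) \<le> 2 * D"
    by (simp add: avg_def set_lebesgue_integral_def divide_inverse_commute)
qed

lemma BMO_I:
  fixes h :: "real ^ 'n \<Rightarrow> complex"
  assumes h: "h \<in> Lp 1" "Lp_norm 1 h \<le> E" and D: "0 \<le> D"
    and osc: "\<And>c r. 0 < r \<Longrightarrow> r \<le> m_fun c \<Longrightarrow>
      \<exists>v. (\<integral>\<^sup>+ x. ennreal (norm (h x - v)) * indicator (ball c r) x \<partial>gauss) \<le> ennreal (D * measure gauss (ball c r))"
  shows "h \<in> BMO" "BMO_norm h \<le> ereal (2 * D + E)"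
proof -
  have "(SUP B\<in>adm_balls 1. ereal (avg B (\<lambda>x. norm (h x - avg B h)))) \<le> ereal (2 * D)"
  proof (rule SUP_least)
    fix B :: "(real ^ 'n) set" assume "B \<in> adm_balls 1"
    then obtain c r where B: "B = ball c r" "0 < r" "r \<le> m_fun c" by (auto simp: adm_balls_def)
    then obtain v where "(\<integral>\<^sup>+ x. ennreal (norm (h x - v)) * indicator (ball c r) x \<partial>gauss) \<le> ennreal (D * measure gauss (ball c r))"
      using osc by blast
    then show "ereal (avg B (\<lambda>x. norm (h x - avg B h))) \<le> ereal (2 * D)"
      unfolding B using avg_oscillation(2)[OF Lp_1_nn_integral(2)[OF h(1)] _ measure_gauss_ball_pos[OF B(2)] D] by simp
  qed
  then have "BMO_norm h \<le> ereal (2 * D) + ereal E"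
    unfolding BMO_norm_def using h by (intro add_mono) auto
  then show *: "BMO_norm h \<le> ereal (2 * D + E)" by simp
  then have "BMO_norm h < \<infinity>" by (rule le_less_trans) simp
  then show "h \<in> BMO" using h by (simp add: BMO_def)
qed

lemma BLO_I:
  fixes h :: "real ^ 'n \<Rightarrow> real"
  assumes h: "h \<in> Lp 1" "Lp_norm 1 h \<le> E" and D: "0 \<le> D"
    and osc: "\<And>c r. 0 < r \<Longrightarrow> r \<le> a * m_fun c \<Longrightarrow>
      \<exists>v. (\<integral>\<^sup>+ x. ennreal (norm (h x - v)) * indicator (ball c r) x \<partial>gauss) \<le> ennreal (D * measure gauss (ball c r))
        \<and> (AE x in gauss. x \<in> ball c r \<longrightarrow> v - D \<le> h x)"
  shows "h \<in> BLO a" "BLO_norm a h \<le> ereal (E + 2 * D)"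
proof -
  have hm[measurable]: "h \<in> borel_measurable borel" using Lp_1_nn_integral[OF h(1)] by simp
  have "(SUP B\<in>adm_balls a. ereal (avg B h) - ess_inf_on B h) \<le> ereal (2 * D)"
  proof (rule SUP_least)
    fix B :: "(real ^ 'n) set" assume "B \<in> adm_balls a"
    then obtain c r where B: "B = ball c r" "0 < r" "r \<le> a * m_fun c" by (auto simp: adm_balls_def)
    then obtain v where v: "(\<integral>\<^sup>+ x. ennreal (norm (h x - v)) * indicator (ball c r) x \<partial>gauss) \<le> ennreal (D * measure gauss (ball c r))"
      "AE x in gauss. x \<in> ball c r \<longrightarrow> v - D \<le> h x"
      using osc by blast
    have "norm (avg B h - v) \<le> D"
      unfolding B using avg_oscillation(1)[OF Lp_1_nn_integral(2)[OF h(1)] _ measure_gauss_ball_pos[OF B(2)] D v(1)] by simp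
    then have av: "avg B h \<le> v + D" by (simp add: abs_le_iff)
    have "esssup (restrict_space gauss B) (\<lambda>x. - ereal (h x)) \<le> ereal (- (v - D))"
    proof (rule esssup_I)
      have "(\<lambda>x. - ereal (h x)) \<in> borel_measurable gauss" by measurable
      then show "(\<lambda>x. - ereal (h x)) \<in> borel_measurable (restrict_space gauss B)"
        by (rule measurable_restrict_space1)
      show "AE x in restrict_space gauss B. - ereal (h x) \<le> ereal (- (v - D))"
        using v(2) by (subst AE_restrict_space_iff) (auto simp: B)
    qed
    then have "ereal (v - D) \<le> ess_inf_on B h"
    proof -
      assume le: "esssup (restrict_space gauss B) (\<lambda>x. - ereal (h x)) \<le> ereal (- (v - D))"
      have e: "ereal (v - D) = - ereal (- (v - D))" by simp
      show ?thesis unfolding e ess_inf_on_def ereal_minus_le_minus by (rule le)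
    qed
    then have "ereal (avg B h) - ess_inf_on B h \<le> ereal (avg B h) - ereal (v - D)"
      by (intro ereal_minus_mono) auto
    also have "\<dots> \<le> ereal (2 * D)" using av by simp
    finally show "ereal (avg B h) - ess_inf_on B h \<le> ereal (2 * D)" .
  qed
  then have "BLO_norm a h \<le> ereal E + ereal (2 * D)"
    unfolding BLO_norm_def using h by (intro add_mono) auto
  then show *: "BLO_norm a h \<le> ereal (E + 2 * D)" by simp
  then have "BLO_norm a h < \<infinity>" by (rule le_less_trans) simp
  then show "h \<in> BLO a" using h by (simp add: BLO_def)
qed

context fractional_kernel
begin

lemma Lp_integrable:
  fixes f :: "real ^ 'n \<Rightarrow> 'b::{banach, second_countable_topology}"
  assumes "f \<in> Lp (1 / \<beta>)"
  shows "integrable gauss f"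
  using integrable_from_Lp[of f "1 / \<beta>" "Lp_norm (1 / \<beta>) f"] Lp_nn_integral[OF assms] L.\<beta> by simp

lemma Lp_L1_bounded:
  "\<exists>D>0. \<forall>f \<in> (Lp (1 / \<beta>) :: (real ^ 'n \<Rightarrow> 'b::{banach, second_countable_topology}) set).
     T f \<in> Lp 1 \<and> Lp_norm 1 (T f) \<le> D * Lp_norm (1 / \<beta>) f"
proof -
  obtain D where D0: "0 < D" "\<forall>f :: real ^ 'n \<Rightarrow> 'b. f \<in> borel_measurable borel \<longrightarrow>
    (\<integral>\<^sub>\<gamma>x. norm (T f x)) \<le> ennreal D * (\<integral>\<^sub>\<gamma>y. norm (f y))"
    using L1_bound[where ?'b = 'b] by (elim exE conjE)
  note D = D0(1) D0(2)[rule_format]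
  define M where "M = (measure gauss (UNIV :: (real ^ 'n) set) + 1) powr (1 - \<beta>)"
  have M1: "0 < measure gauss (UNIV :: (real ^ 'n) set) + 1"
    by (simp add: add_nonneg_pos)
  then have M: "0 < M" by (simp add: M_def)
  show ?thesis
  proof (intro exI[of _ "D * M"] conjI ballI)
    show "0 < D * M" using D M by simp
    fix f :: "real ^ 'n \<Rightarrow> 'b" assume f: "f \<in> Lp (1 / \<beta>)"
    have p: "0 < 1 / \<beta>" using L.\<beta> by simp
    note [measurable] = Lp_nn_integral(1)[OF f p]
    have "(\<integral>\<^sub>\<gamma>y. indicator UNIV y * norm (f y)) \<le>
        ennreal ((measure gauss (UNIV :: (real ^ 'n) set) + 1) powr (1 - 1 / (1 / \<beta>)) * Lp_norm (1 / \<beta>) f)"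
      by (rule set_L1_le_Lp) (use Lp_nn_integral[OF f p] L.\<beta> M1 in auto)
    then have 1: "(\<integral>\<^sub>\<gamma>y. norm (f y)) \<le> ennreal (M * Lp_norm (1 / \<beta>) f)"
      by (simp add: M_def)
    have "(\<integral>\<^sub>\<gamma>x. norm (T f x)) \<le> ennreal D * ennreal (M * Lp_norm (1 / \<beta>) f)"
      by (rule order_trans[OF D(2) mult_left_mono[OF 1]]) auto
    also have "\<dots> = ennreal (D * M * Lp_norm (1 / \<beta>) f)"
      using D by (simp add: ennreal_mult'[symmetric] mult.assoc)
    finally have "(\<integral>\<^sub>\<gamma>x. norm (T f x)) \<le> ennreal (D * M * Lp_norm (1 / \<beta>) f)" .
    moreover have "0 \<le> D * M * Lp_norm (1 / \<beta>) f" using D M Lp_nn_integral(2)[OF f p] by simp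
    moreover have "T f \<in> borel_measurable borel" by measurable
    ultimately show "T f \<in> Lp 1" "Lp_norm 1 (T f) \<le> D * M * Lp_norm (1 / \<beta>) f"
      using Lp_1_I by blast+
  qed
qed

lemma BMO_bounded:
  "bounded_op (Lp (1 / \<beta>) :: (real ^ 'n \<Rightarrow> complex) set) (\<lambda>f. ereal (Lp_norm (1 / \<beta>) f)) BMO BMO_norm T"
proof -
  obtain D1 where D10: "0 < D1" "\<forall>f \<in> (Lp (1 / \<beta>) :: (real ^ 'n \<Rightarrow> complex) set).
     T f \<in> Lp 1 \<and> Lp_norm 1 (T f) \<le> D1 * Lp_norm (1 / \<beta>) f"
    using Lp_L1_bounded[where ?'b = complex] by (elim exE conjE)
  note D1 = D10(1) D10(2)[rule_format]
  obtain D2 where D20: "0 < D2" "\<forall>c r N (f :: real ^ 'n \<Rightarrow> complex).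
    0 < r \<and> r \<le> 1 * m_fun c \<and> f \<in> borel_measurable borel \<and> 0 \<le> N \<and>
     (\<integral>\<^sub>\<gamma>y. norm (f y) powr (1 / \<beta>)) \<le> ennreal (N powr (1 / \<beta>)) \<longrightarrow>
    (\<exists>v. (\<integral>\<^sup>+ x. ennreal (norm (T f x - v)) * indicator (ball c r) x \<partial>gauss)
          \<le> ennreal (D2 * N * measure gauss (ball c r)) \<and>
      (AE x in gauss. x \<in> ball c r \<longrightarrow>
         norm (T f x - T (\<lambda>y. indicator (ball c (2 * r)) y *\<^sub>R f y) x - v) \<le> D2 * N))"
    using oscillation[OF zero_less_one, where ?'b = complex] by (elim exE conjE)
  note D2 = D20(1) D20(2)[rule_format]
  have p: "0 < 1 / \<beta>" using L.\<beta> by simp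
  show ?thesis unfolding bounded_op_def
  proof (intro exI[of _ "2 * D2 + D1"] conjI ballI)
    show "0 \<le> 2 * D2 + D1" using D1 D2 by simp
    fix f :: "real ^ 'n \<Rightarrow> complex" assume f: "f \<in> Lp (1 / \<beta>)"
    let ?N = "Lp_norm (1 / \<beta>) f"
    have osc: "\<exists>v. (\<integral>\<^sup>+ x. ennreal (norm (T f x - v)) * indicator (ball c r) x \<partial>gauss)
          \<le> ennreal (D2 * ?N * measure gauss (ball c r))" if "0 < r" "r \<le> m_fun c" for c r
      using D2(2)[of r c f ?N] that Lp_nn_integral[OF f p] by auto
    have "0 \<le> D2 * ?N" using D2 Lp_nn_integral(2)[OF f p] by simp
    note B = BMO_I[OF conjunct1[OF D1(2)[OF f]] conjunct2[OF D1(2)[OF f]] this osc]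
    show "T f \<in> BMO" using B by blast
    have "BMO_norm (T f) \<le> ereal (2 * (D2 * ?N) + D1 * ?N)" using B by blast
    then show "BMO_norm (T f) \<le> ereal (2 * D2 + D1) * ereal ?N"
      by (simp add: algebra_simps)
  qed
qed

text \<open>
  For nonnegative \<open>f\<close> the near part in \<open>oscillation\<close> is nonnegative, so that the image of \<open>f\<close> stays above \<open>v\<close> up to a
  multiple of the norm, and so does its essential infimum.
\<close>

lemma BLO_bounded:
  assumes a: "0 < a"
  shows "bounded_op {f \<in> (Lp (1 / \<beta>) :: (real ^ 'n \<Rightarrow> real) set). AE x in gauss. 0 \<le> f x}
    (\<lambda>f. ereal (Lp_norm (1 / \<beta>) f)) (BLO a) (BLO_norm a) T"
proof -
  obtain D1 where D10: "0 < D1" "\<forall>f \<in> (Lp (1 / \<beta>) :: (real ^ 'n \<Rightarrow> real) set).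
     T f \<in> Lp 1 \<and> Lp_norm 1 (T f) \<le> D1 * Lp_norm (1 / \<beta>) f"
    using Lp_L1_bounded[where ?'b = real] by (elim exE conjE)
  note D1 = D10(1) D10(2)[rule_format]
  obtain D2 where D20: "0 < D2" "\<forall>c r N (f :: real ^ 'n \<Rightarrow> real).
    0 < r \<and> r \<le> a * m_fun c \<and> f \<in> borel_measurable borel \<and> 0 \<le> N \<and>
     (\<integral>\<^sub>\<gamma>y. norm (f y) powr (1 / \<beta>)) \<le> ennreal (N powr (1 / \<beta>)) \<longrightarrow>
    (\<exists>v. (\<integral>\<^sup>+ x. ennreal (norm (T f x - v)) * indicator (ball c r) x \<partial>gauss)
          \<le> ennreal (D2 * N * measure gauss (ball c r)) \<and>
      (AE x in gauss. x \<in> ball c r \<longrightarrow>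
         norm (T f x - T (\<lambda>y. indicator (ball c (2 * r)) y *\<^sub>R f y) x - v) \<le> D2 * N))"
    using oscillation[OF a, where ?'b = real] by (elim exE conjE)
  note D2 = D20(1) D20(2)[rule_format]
  have p: "0 < 1 / \<beta>" using L.\<beta> by simp
  show ?thesis unfolding bounded_op_def
  proof (intro exI[of _ "D1 + 2 * D2"] conjI ballI)
    show "0 \<le> D1 + 2 * D2" using D1 D2 by simp
    fix f :: "real ^ 'n \<Rightarrow> real" assume "f \<in> {f \<in> Lp (1 / \<beta>). AE x in gauss. 0 \<le> f x}"
    then have f: "f \<in> Lp (1 / \<beta>)" and pos: "AE x in gauss. 0 \<le> f x" by auto
    let ?N = "Lp_norm (1 / \<beta>) f"
    have osc: "\<exists>v. (\<integral>\<^sup>+ x. ennreal (norm (T f x - v)) * indicator (ball c r) x \<partial>gauss)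
          \<le> ennreal (D2 * ?N * measure gauss (ball c r)) \<and>
          (AE x in gauss. x \<in> ball c r \<longrightarrow> v - D2 * ?N \<le> T f x)" if r: "0 < r" "r \<le> a * m_fun c" for c r
    proof -
      obtain v where v: "(\<integral>\<^sup>+ x. ennreal (norm (T f x - v)) * indicator (ball c r) x \<partial>gauss)
          \<le> ennreal (D2 * ?N * measure gauss (ball c r))"
        "AE x in gauss. x \<in> ball c r \<longrightarrow>
         norm (T f x - T (\<lambda>y. indicator (ball c (2 * r)) y *\<^sub>R f y) x - v) \<le> D2 * ?N"
        using D2(2)[of r c f ?N] r Lp_nn_integral[OF f p] by auto
      have near_nonneg: "0 \<le> T (\<lambda>y. indicator (ball c (2 * r)) y *\<^sub>R f y) x" for x
        unfolding kernel_op_def using pos L.nonneg[of x] by (intro integral_nonneg_AE) (auto elim!: eventually_mono)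
      have "AE x in gauss. x \<in> ball c r \<longrightarrow> v - D2 * ?N \<le> T f x"
        using v(2)
      proof eventually_elim
        case (elim x)
        show ?case
        proof
          assume "x \<in> ball c r"
          then have "\<bar>T f x - T (\<lambda>y. indicator (ball c (2 * r)) y *\<^sub>R f y) x - v\<bar> \<le> D2 * ?N"
            using elim by simp
          then show "v - D2 * ?N \<le> T f x"
            using near_nonneg[of x] by linarith
        qed
      qed
      then show ?thesis using v(1) by blast
    qed
    have "0 \<le> D2 * ?N" using D2 Lp_nn_integral(2)[OF f p] by simp
    note B = BLO_I[OF conjunct1[OF D1(2)[OF f]] conjunct2[OF D1(2)[OF f]] this osc]
    show "T f \<in> BLO a" using B by blast
    have "BLO_norm a (T f) \<le> ereal (D1 * ?N + 2 * (D2 * ?N))" using B by blast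
    then show "BLO_norm a (T f) \<le> ereal (D1 + 2 * D2) * ereal ?N"
      by (simp add: algebra_simps)
  qed
qed

end

section \<open>Atoms\<close>

text \<open>
  An atom normalised in \<open>L\<^sup>r\<close> is, on its ball, also normalised for every smaller exponent.
\<close>

lemma nn_integral_power_atom:
  fixes g :: "real ^ 'n \<Rightarrow> complex"
  assumes g: "g \<in> Lp r" "AE x in gauss. x \<notin> B \<longrightarrow> g x = 0"
    and norm: "Lp_norm r g \<le> measure gauss B powr (1 / r - 1)"
    and [measurable]: "B \<in> sets borel" and B: "0 < measure gauss B" and p: "1 \<le> p" "p \<le> r"
  shows "(\<integral>\<^sub>\<gamma>x. norm (g x) powr p) \<le> ennreal (measure gauss B powr (1 - p))"
proof -
  let ?\<mu> = "measure gauss B"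
  have r: "0 < r" using p by simp
  note [measurable] = Lp_nn_integral(1)[OF g(1) r]
  have "(\<integral>\<^sub>\<gamma>x. norm (g x) powr p) = (\<integral>\<^sub>\<gamma>x. indicator B x * norm (g x) powr p)"
    using g(2) by (intro nn_integral_cong_AE) (auto elim!: eventually_mono simp: indicator_def)
  also have "\<dots> \<le> ennreal ((?\<mu> powr (r / p - 1) * ?\<mu> powr (1 - r)) powr (1 / (r / p)))"
  proof (rule nn_integral_jensen_root)
    show "(\<integral>\<^sub>\<gamma>y. indicator B y) \<le> ennreal ?\<mu>"
      by (simp add: ennreal_indicator gauss.emeasure_eq_measure)
    have "(\<integral>\<^sub>\<gamma>x. indicator B x * (norm (g x) powr p) powr (r / p))
        \<le> (\<integral>\<^sub>\<gamma>x. norm (g x) powr r)"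
      using p by (intro nn_integral_mono) (auto simp: indicator_def powr_powr)
    also have "\<dots> = ennreal (Lp_norm r g powr r)" by (rule Lp_nn_integral(3)[OF g(1) r])
    also have "\<dots> \<le> ennreal ((?\<mu> powr (1 / r - 1)) powr r)"
      using norm r Lp_nn_integral(2)[OF g(1) r] by (intro ennreal_leI powr_mono2) auto
    also have "(?\<mu> powr (1 / r - 1)) powr r = ?\<mu> powr (1 - r)"
      using r by (simp add: powr_powr left_diff_distrib)
    finally show "(\<integral>\<^sub>\<gamma>x. indicator B x * (norm (g x) powr p) powr (r / p)) \<le> ennreal (?\<mu> powr (1 - r))" .
    show "(indicator B :: _ \<Rightarrow> real) \<in> borel_measurable gauss" "(\<lambda>x. norm (g x) powr p) \<in> borel_measurable gauss"
      by measurable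
  qed (use p B in auto)
  also have "(?\<mu> powr (r / p - 1) * ?\<mu> powr (1 - r)) powr (1 / (r / p)) = ?\<mu> powr (1 - p)"
  proof -
    have "(r / p - 1 + (1 - r)) * (1 / (r / p)) = 1 - p" using p by (simp add: field_simps)
    then show ?thesis by (simp only: powr_add[symmetric] powr_powr)
  qed
  finally show ?thesis .
qed

context fractional_kernel
begin

abbreviation q where "q \<equiv> L.q"

lemma constant_atom:
  "\<exists>D>0. \<forall>b :: real ^ 'n \<Rightarrow> complex. b \<in> borel_measurable borel \<and> (AE x in gauss. b x = 1) \<longrightarrow>
    (\<integral>\<^sub>\<gamma>x. norm (T b x) powr q) \<le> ennreal D"
proof -
  obtain D where D: "0 < D" "\<And>x. (\<integral>\<^sub>\<gamma>y. k x y) \<le> ennreal D"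
    using L.total_integral by blast
  show ?thesis
  proof (intro exI[of _ "D powr q * (measure gauss (UNIV :: (real ^ 'n) set) + 1)"] conjI allI impI)
    show "0 < D powr q * (measure gauss (UNIV :: (real ^ 'n) set) + 1)"
      using D by (intro mult_pos_pos) (auto simp: add_nonneg_pos)
    fix b :: "real ^ 'n \<Rightarrow> complex"
    assume b: "b \<in> borel_measurable borel \<and> (AE x in gauss. b x = 1)"
    have pt: "norm (T b x) powr q \<le> D powr q" for x
    proof -
      have "ennreal (norm (T b x)) \<le> (\<integral>\<^sub>\<gamma>y. k x y * norm (b y))"
        by (rule L.norm_kernel_op_le)
      also have "\<dots> = (\<integral>\<^sub>\<gamma>y. k x y)"
        using b by (intro nn_integral_cong_AE) (auto elim!: eventually_mono)
      also note D(2)[of x]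
      finally have "norm (T b x) \<le> D" using D by (subst (asm) ennreal_le_iff) auto
      then show ?thesis using L.q by (intro powr_mono2) auto
    qed
    have "(\<integral>\<^sub>\<gamma>x. norm (T b x) powr q) \<le> (\<integral>\<^sup>+ x. ennreal (D powr q) \<partial>(gauss :: (real ^ 'n) measure))"
      by (intro nn_integral_mono ennreal_leI pt)
    also have "\<dots> = ennreal (D powr q * measure gauss (UNIV :: (real ^ 'n) set))"
      by (simp add: gauss.emeasure_eq_measure ennreal_mult')
    also have "\<dots> \<le> ennreal (D powr q * (measure gauss (UNIV :: (real ^ 'n) set) + 1))"
      by (intro ennreal_leI mult_left_mono) auto
    finally show "(\<integral>\<^sub>\<gamma>x. norm (T b x) powr q)
      \<le> ennreal (D powr q * (measure gauss (UNIV :: (real ^ 'n) set) + 1))" .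
  qed
qed

text \<open>
  On the ball of twice the radius only the size of the atom is used. This is Young's inequality for convolutions:
  since \<open>p > 1\<close>, the exponents \<open>1\<close> and \<open>t = q / p\<close> at which the kernel enters are below the critical exponent
  \<open>q\<close>, so that both integrals of powers of the kernel converge. All powers of the measure \<open>\<mu>\<close> of the ball cancel,
  whence the bound does not depend on the ball.
\<close>

lemma atom_near:
  assumes p: "1 < p" "p \<le> q"
  shows "\<exists>D>0. \<forall>c \<rho> (g :: real ^ 'n \<Rightarrow> complex).
    0 < \<rho> \<and> \<rho> \<le> m_fun c \<and> g \<in> borel_measurable borel \<and> (AE x in gauss. x \<notin> ball c \<rho> \<longrightarrow> g x = 0) \<and>
    (\<integral>\<^sub>\<gamma>x. norm (g x) powr p) \<le> ennreal (measure gauss (ball c \<rho>) powr (1 - p)) \<longrightarrow>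
    (\<integral>\<^sup>+ x. ennreal (norm (T g x) powr q) * indicator (ball c (2 * \<rho>)) x \<partial>gauss) \<le> ennreal D"
proof -
  define t where "t = q / p"
  have t: "1 \<le> t" "t * (1 - \<beta>) = 1 / p" using p L.q by (auto simp: t_def mult.commute)
  have t1: "t * (1 - \<beta>) < 1" using p t by simp
  obtain D1 where D1: "0 < D1" "\<And>c r x. 0 < r \<and> r \<le> 1 * m_fun c \<and> dist c x < 2 * r \<Longrightarrow>
    (\<integral>\<^sub>\<gamma>y. k x y powr 1 * indicator (ball c (2 * r)) y)
      \<le> ennreal (D1 * vol c r powr (1 - 1 * (1 - \<beta>)))"
    using L.ball_power_integral[of 1 1] L.\<beta> by auto
  have t0: "0 < t" using t by simp
  obtain D2 where D20: "0 < D2" "\<forall>c r x. 0 < r \<and> r \<le> 1 * m_fun c \<and> dist c x < 2 * r \<longrightarrow>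
    (\<integral>\<^sub>\<gamma>y. k y x powr t * indicator (ball c (2 * r)) y)
      \<le> ennreal (D2 * vol c r powr (1 - t * (1 - \<beta>)))"
    using R.ball_power_integral[OF t0 t1 zero_less_one] by (elim exE conjE)
  note D2 = D20(1) D20(2)[rule_format]
  obtain C1 C2 where C12: "0 < C1" "\<And>(c :: real ^ 'n) r. 0 < r \<and> r \<le> 1 * m_fun c \<Longrightarrow>
    C1 * vol c r \<le> measure gauss (ball c r) \<and>
    measure gauss (ball c r) \<le> C2 * vol c r"
    using measure_gauss_ball_bounds[OF zero_less_one, where ?'n = 'n] by blast
  define D3 where "D3 = C1 powr (1 - p)"
  have D3: "0 < D3" using C12 by (simp add: D3_def)
  define E where "E = (D1 powr (p - 1)) powr t * (D3 powr (t - 1) * (D3 * D2))"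
  show ?thesis
  proof (intro exI[of _ E] conjI allI impI)
    show "0 < E" using D1 D2 D3 by (simp add: E_def)
    fix c :: "real ^ 'n" and \<rho> and g :: "real ^ 'n \<Rightarrow> complex"
    assume *: "0 < \<rho> \<and> \<rho> \<le> m_fun c \<and> g \<in> borel_measurable borel \<and> (AE x in gauss. x \<notin> ball c \<rho> \<longrightarrow> g x = 0) \<and>
      (\<integral>\<^sub>\<gamma>x. norm (g x) powr p) \<le> ennreal (measure gauss (ball c \<rho>) powr (1 - p))"
    then have [measurable]: "g \<in> borel_measurable borel" by blast
    define \<mu> where "\<mu> = vol c \<rho>"
    have \<mu>: "0 < \<mu>" using * by (simp add: \<mu>_def)
    let ?B = "ball c (2 * \<rho>)"
    let ?J = "\<lambda>x y. norm (g y) powr p * (k x y * indicator ?B y) powr t * indicator ?B x"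
    define W where "W = D1 * \<mu> powr \<beta>"
    have W: "0 < W" using D1 \<mu> by (simp add: W_def)
    define Z where "Z = D3 * \<mu> powr (1 - p)"
    have Z: "0 < Z" using D3 \<mu> by (simp add: Z_def)
    have gZ: "(\<integral>\<^sub>\<gamma>y. norm (g y) powr p) \<le> ennreal Z"
    proof -
      have "measure gauss (ball c \<rho>) powr (1 - p) \<le> (C1 * \<mu>) powr (1 - p)"
        using C12(2)[of \<rho> c] * p C12(1) \<mu> by (intro powr_mono2') (auto simp: \<mu>_def)
      also have "\<dots> = Z" by (simp add: Z_def D3_def powr_mult)
      finally show ?thesis using * ennreal_leI order_trans by blast
    qed
    have pt: "ennreal (norm (T g x) powr q) * indicator ?B x \<le>
        ennreal ((W powr (p - 1)) powr t * Z powr (t - 1)) *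
          (\<integral>\<^sub>\<gamma>y. ?J x y)" for x
    proof (cases "x \<in> ?B")
      case x: True
      let ?u = "norm (T g x)"
      have "ennreal ?u \<le> (\<integral>\<^sub>\<gamma>y. k x y * norm (g y))"
        by (rule L.norm_kernel_op_le)
      also have "\<dots> = (\<integral>\<^sub>\<gamma>y. (k x y * indicator ?B y) * norm (g y))"
      proof (rule nn_integral_cong_AE)
        have "AE y in gauss. y \<notin> ball c \<rho> \<longrightarrow> g y = 0" using * by blast
        then show "AE y in gauss. ennreal (k x y * norm (g y)) = ennreal ((k x y * indicator ?B y) * norm (g y))"
        proof eventually_elim
          case (elim y)
          show ?case using elim * by (cases "y \<in> ball c \<rho>") auto
        qed
      qed
      finally have u: "ennreal ?u \<le> (\<integral>\<^sub>\<gamma>y. (k x y * indicator ?B y) * norm (g y))" .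
      have 1: "ennreal (?u powr p) \<le> ennreal (W powr (p - 1)) *
          (\<integral>\<^sub>\<gamma>y. (k x y * indicator ?B y) * norm (g y) powr p)"
      proof (rule nn_integral_jensen[OF _ _ _ _ _ _ u])
        have "(\<integral>\<^sub>\<gamma>y. k x y * indicator ?B y) = (\<integral>\<^sub>\<gamma>y. k x y powr 1 * indicator ?B y)"
          using L.nonneg by (intro nn_integral_cong) simp
        also have "\<dots> \<le> ennreal (D1 * vol c \<rho> powr (1 - 1 * (1 - \<beta>)))"
          using * x by (intro D1(2)) auto
        finally show "(\<integral>\<^sub>\<gamma>y. k x y * indicator ?B y) \<le> ennreal W"
          by (simp add: W_def \<mu>_def)
        show "(\<lambda>y. k x y * indicator ?B y) \<in> borel_measurable gauss" "(\<lambda>y. norm (g y)) \<in> borel_measurable gauss"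
          by measurable
      qed (use p W L.nonneg in auto)
      \<comment> \<open>Dividing out the constant puts the first estimate into the form required by the second.\<close>
      define u' where "u' = ?u powr p / W powr (p - 1)"
      have u'0: "0 \<le> u'" by (simp add: u'_def)
      have "ennreal u' = ennreal (1 / W powr (p - 1)) * ennreal (?u powr p)"
        by (simp add: u'_def ennreal_mult'[symmetric])
      also have "\<dots> \<le> ennreal (1 / W powr (p - 1)) * (ennreal (W powr (p - 1)) *
          (\<integral>\<^sub>\<gamma>y. (k x y * indicator ?B y) * norm (g y) powr p))"
        using 1 by (rule mult_left_mono) simp
      also have "\<dots> = (\<integral>\<^sub>\<gamma>y. norm (g y) powr p * (k x y * indicator ?B y))"
        using W by (simp add: mult.assoc[symmetric] ennreal_mult'[symmetric] mult.commute)
      finally have u': "ennreal u' \<le> (\<integral>\<^sub>\<gamma>y. norm (g y) powr p * (k x y * indicator ?B y))" .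
      have 2: "ennreal (u' powr t) \<le> ennreal (Z powr (t - 1)) *
          (\<integral>\<^sub>\<gamma>y. norm (g y) powr p * (k x y * indicator ?B y) powr t)"
      proof (rule nn_integral_jensen[OF _ _ _ _ t(1) u'0 u' gZ Z])
        show "(\<lambda>y. k x y * indicator ?B y) \<in> borel_measurable gauss" "(\<lambda>y. norm (g y) powr p) \<in> borel_measurable gauss"
          by measurable
      qed (use L.nonneg in auto)
      have "?u powr q = (W powr (p - 1)) powr t * u' powr t"
      proof -
        have "(W powr (p - 1)) powr t * u' powr t = (W powr (p - 1) * u') powr t"
          by (simp only: powr_mult)
        also have "W powr (p - 1) * u' = ?u powr p" using W by (simp add: u'_def)
        also have "(?u powr p) powr t = ?u powr q" using p by (simp add: powr_powr t_def)
        finally show ?thesis ..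
      qed
      then have "ennreal (?u powr q) = ennreal ((W powr (p - 1)) powr t) * ennreal (u' powr t)"
        by (simp add: ennreal_mult')
      also have "\<dots> \<le> ennreal ((W powr (p - 1)) powr t) * (ennreal (Z powr (t - 1)) *
          (\<integral>\<^sub>\<gamma>y. norm (g y) powr p * (k x y * indicator ?B y) powr t))"
        using 2 by (rule mult_left_mono) simp
      also have "\<dots> = ennreal ((W powr (p - 1)) powr t * Z powr (t - 1)) *
          (\<integral>\<^sub>\<gamma>y. norm (g y) powr p * (k x y * indicator ?B y) powr t)"
        by (simp add: ennreal_mult' mult.assoc)
      finally show ?thesis using x by simp
    qed simp
    have I: "(\<integral>\<^sup>+ x. (\<integral>\<^sub>\<gamma>y. ?J x y) \<partial>gauss)
        \<le> ennreal (Z * (D2 * \<mu> powr (1 - 1 / p)))"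
    proof -
      have "(\<integral>\<^sup>+ x. (\<integral>\<^sub>\<gamma>y. ?J x y) \<partial>gauss)
        = (\<integral>\<^sup>+ y. (\<integral>\<^sub>\<gamma>x. ?J x y) \<partial>gauss)"
        by (rule gauss_Fubini) measurable
      also have "\<dots> \<le> (\<integral>\<^sup>+ y. ennreal (norm (g y) powr p) * ennreal (D2 * \<mu> powr (1 - 1 / p)) \<partial>gauss)"
      proof (rule nn_integral_mono)
        fix y
        show "(\<integral>\<^sub>\<gamma>x. ?J x y)
          \<le> ennreal (norm (g y) powr p) * ennreal (D2 * \<mu> powr (1 - 1 / p))"
        proof (cases "y \<in> ?B")
          case True
          then have "(\<integral>\<^sub>\<gamma>x. ?J x y)
            = (\<integral>\<^sup>+ x. ennreal (norm (g y) powr p) * ennreal (k x y powr t * indicator ?B x) \<partial>gauss)"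
            by (intro nn_integral_cong) (simp add: ennreal_mult'[symmetric] mult.assoc)
          also have "\<dots> = ennreal (norm (g y) powr p) * (\<integral>\<^sub>\<gamma>x. k x y powr t * indicator ?B x)"
            by (rule nn_integral_cmult) measurable
          also have "\<dots> \<le> ennreal (norm (g y) powr p) * ennreal (D2 * vol c \<rho> powr (1 - t * (1 - \<beta>)))"
            using * True by (intro mult_left_mono D2(2)) auto
          finally show ?thesis by (simp only: t(2) \<mu>_def)
        next
          case False
          then show ?thesis by simp
        qed
      qed
      also have "\<dots> = (\<integral>\<^sub>\<gamma>y. norm (g y) powr p) * ennreal (D2 * \<mu> powr (1 - 1 / p))"
        by (rule nn_integral_multc) measurable
      also have "\<dots> \<le> ennreal Z * ennreal (D2 * \<mu> powr (1 - 1 / p))"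
        using gZ by (rule mult_right_mono) simp
      also have "\<dots> = ennreal (Z * (D2 * \<mu> powr (1 - 1 / p)))"
        using Z by (simp add: ennreal_mult')
      finally show ?thesis .
    qed
    have "(\<integral>\<^sup>+ x. ennreal (norm (T g x) powr q) * indicator ?B x \<partial>gauss)
      \<le> (\<integral>\<^sup>+ x. ennreal ((W powr (p - 1)) powr t * Z powr (t - 1)) *
          (\<integral>\<^sub>\<gamma>y. ?J x y) \<partial>gauss)"
      by (intro nn_integral_mono pt)
    also have "\<dots> = ennreal ((W powr (p - 1)) powr t * Z powr (t - 1)) *
        (\<integral>\<^sup>+ x. (\<integral>\<^sub>\<gamma>y. ?J x y) \<partial>gauss)"
    proof (rule nn_integral_cmult)
      have "(\<lambda>x. \<integral>\<^sub>\<gamma>y. ?J x y) \<in> borel_measurable borel"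
        by (rule borel_measurable_gauss_section) measurable
      then show "(\<lambda>x. \<integral>\<^sub>\<gamma>y. ?J x y) \<in> borel_measurable gauss"
        by (simp add: borel_measurable_gauss_iff)
    qed
    also have "\<dots> \<le> ennreal ((W powr (p - 1)) powr t * Z powr (t - 1)) * ennreal (Z * (D2 * \<mu> powr (1 - 1 / p)))"
      by (intro mult_left_mono I) simp
    also have "\<dots> = ennreal ((W powr (p - 1)) powr t * Z powr (t - 1) * (Z * (D2 * \<mu> powr (1 - 1 / p))))"
      by (rule ennreal_mult'[symmetric]) simp
    also have "(W powr (p - 1)) powr t * Z powr (t - 1) * (Z * (D2 * \<mu> powr (1 - 1 / p))) = E"
    proof -
      have w: "(W powr (p - 1)) powr t = (D1 powr (p - 1)) powr t * \<mu> powr (\<beta> * (p - 1) * t)"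
        by (simp add: W_def powr_mult powr_powr)
      have z: "Z powr (t - 1) = D3 powr (t - 1) * \<mu> powr ((1 - p) * (t - 1))"
        by (simp add: Z_def powr_mult powr_powr)
      have "(W powr (p - 1)) powr t * Z powr (t - 1) * (Z * (D2 * \<mu> powr (1 - 1 / p)))
        = E * (\<mu> powr (\<beta> * (p - 1) * t) * \<mu> powr ((1 - p) * (t - 1)) * \<mu> powr (1 - p) * \<mu> powr (1 - 1 / p))"
        unfolding w z unfolding Z_def E_def by (simp only: mult_ac)
      also have "\<mu> powr (\<beta> * (p - 1) * t) * \<mu> powr ((1 - p) * (t - 1)) * \<mu> powr (1 - p) * \<mu> powr (1 - 1 / p)
        = \<mu> powr (\<beta> * (p - 1) * t + (1 - p) * (t - 1) + (1 - p) + (1 - 1 / p))"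
        by (simp only: powr_add)
      also have "\<beta> * (p - 1) * t + (1 - p) * (t - 1) + (1 - p) + (1 - 1 / p) = 0"
      proof -
        have "\<beta> * (p - 1) * t + (1 - p) * (t - 1) + (1 - p) + (1 - 1 / p) = (1 - p) * (t * (1 - \<beta>)) + (1 - 1 / p)"
          by (simp add: algebra_simps)
        also have "\<dots> = (1 - p) * (1 / p) + (1 - 1 / p)" by (simp only: t(2))
        also have "\<dots> = 0" using p by (simp add: field_simps)
        finally show ?thesis .
      qed
      finally show ?thesis using \<mu> by simp
    qed
    finally show "(\<integral>\<^sup>+ x. ennreal (norm (T g x) powr q) * indicator ?B x \<partial>gauss) \<le> ennreal E" .
  qed
qed

text \<open>
  Far from its ball the mean value zero of an atom replaces \<open>k x y\<close> by \<open>k x y - k x c\<close>, and Hoermander's condition in the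
  second variable applies after Minkowski's inequality for integrals.
\<close>

lemma atom_far:
  "\<exists>D>0. \<forall>c \<rho> (g :: real ^ 'n \<Rightarrow> complex).
    0 < \<rho> \<and> integrable gauss g \<and> (AE x in gauss. x \<notin> ball c \<rho> \<longrightarrow> g x = 0) \<and> (LINT x|gauss. g x) = 0 \<and>
    (\<integral>\<^sub>\<gamma>x. norm (g x)) \<le> ennreal 1 \<longrightarrow>
    (\<integral>\<^sup>+ x. ennreal (norm (T g x) powr q) * indicator {2 * \<rho>..} (dist c x) \<partial>gauss) \<le> ennreal D"
proof -
  obtain D where D0: "0 < D" "\<forall>c x r. 0 < r \<and> dist x c \<le> r \<longrightarrow>
    (\<integral>\<^sub>\<gamma>y. \<bar>k y x - k y c\<bar> powr q * indicator {2 * r..} (dist c y)) \<le> ennreal D"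
    using R.hoermander by (elim exE conjE)
  note D = D0(1) D0(2)[rule_format]
  show ?thesis
  proof (intro exI[of _ D] conjI allI impI D(1))
    fix c :: "real ^ 'n" and \<rho> and g :: "real ^ 'n \<Rightarrow> complex"
    assume *: "0 < \<rho> \<and> integrable gauss g \<and> (AE x in gauss. x \<notin> ball c \<rho> \<longrightarrow> g x = 0) \<and> (LINT x|gauss. g x) = 0 \<and>
      (\<integral>\<^sub>\<gamma>x. norm (g x)) \<le> ennreal 1"
    then have g: "integrable gauss g" by blast
    then have [measurable]: "g \<in> borel_measurable borel"
      using borel_measurable_integrable[OF g] by (simp add: borel_measurable_gauss_iff)
    let ?B = "ball c \<rho>" and ?F = "\<lambda>x. indicator {2 * \<rho>..} (dist c x) :: real"
    let ?d = "\<lambda>x y. \<bar>k x y - k x c\<bar> * indicator ?B y"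
    let ?J = "\<lambda>x y. norm (g y) * ?d x y powr q * ?F x"
    have pt: "AE x in gauss. ennreal (norm (T g x) powr q) * indicator {2 * \<rho>..} (dist c x) \<le>
        (\<integral>\<^sub>\<gamma>y. ?J x y)"
      using AE_integrable[OF g]
    proof eventually_elim
      case (elim x)
      have "T g x = (LINT y|gauss. k x y *\<^sub>R g y - k x c *\<^sub>R g y)"
        unfolding kernel_op_def using elim g * by (subst Bochner_Integration.integral_diff) auto
      also have "\<dots> = (LINT y|gauss. (k x y - k x c) *\<^sub>R g y)"
        by (simp only: scaleR_left_diff_distrib)
      finally have eq: "T g x = (LINT y|gauss. (k x y - k x c) *\<^sub>R g y)" .
      have "ennreal (norm (T g x)) \<le> (\<integral>\<^sub>\<gamma>y. norm ((k x y - k x c) *\<^sub>R g y))"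
        unfolding eq by (rule ennreal_norm_integral_le)
      also have "\<dots> = (\<integral>\<^sub>\<gamma>y. norm (g y) * ?d x y)"
      proof (rule nn_integral_cong_AE)
        have "AE y in gauss. y \<notin> ?B \<longrightarrow> g y = 0" using * by blast
        then show "AE y in gauss. ennreal (norm ((k x y - k x c) *\<^sub>R g y)) = ennreal (norm (g y) * ?d x y)"
        proof eventually_elim
          case (elim y)
          show ?case using elim by (cases "y \<in> ?B") (auto simp: mult.commute)
        qed
      qed
      finally have u: "ennreal (norm (T g x)) \<le> (\<integral>\<^sub>\<gamma>y. norm (g y) * ?d x y)" .
      have "ennreal (norm (T g x) powr q) \<le> ennreal (1 powr (q - 1)) *
          (\<integral>\<^sub>\<gamma>y. norm (g y) * ?d x y powr q)"
      proof (rule nn_integral_jensen[OF _ _ _ _ _ _ u])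
        show "(\<lambda>y. norm (g y)) \<in> borel_measurable gauss" "?d x \<in> borel_measurable gauss"
          by measurable
        show "(\<integral>\<^sub>\<gamma>y. norm (g y)) \<le> ennreal 1" using * by blast
      qed (use L.q in auto)
      then show ?case by (cases "2 * \<rho> \<le> dist c x") simp_all
    qed
    have "(\<integral>\<^sup>+ x. ennreal (norm (T g x) powr q) * indicator {2 * \<rho>..} (dist c x) \<partial>gauss)
      \<le> (\<integral>\<^sup>+ x. (\<integral>\<^sub>\<gamma>y. ?J x y) \<partial>gauss)"
      by (rule nn_integral_mono_AE[OF pt])
    also have "\<dots> = (\<integral>\<^sup>+ y. (\<integral>\<^sub>\<gamma>x. ?J x y) \<partial>gauss)"
      by (rule gauss_Fubini) measurable
    also have "\<dots> \<le> (\<integral>\<^sup>+ y. ennreal (norm (g y)) * ennreal D \<partial>gauss)"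
    proof (rule nn_integral_mono)
      fix y
      show "(\<integral>\<^sub>\<gamma>x. ?J x y) \<le> ennreal (norm (g y)) * ennreal D"
      proof (cases "y \<in> ?B")
        case True
        then have "(\<integral>\<^sub>\<gamma>x. ?J x y)
          = (\<integral>\<^sup>+ x. ennreal (norm (g y)) * ennreal (\<bar>k x y - k x c\<bar> powr q * ?F x) \<partial>gauss)"
          by (intro nn_integral_cong) (simp add: ennreal_mult'[symmetric] mult.assoc)
        also have "\<dots> = ennreal (norm (g y)) * (\<integral>\<^sub>\<gamma>x. \<bar>k x y - k x c\<bar> powr q * ?F x)"
          by (rule nn_integral_cmult) measurable
        also have "\<dots> \<le> ennreal (norm (g y)) * ennreal D"
          using * True by (intro mult_left_mono D(2)) (auto simp: dist_commute)
        finally show ?thesis .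
      next
        case False
        then show ?thesis by simp
      qed
    qed
    also have "\<dots> = (\<integral>\<^sub>\<gamma>y. norm (g y)) * ennreal D"
      by (rule nn_integral_multc) measurable
    also have "\<dots> \<le> ennreal 1 * ennreal D"
      using * by (intro mult_right_mono) auto
    finally show "(\<integral>\<^sup>+ x. ennreal (norm (T g x) powr q) * indicator {2 * \<rho>..} (dist c x) \<partial>gauss) \<le> ennreal D"
      by simp
  qed
qed

lemma atom_bounded:
  assumes r: "1 < r"
  shows "\<exists>D>0. \<forall>g \<in> (atoms r :: (real ^ 'n \<Rightarrow> complex) set).
    (\<integral>\<^sub>\<gamma>x. norm (T g x) powr q) \<le> ennreal D \<and>
    (\<integral>\<^sub>\<gamma>x. norm (g x)) \<le> ennreal D"
proof -
  \<comment> \<open>The norm bound of an atom passes to exponents \<open>p \<le> r\<close>; \<open>atom_near\<close> also wants \<open>p \<le> q\<close>.\<close>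
  define p where "p = min r q"
  have p: "1 < p" "p \<le> q" "p \<le> r" using r L.q by (auto simp: p_def)
  obtain D1 where D10: "0 < D1" "\<forall>b :: real ^ 'n \<Rightarrow> complex. b \<in> borel_measurable borel \<and> (AE x in gauss. b x = 1) \<longrightarrow>
    (\<integral>\<^sub>\<gamma>x. norm (T b x) powr q) \<le> ennreal D1"
    using constant_atom by (elim exE conjE)
  note D1 = D10(1) D10(2)[rule_format]
  obtain D2 where D20: "0 < D2" "\<forall>c \<rho> (g :: real ^ 'n \<Rightarrow> complex).
    0 < \<rho> \<and> \<rho> \<le> m_fun c \<and> g \<in> borel_measurable borel \<and> (AE x in gauss. x \<notin> ball c \<rho> \<longrightarrow> g x = 0) \<and>
    (\<integral>\<^sub>\<gamma>x. norm (g x) powr p) \<le> ennreal (measure gauss (ball c \<rho>) powr (1 - p)) \<longrightarrow>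
    (\<integral>\<^sup>+ x. ennreal (norm (T g x) powr q) * indicator (ball c (2 * \<rho>)) x \<partial>gauss) \<le> ennreal D2"
    using atom_near[OF p(1,2)] by (elim exE conjE)
  note D2 = D20(1) D20(2)[rule_format]
  obtain D3 where D30: "0 < D3" "\<forall>c \<rho> (g :: real ^ 'n \<Rightarrow> complex).
    0 < \<rho> \<and> integrable gauss g \<and> (AE x in gauss. x \<notin> ball c \<rho> \<longrightarrow> g x = 0) \<and> (LINT x|gauss. g x) = 0 \<and>
    (\<integral>\<^sub>\<gamma>x. norm (g x)) \<le> ennreal 1 \<longrightarrow>
    (\<integral>\<^sup>+ x. ennreal (norm (T g x) powr q) * indicator {2 * \<rho>..} (dist c x) \<partial>gauss) \<le> ennreal D3"
    using atom_far by (elim exE conjE)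
  note D3 = D30(1) D30(2)[rule_format]
  define M where "M = measure gauss (UNIV :: (real ^ 'n) set)"
  have M: "0 \<le> M" by (simp add: M_def)
  define D where "D = D1 + D2 + D3 + M + 1"
  show ?thesis
  proof (intro exI[of _ D] conjI ballI)
    show "0 < D" using D1 D2 D3 M by (simp add: D_def)
    fix g :: "real ^ 'n \<Rightarrow> complex" assume "g \<in> atoms r"
    then have g1: "g \<in> Lp 1" and "(AE x in gauss. g x = 1) \<or>
       (\<exists>B \<in> adm_balls 1. (AE x in gauss. x \<notin> B \<longrightarrow> g x = 0) \<and>
        g \<in> Lp r \<and> Lp_norm r g \<le> measure gauss B powr (1 / r - 1) \<and> (LINT x:B|gauss. g x) = 0)"
      by (auto simp: atoms_def)
    then consider "AE x in gauss. g x = 1" | B where "B \<in> adm_balls 1" "AE x in gauss. x \<notin> B \<longrightarrow> g x = 0"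
        "g \<in> Lp r" "Lp_norm r g \<le> measure gauss B powr (1 / r - 1)" "(LINT x:B|gauss. g x) = 0"
      by blast
    then have "(\<integral>\<^sub>\<gamma>x. norm (T g x) powr q) \<le> ennreal D \<and>
      (\<integral>\<^sub>\<gamma>x. norm (g x)) \<le> ennreal D"
    proof cases
      case 1
      have "(\<integral>\<^sub>\<gamma>x. norm (T g x) powr q) \<le> ennreal D1"
        using D1(2)[of g] 1 Lp_1_nn_integral(1)[OF g1] by blast
      moreover have "(\<integral>\<^sub>\<gamma>x. norm (g x)) = ennreal M"
      proof -
        have "(\<integral>\<^sub>\<gamma>x. norm (g x)) = (\<integral>\<^sup>+ x. 1 \<partial>(gauss :: (real ^ 'n) measure))"
          using 1 by (intro nn_integral_cong_AE) (auto elim!: eventually_mono)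
        then show ?thesis by (simp add: M_def gauss.emeasure_eq_measure)
      qed
      moreover have "ennreal D1 \<le> ennreal D" "ennreal M \<le> ennreal D"
        using D1 D2 D3 M by (auto simp: D_def intro!: ennreal_leI)
      ultimately show ?thesis by (metis order_trans)
    next
      case 2
      from 2(1) obtain c \<rho> where B: "B = ball c \<rho>" "0 < \<rho>" "\<rho> \<le> m_fun c" by (auto simp: adm_balls_def)
      have \<mu>: "0 < measure gauss B" unfolding B by (rule measure_gauss_ball_pos[OF B(2)])
      have Bs: "B \<in> sets borel" by (simp add: B)
      have gm: "g \<in> borel_measurable borel" "integrable gauss g" using Lp_1_nn_integral[OF g1] by auto
      have supp: "AE x in gauss. x \<notin> ball c \<rho> \<longrightarrow> g x = 0" using 2(2) unfolding B .
      have n1: "(\<integral>\<^sub>\<gamma>x. norm (g x)) \<le> ennreal 1"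
      proof -
        have "(\<integral>\<^sub>\<gamma>x. norm (g x) powr 1) \<le> ennreal (measure gauss B powr (1 - 1))"
          using r by (intro nn_integral_power_atom[OF 2(3,2,4) Bs \<mu>]) auto
        then show ?thesis using \<mu> by simp
      qed
      have np: "(\<integral>\<^sub>\<gamma>x. norm (g x) powr p) \<le> ennreal (measure gauss (ball c \<rho>) powr (1 - p))"
        using p unfolding B(1)[symmetric] by (intro nn_integral_power_atom[OF 2(3,2,4) Bs \<mu>]) auto
      have int0: "(LINT x|gauss. g x) = 0"
      proof -
        have "(LINT x|gauss. g x) = (LINT x|gauss. indicator B x *\<^sub>R g x)"
        proof (rule integral_cong_AE)
          show "g \<in> borel_measurable gauss" "(\<lambda>x. indicator B x *\<^sub>R g x) \<in> borel_measurable gauss"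
            using gm Bs by measurable
          show "AE x in gauss. g x = indicator B x *\<^sub>R g x"
            using 2(2) by (auto elim!: eventually_mono simp: indicator_def)
        qed
        then show ?thesis using 2(5) by (simp add: set_lebesgue_integral_def)
      qed
      have near: "(\<integral>\<^sup>+ x. ennreal (norm (T g x) powr q) * indicator (ball c (2 * \<rho>)) x \<partial>gauss) \<le> ennreal D2"
        using B gm supp np by (intro D2(2)) blast
      have far: "(\<integral>\<^sup>+ x. ennreal (norm (T g x) powr q) * indicator {2 * \<rho>..} (dist c x) \<partial>gauss) \<le> ennreal D3"
        using B gm supp n1 int0 by (intro D3(2)) blast
      have km[measurable]: "T g \<in> borel_measurable borel"
        by (rule L.kernel_op_measurable[OF gm(1)])
      have "(\<integral>\<^sub>\<gamma>x. norm (T g x) powr q)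
        = (\<integral>\<^sup>+ x. ennreal (norm (T g x) powr q) * indicator (ball c (2 * \<rho>)) x
            + ennreal (norm (T g x) powr q) * indicator {2 * \<rho>..} (dist c x) \<partial>gauss)"
        by (intro nn_integral_cong) (auto simp: indicator_def)
      also have "\<dots> = (\<integral>\<^sup>+ x. ennreal (norm (T g x) powr q) * indicator (ball c (2 * \<rho>)) x \<partial>gauss)
            + (\<integral>\<^sup>+ x. ennreal (norm (T g x) powr q) * indicator {2 * \<rho>..} (dist c x) \<partial>gauss)"
        by (rule nn_integral_add) measurable
      also have "\<dots> \<le> ennreal D2 + ennreal D3" by (intro add_mono near far)
      also have "\<dots> = ennreal (D2 + D3)" using D2 D3 by simp
      also have "\<dots> \<le> ennreal D" using D1 M by (intro ennreal_leI) (simp add: D_def)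
      finally have "(\<integral>\<^sub>\<gamma>x. norm (T g x) powr q) \<le> ennreal D" .
      moreover have "ennreal 1 \<le> ennreal D"
        using D1 D2 D3 M by (intro ennreal_leI) (simp add: D_def)
      ultimately show ?thesis using n1 by (metis order_trans)
    qed
    then show "(\<integral>\<^sub>\<gamma>x. norm (T g x) powr q) \<le> ennreal D"
      "(\<integral>\<^sub>\<gamma>x. norm (g x)) \<le> ennreal D" by auto
  qed
qed

end

section \<open>The Hardy space\<close>

context fractional_kernel
begin

text \<open>
  The operator is bounded on \<open>L\<^sup>1\<close>, in which the atomic series converges; hence the image of \<open>g\<close> is dominated almost
  everywhere by the series \<open>G\<close> of the images of the atoms. Jensen's inequality for the weights \<open>norm (l j)\<close>
  on the natural numbers turns this into a bound in \<open>L\<^sup>q\<close>. The bound \<open>W\<close> is used in place of the sum of the weights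
  since the sum may be zero.
\<close>

lemma decomposition_bound:
  assumes r: "1 < r"
  shows "\<exists>D>0. \<forall>(g :: real ^ 'n \<Rightarrow> complex) l b W. g \<in> Lp 1 \<and> atomic_decomp r g l b \<and> (\<Sum>j. norm (l j)) \<le> W \<and> 0 < W \<longrightarrow>
    (\<integral>\<^sub>\<gamma>x. norm (T g x) powr q) \<le> ennreal (D * W powr q)"
proof -
  obtain D where D0: "0 < D" "\<forall>g \<in> (atoms r :: (real ^ 'n \<Rightarrow> complex) set).
    (\<integral>\<^sub>\<gamma>x. norm (T g x) powr q) \<le> ennreal D \<and>
    (\<integral>\<^sub>\<gamma>x. norm (g x)) \<le> ennreal D"
    using atom_bounded[OF r] by (elim exE conjE)
  note D = D0(1) D0(2)[rule_format]
  obtain D1 where D10: "0 < D1" "\<forall>f :: real ^ 'n \<Rightarrow> complex. f \<in> borel_measurable borel \<longrightarrow>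
    (\<integral>\<^sub>\<gamma>x. norm (T f x)) \<le> ennreal D1 * (\<integral>\<^sub>\<gamma>y. norm (f y))"
    using L1_bound[where ?'b = complex] by (elim exE conjE)
  note D1 = D10(1) D10(2)[rule_format]
  show ?thesis
  proof (intro exI[of _ D] conjI allI impI D(1))
    fix g :: "real ^ 'n \<Rightarrow> complex" and l b W
    assume *: "g \<in> Lp 1 \<and> atomic_decomp r g l b \<and> (\<Sum>j. norm (l j)) \<le> W \<and> 0 < W"
    have g: "g \<in> borel_measurable borel" "integrable gauss g" using * Lp_1_nn_integral by blast+
    have b: "b j \<in> atoms r" and l: "summable (\<lambda>j. norm (l j))"
      and lim: "(\<lambda>N. Lp_norm 1 (\<lambda>x. g x - (\<Sum>j<N. l j * b j x))) \<longlonglongrightarrow> 0" for j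
      using * by (auto simp: atomic_decomp_def)
    have b1: "b j \<in> Lp 1" for j using b[of j] by (simp add: atoms_def)
    have bi: "b j \<in> borel_measurable borel" "integrable gauss (b j)" for j
      using Lp_1_nn_integral[OF b1[of j]] by auto
    let ?s = "\<lambda>j x. norm (l j) * norm (T (b j) x)"
    let ?t = "\<lambda>j x. norm (l j) * norm (T (b j) x) powr q"
    note [measurable] = g(1) bi(1)
    have [measurable]: "T g \<in> borel_measurable borel" "T (b j) \<in> borel_measurable borel" for j
      by measurable
    define R where "R N x = g x - (\<Sum>j<N. l j * b j x)" for N x
    have Rm[measurable]: "R N \<in> borel_measurable borel" for N
      unfolding R_def by measurable
    have Ri: "integrable gauss (R N)" for N
      unfolding R_def using g bi by (intro Bochner_Integration.integrable_diff Bochner_Integration.integrable_sum) auto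
    have R1: "R N \<in> Lp 1" for N
      using Ri[of N] Rm[of N] by (simp add: Lp_def borel_measurable_gauss_iff)
    have Rlim: "(\<lambda>N. Lp_norm 1 (R N)) \<longlonglongrightarrow> 0" using lim unfolding R_def .
    define G where "G x = (\<Sum>j. ennreal (?s j x))" for x
    have Gm[measurable]: "G \<in> borel_measurable borel" unfolding G_def by measurable
    have all: "AE x in gauss. \<forall>j. integrable gauss (\<lambda>y. k x y *\<^sub>R b j y)"
      unfolding AE_all_countable using AE_integrable[OF bi(2)] by blast
    have split: "AE x in gauss. \<forall>N. ennreal (norm (T g x)) \<le> G x + ennreal (norm (T (R N) x))"
      using all AE_integrable[OF g(2)]
    proof eventually_elim
      case (elim x)
      show ?case
      proof
        fix N
        have i: "integrable gauss (\<lambda>y. l j * (k x y *\<^sub>R b j y))" for j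
          using elim(1) by (intro integrable_mult_right) blast
        have "T (R N) x = (LINT y|gauss. k x y *\<^sub>R g y - (\<Sum>j<N. l j * (k x y *\<^sub>R b j y)))"
          unfolding kernel_op_def R_def
          by (intro Bochner_Integration.integral_cong) (simp_all add: scaleR_right_diff_distrib scaleR_sum_right)
        also have "\<dots> = T g x - (LINT y|gauss. (\<Sum>j<N. l j * (k x y *\<^sub>R b j y)))"
          unfolding kernel_op_def
          by (rule Bochner_Integration.integral_diff[OF elim(2)]) (intro Bochner_Integration.integrable_sum i)
        also have "(LINT y|gauss. (\<Sum>j<N. l j * (k x y *\<^sub>R b j y))) = (\<Sum>j<N. LINT y|gauss. l j * (k x y *\<^sub>R b j y))"
          by (rule Bochner_Integration.integral_sum) (rule i)
        also have "\<dots> = (\<Sum>j<N. l j * T (b j) x)"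
          unfolding kernel_op_def by (intro sum.cong refl integral_mult_right_zero)
        finally have "T g x = (\<Sum>j<N. l j * T (b j) x) + T (R N) x"
          by simp
        then have "norm (T g x) \<le> norm (\<Sum>j<N. l j * T (b j) x) + norm (T (R N) x)"
          using norm_triangle_ineq by metis
        also have "norm (\<Sum>j<N. l j * T (b j) x) \<le> (\<Sum>j<N. ?s j x)"
          using norm_sum[of "\<lambda>j. l j * T (b j) x" "{..<N}"] by (simp add: norm_mult)
        finally have "ennreal (norm (T g x)) \<le>
            ennreal ((\<Sum>j<N. ?s j x) + norm (T (R N) x))"
          by (simp add: ennreal_leI)
        also have "\<dots> = (\<Sum>j<N. ennreal (?s j x)) + ennreal (norm (T (R N) x))"
          by (subst ennreal_plus) (auto intro!: sum_nonneg simp: sum_ennreal)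
        also have "\<dots> \<le> G x + ennreal (norm (T (R N) x))"
          unfolding G_def by (intro add_right_mono sum_le_suminf) auto
        finally show "ennreal (norm (T g x)) \<le> G x + ennreal (norm (T (R N) x))" .
      qed
    qed
    \<comment> \<open>The excess of the image over \<open>G\<close> is at most the image of the \<open>N\<close>-th remainder, for every \<open>N\<close>.\<close>
    have "(\<integral>\<^sup>+ x. ennreal (norm (T g x)) - G x \<partial>gauss) \<le> ennreal (D1 * Lp_norm 1 (R N))" for N
    proof -
      have "(\<integral>\<^sup>+ x. ennreal (norm (T g x)) - G x \<partial>gauss) \<le> (\<integral>\<^sub>\<gamma>x. norm (T (R N) x))"
        using split by (intro nn_integral_mono_AE) (auto elim!: eventually_mono simp: ennreal_minus_le_iff)
      also have "\<dots> \<le> ennreal D1 * (\<integral>\<^sub>\<gamma>y. norm (R N y))"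
        by (rule D1(2)[OF Rm])
      also have "\<dots> = ennreal (D1 * Lp_norm 1 (R N))"
        using D1(1) by (simp add: Lp_1_nn_integral(4)[OF R1] ennreal_mult')
      finally show ?thesis .
    qed
    moreover have "(\<lambda>N. ennreal (D1 * Lp_norm 1 (R N))) \<longlonglongrightarrow> ennreal (D1 * 0)"
      by (intro tendsto_ennrealI tendsto_mult_left Rlim)
    ultimately have "(\<integral>\<^sup>+ x. ennreal (norm (T g x)) - G x \<partial>gauss) \<le> ennreal (D1 * 0)"
      by (intro LIMSEQ_le_const) auto
    then have "(\<integral>\<^sup>+ x. ennreal (norm (T g x)) - G x \<partial>gauss) = 0" by simp
    then have "AE x in gauss. ennreal (norm (T g x)) - G x = 0"
      by (subst (asm) nn_integral_0_iff_AE) simp_all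
    then have le: "AE x in gauss. ennreal (norm (T g x)) \<le> G x"
      by eventually_elim (rule ennreal_minus_eq_0)
    have W: "(\<Sum>j. ennreal (norm (l j))) \<le> ennreal W"
      using * l by (subst suminf_ennreal2) (auto intro: ennreal_leI)
    have pt: "AE x in gauss. ennreal (norm (T g x) powr q) \<le>
        ennreal (W powr (q - 1)) * (\<Sum>j. ennreal (?t j x))"
      using le
    proof eventually_elim
      case (elim x)
      have u: "ennreal (norm (T g x)) \<le>
          (\<integral>\<^sup>+ j. ennreal (?s j x) \<partial>count_space UNIV)"
        using elim by (simp add: G_def nn_integral_count_space_nat)
      have "ennreal (norm (T g x) powr q) \<le>
        ennreal (W powr (q - 1)) * (\<integral>\<^sup>+ j. ennreal (?t j x) \<partial>count_space UNIV)"
      proof (rule nn_integral_jensen[OF _ _ _ _ _ _ u])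
        show "(\<integral>\<^sup>+ j. ennreal (norm (l j)) \<partial>count_space UNIV) \<le> ennreal W"
          using W by (simp add: nn_integral_count_space_nat)
        show "1 \<le> q" using L.q by simp
        show "0 < W" using * by blast
      qed simp_all
      then show ?case by (simp add: nn_integral_count_space_nat)
    qed
    have "(\<integral>\<^sub>\<gamma>x. norm (T g x) powr q)
      \<le> (\<integral>\<^sup>+ x. ennreal (W powr (q - 1)) * (\<Sum>j. ennreal (?t j x)) \<partial>gauss)"
      by (rule nn_integral_mono_AE[OF pt])
    also have "\<dots> = ennreal (W powr (q - 1)) * (\<integral>\<^sup>+ x. (\<Sum>j. ennreal (?t j x)) \<partial>gauss)"
      by (rule nn_integral_cmult) measurable
    also have "(\<integral>\<^sup>+ x. (\<Sum>j. ennreal (?t j x)) \<partial>gauss)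
      = (\<Sum>j. \<integral>\<^sub>\<gamma>x. ?t j x)"
      by (rule nn_integral_suminf) measurable
    also have "ennreal (W powr (q - 1)) * \<dots> \<le> ennreal (W powr (q - 1)) * (\<Sum>j. ennreal (norm (l j)) * ennreal D)"
    proof (intro mult_left_mono suminf_le)
      fix j
      have "(\<integral>\<^sub>\<gamma>x. ?t j x)
        = ennreal (norm (l j)) * (\<integral>\<^sub>\<gamma>x. norm (T (b j) x) powr q)"
        by (simp add: ennreal_mult' nn_integral_cmult)
      also have "\<dots> \<le> ennreal (norm (l j)) * ennreal D"
        using D(2)[OF b] by (intro mult_left_mono) auto
      finally show "(\<integral>\<^sub>\<gamma>x. ?t j x) \<le> ennreal (norm (l j)) * ennreal D" .
    qed auto
    also have "(\<Sum>j. ennreal (norm (l j)) * ennreal D) = (\<Sum>j. ennreal (norm (l j))) * ennreal D"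
      by (rule ennreal_suminf_multc)
    also have "ennreal (W powr (q - 1)) * \<dots> \<le> ennreal (W powr (q - 1)) * (ennreal W * ennreal D)"
      by (intro mult_left_mono mult_right_mono W) auto
    also have "\<dots> = ennreal (W powr (q - 1) * (W * D))"
      using * D(1) by (simp add: ennreal_mult)
    also have "W powr (q - 1) * (W * D) = D * W powr q"
    proof -
      have "W powr q = W powr (q - 1) * W" using * powr_add[of W "q - 1" 1] by simp
      then show ?thesis by simp
    qed
    finally show "(\<integral>\<^sub>\<gamma>x. norm (T g x) powr q) \<le> ennreal (D * W powr q)" .
  qed
qed

lemma H1_bounded:
  assumes r: "1 < r"
  shows "bounded_op (H1 r :: (real ^ 'n \<Rightarrow> complex) set) (\<lambda>f. ereal (H1_norm r f))
    (Lp (1 / (1 - \<beta>))) (\<lambda>f. ereal (Lp_norm (1 / (1 - \<beta>)) f)) T"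
proof -
  obtain D where D0: "0 < D" "\<forall>(g :: real ^ 'n \<Rightarrow> complex) l b W. g \<in> Lp 1 \<and> atomic_decomp r g l b \<and> (\<Sum>j. norm (l j)) \<le> W \<and> 0 < W \<longrightarrow>
    (\<integral>\<^sub>\<gamma>x. norm (T g x) powr q) \<le> ennreal (D * W powr q)"
    using decomposition_bound[OF r] by (elim exE conjE)
  define E where "E = D powr (1 / q)"
  have E: "0 < E" using D0 by (simp add: E_def)
  show ?thesis unfolding bounded_op_def L.q_def[symmetric]
  proof (intro exI[of _ E] conjI ballI)
    show "0 \<le> E" using E by simp
    fix g :: "real ^ 'n \<Rightarrow> complex" assume "g \<in> H1 r"
    then have g: "g \<in> Lp 1" and ex: "\<exists>l b. atomic_decomp r g l b" by (auto simp: H1_def)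
    have gm: "g \<in> borel_measurable borel" using Lp_1_nn_integral[OF g] by simp
    have km: "T g \<in> borel_measurable borel" by (rule L.kernel_op_measurable[OF gm])
    have q: "0 < q" using L.q by simp
    have *: "T g \<in> Lp q \<and> Lp_norm q (T g) \<le> E * W"
      if "atomic_decomp r g l b" "(\<Sum>j. norm (l j)) \<le> W" "0 < W" for l b W
    proof -
      have "(\<integral>\<^sub>\<gamma>x. norm (T g x) powr q) \<le> ennreal (D * W powr q)"
        using D0(2) g that by blast
      also have "D * W powr q = (E * W) powr q"
        using D0(1) that q by (simp add: E_def powr_mult powr_powr)
      finally show ?thesis using Lp_I[OF km q, of "E * W"] E that by auto
    qed
    have S: "0 \<le> (\<Sum>j. norm (l j))" if "atomic_decomp r g l b" for l b
      using that by (intro suminf_nonneg) (auto simp: atomic_decomp_def)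
    obtain l b where "atomic_decomp r g l b" using ex by blast
    then show "T g \<in> Lp q"
      using *[of l b "(\<Sum>j. norm (l j)) + 1"] S[of l b] by auto
    have "Lp_norm q (T g) / E \<le> H1_norm r g"
      unfolding H1_norm_def
    proof (rule cInf_greatest)
      show "{(\<Sum>k. norm (l k)) |l b. atomic_decomp r g l b} \<noteq> {}" using ex by blast
      fix s assume "s \<in> {(\<Sum>k. norm (l k)) |l b. atomic_decomp r g l b}"
      then obtain l b where lb: "atomic_decomp r g l b" "s = (\<Sum>k. norm (l k))" by blast
      show "Lp_norm q (T g) / E \<le> s"
      proof (rule field_le_epsilon)
        fix e :: real assume "0 < e"
        then have "Lp_norm q (T g) \<le> E * (s + e)"
          using *[OF lb(1), of "s + e"] S[OF lb(1)] lb(2) by simp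
        then show "Lp_norm q (T g) / E \<le> s + e" using E by (simp add: divide_le_eq mult.commute)
      qed
    qed
    then have "Lp_norm q (T g) \<le> E * H1_norm r g"
      using E by (simp add: divide_le_eq mult.commute)
    then show "ereal (Lp_norm q (T g)) \<le> ereal E * ereal (H1_norm r g)" by simp
  qed
qed

end

section \<open>The two fractional kernels\<close>

lemma one_add_power_le:
  fixes \<delta> :: real
  assumes "0 \<le> \<delta>" "\<delta> \<le> 1"
  shows "(1 + 2 * \<delta>) ^ n \<le> 1 + 3 ^ n * \<delta>"
proof -
  have "(1 + 2 * \<delta>) ^ n \<le> 1 + (3 ^ n - 1) * \<delta>"
  proof (induction n)
    case (Suc n)
    have "(1 + 2 * \<delta>) ^ Suc n \<le> (1 + 2 * \<delta>) * (1 + (3 ^ n - 1) * \<delta>)"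
      using Suc assms by (simp add: mult_left_mono)
    also have "\<dots> = 1 + (3 ^ n - 1) * \<delta> + 2 * \<delta> + 2 * (3 ^ n - 1) * (\<delta> * \<delta>)"
      by (simp add: algebra_simps)
    also have "\<dots> \<le> 1 + (3 ^ n - 1) * \<delta> + 2 * \<delta> + 2 * (3 ^ n - 1) * (\<delta> * 1)"
      using assms by (intro add_left_mono mult_left_mono) auto
    also have "\<dots> = 1 + (3 ^ Suc n - 1) * \<delta>" by (simp add: algebra_simps)
    finally show ?case .
  qed simp
  also have "\<dots> \<le> 1 + 3 ^ n * \<delta>" using assms by (simp add: algebra_simps)
  finally show ?thesis .
qed

text \<open>
  On the diagonal the value is \<open>0\<close> when \<open>w x x = 0\<close>, since \<open>0 powr _ = 0\<close> and \<open>inverse 0 = 0\<close>; this agrees with the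
  integrands of the operators.
\<close>

definition truncated_kernel ::
  "real \<Rightarrow> real \<Rightarrow> (real ^ 'n \<Rightarrow> real ^ 'n \<Rightarrow> real) \<Rightarrow> real ^ 'n \<Rightarrow> real ^ 'n \<Rightarrow> real" where
  "truncated_kernel a \<beta> w x y = (if dist x y < a * m_fun x then inverse (w x y powr (1 - \<beta>)) else 0)"

text \<open>
  What the functions \<open>V_fun x y\<close> and \<open>vol x (dist x y)\<close> have in common: at the local scale they are at least
  a multiple of \<open>vol x (dist x y)\<close>, and moving both points by a fraction \<open>\<delta>\<close> of
  their distance increases them at most by a factor \<open>1 + O(\<delta>)\<close>. Exchanging the two pairs of points gives the
  estimate in the other direction.
\<close>

locale local_volume =
  fixes w :: "real ^ 'n \<Rightarrow> real ^ 'n \<Rightarrow> real"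
  assumes volume_measurable: "(\<lambda>(x, y). w x y) \<in> borel_measurable (borel \<Otimes>\<^sub>M borel)"
    and volume_diagonal: "w x x = 0"
    and volume_lower: "0 < A \<Longrightarrow> \<exists>c>0. \<forall>x y. dist x y \<le> A * m_fun x \<longrightarrow> c * vol x (dist x y) \<le> w x y"
    and volume_regular: "0 < A \<Longrightarrow> \<exists>K>0. \<forall>x y x' y' \<delta>. 0 \<le> \<delta> \<and> \<delta> \<le> 1 \<and> dist x y \<le> A * m_fun x \<and>
      dist x x' + dist y y' \<le> \<delta> * dist x y \<longrightarrow> w x' y' \<le> (1 + K * \<delta>) * w x y"

lemma powr_diff_le:
  fixes u v s \<epsilon> :: real
  assumes "0 < u" "0 < v" "0 < s" "s < 1" "0 \<le> \<epsilon>" "u \<le> (1 + \<epsilon>) * v" "v \<le> (1 + \<epsilon>) * u"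
  shows "\<bar>inverse (v powr s) - inverse (u powr s)\<bar> \<le> \<epsilon> * inverse (u powr s)"
    "inverse (v powr s) \<le> (1 + \<epsilon>) * inverse (u powr s)"
proof -
  have *: "inverse (y powr s) \<le> (1 + \<epsilon>) * inverse (x powr s)"
    if "0 < x" "0 < y" "x \<le> (1 + \<epsilon>) * y" for x y :: real
  proof -
    have "x powr s \<le> ((1 + \<epsilon>) * y) powr s" using that assms by (intro powr_mono2) auto
    also have "\<dots> = (1 + \<epsilon>) powr s * y powr s" by (rule powr_mult)
    also have "\<dots> \<le> (1 + \<epsilon>) powr 1 * y powr s"
      using assms by (intro mult_right_mono powr_mono) auto
    finally show ?thesis using that assms by (simp add: field_simps)
  qed
  show 1: "inverse (v powr s) \<le> (1 + \<epsilon>) * inverse (u powr s)" using * assms by blast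
  have 2: "inverse (u powr s) \<le> (1 + \<epsilon>) * inverse (v powr s)" using * assms by blast
  have "inverse (u powr s) - inverse (v powr s) \<le> \<epsilon> * inverse (u powr s)"
  proof -
    have "inverse (u powr s) - inverse (v powr s) \<le> \<epsilon> * inverse (v powr s)" using 2 by (simp add: algebra_simps)
    show ?thesis
    proof (cases "inverse (u powr s) \<le> inverse (v powr s)")
      case True
      then have "inverse (u powr s) - inverse (v powr s) \<le> 0" by linarith
      also have "0 \<le> \<epsilon> * inverse (u powr s)" using assms by simp
      finally show ?thesis .
    next
      case False
      then have "\<epsilon> * inverse (v powr s) \<le> \<epsilon> * inverse (u powr s)" using assms by (intro mult_left_mono) auto
      then show ?thesis using \<open>inverse (u powr s) - inverse (v powr s) \<le> \<epsilon> * inverse (v powr s)\<close> by linarith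
    qed
  qed
  then show "\<bar>inverse (v powr s) - inverse (u powr s)\<bar> \<le> \<epsilon> * inverse (u powr s)"
    using 1 by (auto simp: abs_le_iff algebra_simps)
qed

lemma m_fun_measurable [measurable]: "m_fun \<in> borel_measurable borel"
  unfolding m_fun_eq[abs_def] by measurable

context local_volume
begin

text \<open>
  Where the kernel is not cut off at either pair of points, the difference is controlled by the regularity of \<open>w\<close>, used in both directions.
  Where it is cut off at exactly one of them, \<open>dist x y\<close> is at least a multiple of \<open>m_fun x\<close>, and the size alone is
  enough.
\<close>

lemma truncated_kernel_regular:
  assumes a: "0 < a" and \<beta>: "0 < \<beta>" "\<beta> < 1"
  shows "\<exists>A>0. \<exists>C>0. (\<forall>x y. truncated_kernel a \<beta> w x y \<le> C * riesz \<beta> A x y) \<and>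
    (\<forall>x y x' y'. 2 * (dist x x' + dist y y') \<le> dist x y \<longrightarrow>
      \<bar>truncated_kernel a \<beta> w x' y' - truncated_kernel a \<beta> w x y\<bar>
        \<le> C * ((dist x x' + dist y y') / dist x y + dist x y / m_fun x) * riesz \<beta> A x y)"
proof -
  \<comment> \<open>If the kernel is not cut off at one of the two pairs of points, then \<open>dist x y \<le> A * m_fun x\<close>.\<close>
  define A where "A = 2 * a * (1 + a)"
  have A: "0 < A" unfolding A_def using a by (intro mult_pos_pos) auto
  have aA: "a \<le> A" using mult_left_mono[of 1 "2 * (1 + a)" a] a by (simp add: A_def mult_ac)
  \<comment> \<open>The moved pair is at distance at most \<open>A2 * m_fun x'\<close>.\<close>
  define A2 where "A2 = 3 / 2 * (A * (1 + A))"
  have A2: "0 < A2" using A by (simp add: A2_def)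
  obtain c where c: "0 < c" "\<And>x y. dist x y \<le> A * m_fun x \<Longrightarrow> c * vol x (dist x y) \<le> w x y"
    using volume_lower[OF A] by blast
  obtain K1 where K1: "0 < K1" "\<forall>x y x' y' \<delta>. 0 \<le> \<delta> \<and> \<delta> \<le> 1 \<and> dist x y \<le> A * m_fun x \<and>
      dist x x' + dist y y' \<le> \<delta> * dist x y \<longrightarrow> w x' y' \<le> (1 + K1 * \<delta>) * w x y"
    using volume_regular[OF A] by (elim exE conjE)
  obtain K2 where K2: "0 < K2" "\<forall>x y x' y' \<delta>. 0 \<le> \<delta> \<and> \<delta> \<le> 1 \<and> dist x y \<le> A2 * m_fun x \<and>
      dist x x' + dist y y' \<le> \<delta> * dist x y \<longrightarrow> w x' y' \<le> (1 + K2 * \<delta>) * w x y"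
    using volume_regular[OF A2] by (elim exE conjE)
  define s where "s = 1 - \<beta>"
  have s: "0 < s" "s < 1" using \<beta> by (auto simp: s_def)
  define K where "K = K1 + 2 * K2"
  have K: "0 < K" using K1 K2 by (simp add: K_def)
  let ?k = "truncated_kernel a \<beta> w"
  let ?c = "c powr (- s)"
  have low: "inverse (w x y powr s) \<le> ?c * riesz \<beta> A x y" if "dist x y \<le> A * m_fun x" for x y
  proof (cases "x = y")
    case True
    then show ?thesis by (simp add: volume_diagonal)
  next
    case False
    then have p: "0 < c * vol x (dist x y)" using c by simp
    have "(c * vol x (dist x y)) powr s \<le> w x y powr s"
      by (rule powr_mono2) (use p c(2)[OF that] s in linarith)+
    moreover have "0 < (c * vol x (dist x y)) powr s"
      unfolding powr_gt_zero using p by linarith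
    ultimately have "inverse (w x y powr s) \<le> inverse ((c * vol x (dist x y)) powr s)"
      by (rule le_imp_inverse_le)
    also have "\<dots> = (c * vol x (dist x y)) powr (- s)" by (simp only: powr_minus)
    also have "\<dots> = ?c * vol x (dist x y) powr (- s)" by (rule powr_mult)
    also have "\<dots> = ?c * riesz \<beta> A x y" using that by (simp add: riesz_def s_def)
    finally show ?thesis .
  qed
  have k: "?k x y = (if dist x y < a * m_fun x then inverse (w x y powr s) else 0)" for x y
    by (simp add: truncated_kernel_def s_def)
  have k0: "0 \<le> ?k x y" for x y by (simp add: k)
  have size: "?k x y \<le> ?c * riesz \<beta> A x y" for x y
  proof (cases "dist x y < a * m_fun x")
    case True
    note True
    moreover have "a * m_fun x \<le> A * m_fun x" using aA by (intro mult_right_mono) auto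
    ultimately have "dist x y \<le> A * m_fun x" by linarith
    from low[OF this] True show ?thesis by (simp add: k)
  qed (simp add: k)
  define C where "C = ?c * (1 + K + (1 + K) * (2 * (1 + A) / a))"
  have C: "?c \<le> C" "?c * K \<le> C" "?c * (1 + K) * (2 * (1 + A) / a) \<le> C" "0 < C"
    using K A a c by (auto simp: C_def algebra_simps intro!: add_pos_nonneg)
  show ?thesis
  proof (rule exI[of _ A], intro exI[of _ C] conjI allI impI)
    show "?k x y \<le> C * riesz \<beta> A x y" for x y
      using size[of x y] mult_right_mono[OF C(1) riesz_nonneg, of \<beta> A x y] by linarith
    fix x y x' y' :: "real ^ 'n"
    assume near: "2 * (dist x x' + dist y y') \<le> dist x y"
    let ?d = "dist x y" and ?d' = "dist x' y'"
    let ?\<delta> = "(dist x x' + dist y y') / ?d"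
    show "\<bar>?k x' y' - ?k x y\<bar> \<le> C * (?\<delta> + ?d / m_fun x) * riesz \<beta> A x y"
    proof (cases "?k x' y' = ?k x y")
      case True
      then show ?thesis using C by (auto intro!: mult_nonneg_nonneg add_nonneg_nonneg)
    next
      case False
      have d: "0 < ?d"
      proof (rule ccontr)
        assume "\<not> 0 < ?d"
        then have "?d = 0" by simp
        then have "dist x x' + dist y y' \<le> 0" using near by simp
        then have "dist x x' = 0" "dist y y' = 0"
          using zero_le_dist[of x x'] zero_le_dist[of y y'] by linarith+
        then show False using False by simp
      qed
      have \<delta>: "0 \<le> ?\<delta>" "?\<delta> \<le> 1 / 2" "dist x x' + dist y y' = ?\<delta> * ?d"
        using d near by (auto simp: field_simps)
      have d': "?d \<le> 2 * ?d'" "?d' \<le> 3 / 2 * ?d"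
      proof -
        have "?d \<le> dist x x' + ?d' + dist y y'"
          using dist_triangle[of x y x'] dist_triangle[of x' y y'] by (simp add: dist_commute)
        then show "?d \<le> 2 * ?d'" using near by (simp add: algebra_simps)
        have "?d' \<le> dist x x' + ?d + dist y y'"
          using dist_triangle[of x' y' x] dist_triangle[of x y' y] by (simp add: dist_commute)
        then show "?d' \<le> 3 / 2 * ?d" using near by (simp add: algebra_simps)
      qed
      have xx': "2 * dist x x' \<le> ?d"
      proof -
        have "2 * dist x x' \<le> 2 * (dist x x' + dist y y')" by simp
        also note near
        finally show ?thesis .
      qed
      have nz: "?d < a * m_fun x \<or> ?d' < a * m_fun x'"
        using False by (auto simp: k split: if_splits)
      have dA: "?d \<le> A * m_fun x"
        using nz
      proof
        assume "?d < a * m_fun x"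
        also have "\<dots> \<le> A * m_fun x" using aA by (intro mult_right_mono) auto
        finally show ?thesis by simp
      next
        assume d'a: "?d' < a * m_fun x'"
        have "dist x' x \<le> a * m_fun x'"
          using xx' d'(1) d'a by (simp add: dist_commute)
        then have "m_fun x' \<le> (1 + a) * m_fun x" using a by (intro m_fun_near) auto
        then have "(2 * a) * m_fun x' \<le> (2 * a) * ((1 + a) * m_fun x)" using a by (intro mult_left_mono) auto
        then show ?thesis using d'(1) d'a by (simp add: A_def)
      qed
      have "dist x x' \<le> A * m_fun x" using xx' dA d by linarith
      then have m: "m_fun x \<le> (1 + A) * m_fun x'" using A by (intro m_fun_near) auto
      have d'A: "?d' \<le> A2 * m_fun x'"
      proof -
        have "?d' \<le> 3 / 2 * (A * m_fun x)" using d'(2) dA by linarith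
        also have "\<dots> \<le> 3 / 2 * (A * ((1 + A) * m_fun x'))" using m A by (intro mult_left_mono) auto
        finally show ?thesis by (simp add: A2_def)
      qed
      let ?u = "w x y" and ?v = "w x' y'"
      have "0 < c * vol x ?d" using c d by simp
      then have u: "0 < ?u" using c(2)[OF dA] by linarith
      have vu: "?v \<le> (1 + K * ?\<delta>) * ?u"
      proof -
        have "0 \<le> ?\<delta> \<and> ?\<delta> \<le> 1 \<and> ?d \<le> A * m_fun x \<and> dist x x' + dist y y' \<le> ?\<delta> * ?d"
        proof (intro conjI)
          show "?\<delta> \<le> 1" using \<delta>(2) by linarith
        qed (rule \<delta>(1) dA eq_refl[OF \<delta>(3)])+
        then have "?v \<le> (1 + K1 * ?\<delta>) * ?u" by (rule K1(2)[rule_format])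
        also have "\<dots> \<le> (1 + K * ?\<delta>) * ?u"
          using u \<delta> K2 by (intro mult_right_mono add_left_mono) (auto simp: K_def)
        finally show ?thesis .
      qed
      have uv: "?u \<le> (1 + K2 * (2 * ?\<delta>)) * ?v"
      proof -
        have "0 \<le> 2 * ?\<delta> \<and> 2 * ?\<delta> \<le> 1 \<and> ?d' \<le> A2 * m_fun x' \<and> dist x' x + dist y' y \<le> (2 * ?\<delta>) * ?d'"
        proof (intro conjI d'A)
          show "0 \<le> 2 * ?\<delta>" "2 * ?\<delta> \<le> 1" using \<delta>(1,2) by linarith+
          have "dist x' x + dist y' y = ?\<delta> * ?d" using \<delta>(3) by (simp add: dist_commute)
          also have "\<dots> \<le> ?\<delta> * (2 * ?d')" using d'(1) \<delta>(1) by (rule mult_left_mono)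
          finally show "dist x' x + dist y' y \<le> (2 * ?\<delta>) * ?d'" by (simp only: mult_ac)
        qed
        then show ?thesis by (rule K2(2)[rule_format])
      qed
      have v: "0 < ?v"
      proof (rule ccontr)
        assume "\<not> 0 < ?v"
        then have "(1 + K2 * (2 * ?\<delta>)) * ?v \<le> 0"
          using K2 \<delta>(1) by (intro mult_nonneg_nonpos) auto
        then show False using uv u by linarith
      qed
      have uv': "?u \<le> (1 + K * ?\<delta>) * ?v"
      proof -
        have "K * ?\<delta> = K1 * ?\<delta> + K2 * (2 * ?\<delta>)" by (simp only: K_def distrib_right mult_ac)
        moreover have "0 \<le> K1 * ?\<delta>" by (intro mult_nonneg_nonneg less_imp_le[OF K1(1)] \<delta>(1))
        ultimately have "1 + K2 * (2 * ?\<delta>) \<le> 1 + K * ?\<delta>" by linarith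
        then have "(1 + K2 * (2 * ?\<delta>)) * ?v \<le> (1 + K * ?\<delta>) * ?v"
          using v by (intro mult_right_mono) auto
        then show ?thesis using uv by linarith
      qed
      have K\<delta>: "0 \<le> K * ?\<delta>" using K \<delta>(1) by simp
      note pd = powr_diff_le[OF u v s K\<delta> uv' vu]
      let ?R = "riesz \<beta> A x y"
      have R: "inverse (?u powr s) \<le> ?c * ?R" by (rule low[OF dA])
      show ?thesis
      proof (cases "?d < a * m_fun x \<and> ?d' < a * m_fun x'")
        case True
        then have "\<bar>?k x' y' - ?k x y\<bar> \<le> (K * ?\<delta>) * inverse (?u powr s)" using pd(1) by (simp add: k)
        also have "\<dots> \<le> (K * ?\<delta>) * (?c * ?R)" using R K\<delta> by (rule mult_left_mono)
        also have "\<dots> = (?c * K) * ?\<delta> * ?R" by (simp only: mult_ac)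
        also have "\<dots> \<le> C * (?\<delta> + ?d / m_fun x) * ?R"
          using C \<delta>(1) K by (intro mult_right_mono mult_mono) auto
        finally show ?thesis .
      next
        case far: False
        have "1 \<le> (2 * (1 + A) / a) * (?d / m_fun x)"
        proof -
          have "a * m_fun x \<le> 2 * (1 + A) * ?d"
          proof (cases "?d < a * m_fun x")
            case False
            then have "a * m_fun x \<le> 1 * ?d" by simp
            also have "\<dots> \<le> 2 * (1 + A) * ?d" using A d by (intro mult_right_mono) auto
            finally show ?thesis .
          next
            case True
            then have "a * m_fun x' \<le> ?d'" using far by simp
            have "a * m_fun x \<le> a * ((1 + A) * m_fun x')" using m a by (intro mult_left_mono) auto
            also have "\<dots> = (1 + A) * (a * m_fun x')" by simp
            also have "\<dots> \<le> (1 + A) * (2 * ?d)"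
            proof (rule mult_left_mono)
              have "?d' \<le> 2 * ?d" by (rule order_trans[OF d'(2) mult_right_mono]) simp_all
              with \<open>a * m_fun x' \<le> ?d'\<close> show "a * m_fun x' \<le> 2 * ?d" by (rule order_trans)
            qed (use A in simp)
            finally show ?thesis by (simp only: mult_ac)
          qed
          moreover have "0 < a * m_fun x" using a by simp
          ultimately have "1 \<le> (2 * (1 + A) * ?d) / (a * m_fun x)" by (simp only: le_divide_eq_1_pos)
          then show ?thesis by (simp only: times_divide_times_eq)
        qed
        then have one: "?c * (1 + K) * 1 \<le> ?c * (1 + K) * ((2 * (1 + A) / a) * (?d / m_fun x))"
          using c K by (intro mult_left_mono) auto
        have "\<bar>?k x' y' - ?k x y\<bar> \<le> (1 + K * ?\<delta>) * inverse (?u powr s)"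
        proof -
          have "inverse (?u powr s) \<le> (1 + K * ?\<delta>) * inverse (?u powr s)"
            using K\<delta> mult_right_mono[of 1 "1 + K * ?\<delta>" "inverse (?u powr s)"] by simp
          moreover have "\<bar>?k x' y' - ?k x y\<bar> = inverse (?u powr s) \<or> \<bar>?k x' y' - ?k x y\<bar> = inverse (?v powr s)"
            using far nz by (auto simp: k)
          ultimately show ?thesis using pd(2) by metis
        qed
        also have "\<dots> \<le> (1 + K) * (?c * ?R)"
        proof (rule mult_mono[OF _ R])
          have "?\<delta> \<le> 1" using \<delta>(2) by linarith
          then have "K * ?\<delta> \<le> K * 1" using less_imp_le[OF K] by (rule mult_left_mono)
          then show "1 + K * ?\<delta> \<le> 1 + K" by simp
        qed (use K in auto)
        also have "\<dots> = ?c * (1 + K) * 1 * ?R" by simp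
        also have "\<dots> \<le> ?c * (1 + K) * ((2 * (1 + A) / a) * (?d / m_fun x)) * ?R"
          using one by (rule mult_right_mono) simp
        also have "\<dots> = (?c * (1 + K) * (2 * (1 + A) / a)) * (?d / m_fun x) * ?R" by (simp only: mult.assoc)
        also have "\<dots> \<le> C * (?\<delta> + ?d / m_fun x) * ?R"
        proof (intro mult_right_mono mult_mono)
          show "?d / m_fun x \<le> ?\<delta> + ?d / m_fun x" using \<delta>(1) by linarith
        qed (use C in auto)
        finally show ?thesis .
      qed
    qed
  qed (use A C in auto)
qed

end

text \<open>
  The exchange costs constants only, because \<open>wt\<close> and \<open>m_fun\<close> are comparable at points within the local scale.
\<close>

lemma riesz_swap:
  assumes A: "0 < A" and \<beta>: "\<beta> < 1"
  shows "riesz \<beta> A y x \<le> exp ((2 * A + A\<^sup>2) * (1 - \<beta>)) * riesz \<beta> (A * (1 + A)) x y"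
proof (cases "x = y \<or> \<not> dist y x \<le> A * m_fun y")
  case True
  then have "riesz \<beta> A y x = 0" by (auto simp: riesz_def zero_power)
  then show ?thesis by simp
next
  case False
  then have d: "dist y x \<le> A * m_fun y" "0 < dist x y" by auto
  let ?L = "2 * A + A\<^sup>2"
  have "wt x \<le> exp ?L * wt y" using wt_near1(1)[OF _ d(1)] A by simp
  then have "exp (- ?L) * wt x \<le> exp (- ?L) * (exp ?L * wt y)" by (rule mult_left_mono) simp
  also have "\<dots> = wt y" by (simp only: mult.assoc[symmetric] exp_add[symmetric]) simp
  finally have "exp (- ?L) * wt x * dist x y ^ CARD('a) \<le> wt y * dist x y ^ CARD('a)"
    by (rule mult_right_mono) simp
  then have "(wt y * dist x y ^ CARD('a)) powr (\<beta> - 1) \<le> (exp (- ?L) * (wt x * dist x y ^ CARD('a))) powr (\<beta> - 1)"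
    using d \<beta> by (intro powr_mono2') (auto simp: mult.assoc)
  also have "\<dots> = exp (- ?L) powr (\<beta> - 1) * (wt x * dist x y ^ CARD('a)) powr (\<beta> - 1)" by (rule powr_mult)
  also have "exp (- ?L) powr (\<beta> - 1) = exp (?L * (1 - \<beta>))" by (simp add: powr_def algebra_simps)
  finally show ?thesis
    using d near_sym[of A y x] A by (simp add: riesz_def dist_commute)
qed

context local_volume
begin

lemma truncated_kernel_measurable:
  "(\<lambda>(x, y). truncated_kernel a \<beta> w x y) \<in> borel_measurable (borel \<Otimes>\<^sub>M borel)"
proof -
  have [measurable]: "(\<lambda>p. w (fst p) (snd p)) \<in> borel_measurable (borel \<Otimes>\<^sub>M borel)"
    using volume_measurable by (simp add: case_prod_beta')
  show ?thesis unfolding truncated_kernel_def case_prod_beta' by measurable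
qed

lemma fractional_kernel_truncated:
  assumes a: "0 < a" and \<beta>: "0 < \<beta>" "\<beta> < 1"
  shows "\<exists>A C A' C'. fractional_kernel \<beta> A C A' C' (truncated_kernel a \<beta> w)"
proof -
  let ?k = "truncated_kernel a \<beta> w"
  obtain A C where AC: "0 < A" "0 < C" "\<forall>x y. ?k x y \<le> C * riesz \<beta> A x y"
    "\<forall>x y x' y'. 2 * (dist x x' + dist y y') \<le> dist x y \<longrightarrow> \<bar>?k x' y' - ?k x y\<bar>
        \<le> C * ((dist x x' + dist y y') / dist x y + dist x y / m_fun x) * riesz \<beta> A x y"
    using truncated_kernel_regular[OF a \<beta>] by (elim exE conjE)
  have k0: "0 \<le> ?k x y" for x y by (simp add: truncated_kernel_def)
  define A' where "A' = A * (1 + A)"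
  have A': "0 < A'" using AC by (simp add: A'_def)
  define E where "E = exp ((2 * A + A\<^sup>2) * (1 - \<beta>))"
  have E: "0 < E" by (simp add: E_def)
  have swap: "riesz \<beta> A y x \<le> E * riesz \<beta> A' x y" for x y :: "real ^ 'n"
    unfolding E_def A'_def by (rule riesz_swap) (use AC \<beta> in auto)
  have "one_sided_kernel \<beta> A C ?k"
  proof
    show "\<bar>?k x y - ?k c y\<bar> \<le> C * (dist x c / dist c y + dist c y / m_fun c) * riesz \<beta> A c y"
      if "2 * dist x c \<le> dist c y" for x c y
      using AC(4)[rule_format, of c x y y] that by (simp add: dist_commute)
  qed (use \<beta> AC k0 truncated_kernel_measurable in auto)
  moreover have "one_sided_kernel \<beta> A' (C * (1 + A') * E) (\<lambda>x y. ?k y x)"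
  proof
    show "(\<lambda>(x, y). ?k y x) \<in> borel_measurable (borel \<Otimes>\<^sub>M borel)"
      using measurable_compose[OF measurable_pair_swap' truncated_kernel_measurable]
      by (simp add: case_prod_beta')
    show "?k y x \<le> C * (1 + A') * E * riesz \<beta> A' x y" for x y
    proof -
      have "?k y x \<le> C * riesz \<beta> A y x" using AC(3) by blast
      also have "\<dots> \<le> C * (E * riesz \<beta> A' x y)" using swap AC by (intro mult_left_mono) auto
      also have "\<dots> \<le> (C * (1 + A')) * (E * riesz \<beta> A' x y)"
        using AC A' E by (intro mult_right_mono) auto
      finally show ?thesis by (simp add: mult.assoc)
    qed
    show "\<bar>?k y x - ?k y c\<bar> \<le> C * (1 + A') * E * (dist x c / dist c y + dist c y / m_fun c) * riesz \<beta> A' c y"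
      if "2 * dist x c \<le> dist c y" for x c y
    proof -
      have "\<bar>?k y x - ?k y c\<bar> \<le> C * (dist x c / dist c y + dist c y / m_fun y) * riesz \<beta> A y c"
        using AC(4)[rule_format, of y y c x] that by (simp add: dist_commute)
      also have "\<dots> \<le> C * ((1 + A') * (dist x c / dist c y + dist c y / m_fun c)) * riesz \<beta> A y c"
      proof (cases "dist y c \<le> A * m_fun y")
        case True
        have "dist c y \<le> A' * m_fun c" unfolding A'_def by (rule near_sym) (use True AC in auto)
        then have m: "m_fun c \<le> (1 + A') * m_fun y" using A' by (intro m_fun_near) auto
        have "dist c y / m_fun y \<le> (1 + A') * (dist c y / m_fun c)"
          using mult_left_mono[OF m zero_le_dist[of c y]] by (simp add: field_simps)
        moreover have "dist x c / dist c y \<le> (1 + A') * (dist x c / dist c y)"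
          using mult_right_mono[of 1 "1 + A'" "dist x c / dist c y"] A' by simp
        ultimately have "dist x c / dist c y + dist c y / m_fun y \<le> (1 + A') * (dist x c / dist c y + dist c y / m_fun c)"
          by (simp add: distrib_left)
        then show ?thesis using AC by (intro mult_right_mono mult_left_mono) auto
      next
        case False
        then show ?thesis by (simp add: riesz_def)
      qed
      also have "\<dots> \<le> C * ((1 + A') * (dist x c / dist c y + dist c y / m_fun c)) * (E * riesz \<beta> A' c y)"
        using AC A' by (intro mult_left_mono swap mult_nonneg_nonneg add_nonneg_nonneg) auto
      finally show ?thesis by (simp only: mult_ac)
    qed
  qed (use \<beta> A' AC E k0 in auto)
  ultimately show ?thesis unfolding fractional_kernel_def by blast
qed

end

lemma local_volume_power: "local_volume (\<lambda>x y :: real ^ 'n. vol x (dist x y))"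
proof
  show "(\<lambda>(x, y). wt x * dist x (y :: real ^ 'n) ^ CARD('n)) \<in> borel_measurable (borel \<Otimes>\<^sub>M borel)"
    by measurable
  show "wt x * dist x x ^ CARD('n) = 0" for x :: "real ^ 'n" by simp
  show "\<exists>c>0. \<forall>x y :: real ^ 'n. dist x y \<le> A * m_fun x \<longrightarrow> c * vol x (dist x y) \<le> vol x (dist x y)" for A
    by (intro exI[of _ 1]) simp
  fix A :: real assume A: "0 < A"
  define L where "L = 2 * A + A\<^sup>2"
  have L: "0 < L" using A by (simp add: L_def add_pos_nonneg)
  define a b where "a = L * exp L" and "b = (3 :: real) ^ CARD('n)"
  have ab: "0 < a" "0 < b" using L by (auto simp: a_def b_def)
  have "vol x' (dist x' y') \<le> (1 + (a + b + a * b) * \<delta>) * vol x (dist x y)"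
    if *: "0 \<le> \<delta>" "\<delta> \<le> 1" "dist x y \<le> A * m_fun x" "dist x x' + dist y y' \<le> \<delta> * dist x y"
    for x y x' y' :: "real ^ 'n" and \<delta>
  proof -
    have "dist x x' \<le> \<delta> * dist x y" using *(4) zero_le_dist[of y y'] by linarith
    also have "\<dots> \<le> \<delta> * (A * m_fun x)" using * by (intro mult_left_mono) auto
    finally have "wt x' \<le> exp (\<delta> * L) * wt x" unfolding L_def using * A by (intro wt_near(1)) auto
    also have "exp (\<delta> * L) \<le> 1 + a * \<delta>"
    proof -
      have "1 - \<delta> * L \<le> exp (- (\<delta> * L))" using exp_ge_add_one_self[of "- (\<delta> * L)"] by simp
      then have "exp (\<delta> * L) * (1 - \<delta> * L) \<le> exp (\<delta> * L) * exp (- (\<delta> * L))" by (rule mult_left_mono) simp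
      also have "\<dots> = 1" by (simp only: exp_add[symmetric]) simp
      finally have "exp (\<delta> * L) \<le> 1 + (\<delta> * L) * exp (\<delta> * L)" by (simp add: algebra_simps)
      also have "(\<delta> * L) * exp (\<delta> * L) \<le> (\<delta> * L) * exp (1 * L)"
        using * L by (intro mult_left_mono) (auto simp: mult_right_mono)
      finally show ?thesis by (simp add: a_def mult_ac)
    qed
    finally have w: "wt x' \<le> (1 + a * \<delta>) * wt x" by (simp add: mult_right_mono)
    have "dist x' y' \<le> dist x x' + dist x y + dist y y'"
      using dist_triangle[of x' y' x] dist_triangle[of x y' y] by (simp add: dist_commute)
    also have "\<dots> \<le> (1 + 2 * \<delta>) * dist x y"
    proof -
      have "(1 + 2 * \<delta>) * dist x y = dist x y + \<delta> * dist x y + \<delta> * dist x y" by (simp add: algebra_simps)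
      moreover have "0 \<le> \<delta> * dist x y" using * by simp
      ultimately show ?thesis using *(4) by linarith
    qed
    finally have "dist x' y' ^ CARD('n) \<le> ((1 + 2 * \<delta>) * dist x y) ^ CARD('n)" by (intro power_mono) auto
    also have "\<dots> = (1 + 2 * \<delta>) ^ CARD('n) * dist x y ^ CARD('n)" by (rule power_mult_distrib)
    also have "\<dots> \<le> (1 + b * \<delta>) * dist x y ^ CARD('n)"
      using one_add_power_le[OF *(1,2), of "CARD('n)"] by (intro mult_right_mono) (auto simp: b_def)
    finally have "vol x' (dist x' y') \<le> ((1 + a * \<delta>) * wt x) * ((1 + b * \<delta>) * dist x y ^ CARD('n))"
      using w ab * by (intro mult_mono) auto
    also have "\<dots> = ((1 + a * \<delta>) * (1 + b * \<delta>)) * vol x (dist x y)" by (simp only: mult_ac)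
    also have "\<dots> \<le> (1 + (a + b + a * b) * \<delta>) * vol x (dist x y)"
    proof (rule mult_right_mono)
      have "(a * b) * (\<delta> * \<delta>) \<le> (a * b) * (\<delta> * 1)" using ab * by (intro mult_left_mono) auto
      then show "(1 + a * \<delta>) * (1 + b * \<delta>) \<le> 1 + (a + b + a * b) * \<delta>" by (simp add: algebra_simps)
    qed simp
    finally show ?thesis .
  qed
  moreover have "0 < a + b + a * b" using ab by (simp add: add_pos_pos)
  ultimately show "\<exists>K>0. \<forall>x y x' (y' :: real ^ 'n) \<delta>. 0 \<le> \<delta> \<and> \<delta> \<le> 1 \<and> dist x y \<le> A * m_fun x \<and>
      dist x x' + dist y y' \<le> \<delta> * dist x y \<longrightarrow>
      vol x' (dist x' y') \<le> (1 + K * \<delta>) * vol x (dist x y)"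
    by blast
qed

text \<open>
  A thin annulus has small measure; this is the regularity of \<open>V_fun\<close>.
\<close>

lemma measure_gauss_annulus_le:
  assumes A: "0 < A"
  shows "\<exists>K>0. \<forall>(x :: real ^ 'n) d e. 0 < d \<and> d \<le> e \<and> e \<le> A * m_fun x \<longrightarrow>
    measure gauss (ball x e) \<le> measure gauss (ball x d) + K * wt x * (e ^ CARD('n) - d ^ CARD('n))"
proof -
  define \<omega> where "\<omega> = unit_ball_vol CARD('n)"
  have \<omega>: "0 < \<omega>" by (auto simp: \<omega>_def)
  define G where "G = gauss_norm TYPE('n) * exp (2 * A + A\<^sup>2)"
  have G: "0 < G" by (simp add: G_def)
  have "measure gauss (ball x e) \<le> measure gauss (ball x d) + (G * \<omega>) * wt x * (e ^ CARD('n) - d ^ CARD('n))"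
    if *: "0 < d" "d \<le> e" "e \<le> A * m_fun x" for x :: "real ^ 'n" and d e
  proof -
    let ?S = "ball x e - ball x d"
    have sub: "ball x d \<subseteq> ball x e" using * by auto
    have S: "?S \<in> sets borel" by simp
    have "emeasure lborel ?S = emeasure lborel (ball x e) - emeasure lborel (ball x d)"
      using sub emeasure_lborel_ball_finite[of x d] by (intro emeasure_Diff) auto
    also have "\<dots> = ennreal (\<omega> * (e ^ CARD('n) - d ^ CARD('n)))"
      using * \<omega> by (simp add: emeasure_ball \<omega>_def ennreal_minus right_diff_distrib)
    finally have l: "(\<integral>\<^sup>+ y. indicator ?S y \<partial>lborel) = ennreal (\<omega> * (e ^ CARD('n) - d ^ CARD('n)))"
      using S by simp
    have "emeasure gauss ?S = (\<integral>\<^sup>+ y. indicator ?S y \<partial>gauss)" using S by simp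
    also have "\<dots> \<le> ennreal (G * wt x) * (\<integral>\<^sup>+ y. indicator ?S y \<partial>lborel)"
      unfolding G_def
    proof (rule nn_integral_gauss_local_le)
      show "indicator ?S \<in> borel_measurable borel" using S by (rule borel_measurable_indicator)
      show "dist x y \<le> A * m_fun x" if "indicator ?S y \<noteq> (0 :: ennreal)" for y
        using that * by (auto simp: indicator_def split: if_splits)
    qed (use A in simp)
    also have "\<dots> = ennreal ((G * wt x) * (\<omega> * (e ^ CARD('n) - d ^ CARD('n))))"
      unfolding l using G by (simp add: ennreal_mult')
    finally have "measure gauss ?S \<le> (G * wt x) * (\<omega> * (e ^ CARD('n) - d ^ CARD('n)))"
      using G \<omega> * by (subst (asm) gauss.emeasure_eq_measure, subst (asm) ennreal_le_iff) (auto simp: power_mono)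
    moreover have "measure gauss ?S = measure gauss (ball x e) - measure gauss (ball x d)"
      using sub by (intro gauss.finite_measure_Diff) auto
    ultimately show ?thesis by (simp add: mult_ac)
  qed
  moreover have "0 < G * \<omega>" using G \<omega> by simp
  ultimately show ?thesis by blast
qed

text \<open>
  If both points move by \<open>\<delta> * dist x y\<close> altogether, the new ball is contained in the ball about \<open>x\<close> of radius
  \<open>(1 + 2 * \<delta>) * dist x y\<close>, and the annulus between this one and the old ball has measure \<open>O(\<delta>)\<close> times that of
  the old ball.
\<close>

lemma local_volume_V_fun: "local_volume (V_fun :: real ^ 'n \<Rightarrow> real ^ 'n \<Rightarrow> real)"
proof
  show "(\<lambda>(x, y). V_fun x (y :: real ^ 'n)) \<in> borel_measurable (borel \<Otimes>\<^sub>M borel)"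
  proof -
    have "(\<lambda>p. \<integral>\<^sup>+ z. indicator {0<..} (dist (fst p) (snd p) - dist (fst p) z) \<partial>(gauss :: (real ^ 'n) measure))
      \<in> borel_measurable (borel \<Otimes>\<^sub>M borel)"
      by (rule borel_measurable_gauss_section) measurable
    moreover have "(\<integral>\<^sup>+ z. indicator {0<..} (dist x y - dist x z) \<partial>gauss) = emeasure gauss (ball x (dist x y))"
      for x y :: "real ^ 'n"
    proof -
      have "(\<integral>\<^sup>+ z. indicator {0<..} (dist x y - dist x z) \<partial>gauss) = (\<integral>\<^sup>+ z. indicator (ball x (dist x y)) z \<partial>gauss)"
        by (intro nn_integral_cong) (auto simp: indicator_def)
      then show ?thesis by simp
    qed
    ultimately show ?thesis
      unfolding V_fun_def measure_def case_prod_beta' by simp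
  qed
  show "V_fun x x = 0" for x :: "real ^ 'n" by (simp add: V_fun_def)
next
  fix A :: real assume A: "0 < A"
  obtain C1 C2 where C1: "0 < C1" "\<And>(c :: real ^ 'n) r. 0 < r \<and> r \<le> A * m_fun c \<Longrightarrow>
    C1 * vol c r \<le> measure gauss (ball c r) \<and>
    measure gauss (ball c r) \<le> C2 * vol c r"
    using measure_gauss_ball_bounds[OF A, where ?'n = 'n] by blast
  have low: "C1 * vol x (dist x y) \<le> V_fun x y" if "dist x y \<le> A * m_fun x" for x y :: "real ^ 'n"
  proof (cases "x = y")
    case False
    then show ?thesis using C1(2)[of "dist x y" x] that by (simp add: V_fun_def)
  qed (simp add: V_fun_def zero_power)
  then show "\<exists>c>0. \<forall>x y :: real ^ 'n. dist x y \<le> A * m_fun x \<longrightarrow> c * vol x (dist x y) \<le> V_fun x y"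
    using C1(1) by blast
  \<comment> \<open>Balls of radius up to \<open>3 * dist x y\<close> occur, since \<open>\<delta> \<le> 1\<close>.\<close>
  have A3: "0 < 3 * A" using A by simp
  obtain K where K: "0 < K" "\<forall>(x :: real ^ 'n) d e. 0 < d \<and> d \<le> e \<and> e \<le> (3 * A) * m_fun x \<longrightarrow>
    measure gauss (ball x e) \<le> measure gauss (ball x d) + K * wt x * (e ^ CARD('n) - d ^ CARD('n))"
    using measure_gauss_annulus_le[OF A3, where ?'n = 'n] by (elim exE conjE)
  define b where "b = K * 3 ^ CARD('n) / C1"
  have b: "0 < b" using K C1 by (simp add: b_def)
  have "V_fun x' y' \<le> (1 + b * \<delta>) * V_fun x y"
    if *: "0 \<le> \<delta>" "\<delta> \<le> 1" "dist x y \<le> A * m_fun x" "dist x x' + dist y y' \<le> \<delta> * dist x y"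
    for x y x' y' :: "real ^ 'n" and \<delta>
  proof (cases "x = y")
    case True
    then have "dist x x' + dist y y' \<le> 0" using * by simp
    then have "dist x x' = 0" "dist y y' = 0" using zero_le_dist[of x x'] zero_le_dist[of y y'] by linarith+
    then show ?thesis using True by (simp add: V_fun_def)
  next
    case False
    let ?d = "dist x y" and ?e = "(1 + 2 * \<delta>) * dist x y"
    have d: "0 < ?d" using False by simp
    have de: "?d \<le> ?e" using * by (simp add: distrib_right)
    have eA: "?e \<le> (3 * A) * m_fun x"
    proof -
      have "?e \<le> 3 * ?d" using * by (intro mult_right_mono) auto
      then show ?thesis using *(3) by linarith
    qed
    have sub: "ball x' (dist x' y') \<subseteq> ball x ?e"
    proof
      fix z assume "z \<in> ball x' (dist x' y')"
      then have "dist x' z < dist x' y'" by simp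
      moreover have "dist x' y' \<le> dist x x' + dist x y + dist y y'"
        using dist_triangle[of x' y' x] dist_triangle[of x y' y] by (simp add: dist_commute)
      moreover have "dist x z \<le> dist x x' + dist x' z" by (rule dist_triangle)
      moreover have "?e = ?d + 2 * (\<delta> * ?d)" by (simp add: algebra_simps)
      ultimately have "dist x z < ?e" using *(4) zero_le_dist[of y y'] by linarith
      then show "z \<in> ball x ?e" by simp
    qed
    have "V_fun x' y' \<le> measure gauss (ball x ?e)"
      unfolding V_fun_def using sub by (intro gauss.finite_measure_mono) auto
    also have "\<dots> \<le> V_fun x y + K * wt x * (?e ^ CARD('n) - ?d ^ CARD('n))"
      unfolding V_fun_def using K(2) d de eA by blast
    also have "K * wt x * (?e ^ CARD('n) - ?d ^ CARD('n)) \<le> b * \<delta> * V_fun x y"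
    proof -
      have "?e ^ CARD('n) = (1 + 2 * \<delta>) ^ CARD('n) * ?d ^ CARD('n)" by (rule power_mult_distrib)
      also have "\<dots> \<le> (1 + 3 ^ CARD('n) * \<delta>) * ?d ^ CARD('n)"
        using one_add_power_le[OF *(1,2)] by (intro mult_right_mono) auto
      finally have "?e ^ CARD('n) - ?d ^ CARD('n) \<le> 3 ^ CARD('n) * \<delta> * ?d ^ CARD('n)"
        by (simp add: distrib_right)
      then have "K * wt x * (?e ^ CARD('n) - ?d ^ CARD('n)) \<le> K * wt x * (3 ^ CARD('n) * \<delta> * ?d ^ CARD('n))"
        using K by (intro mult_left_mono) auto
      also have "\<dots> = b * \<delta> * (C1 * vol x ?d)" using C1(1) by (simp add: b_def)
      also have "\<dots> \<le> b * \<delta> * V_fun x y" using low[OF *(3)] b * by (intro mult_left_mono) auto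
      finally show ?thesis .
    qed
    finally show ?thesis by (simp add: algebra_simps)
  qed
  then show "\<exists>K>0. \<forall>x y x' (y' :: real ^ 'n) \<delta>. 0 \<le> \<delta> \<and> \<delta> \<le> 1 \<and> dist x y \<le> A * m_fun x \<and>
      dist x x' + dist y y' \<le> \<delta> * dist x y \<longrightarrow> V_fun x' y' \<le> (1 + K * \<delta>) * V_fun x y"
    using b by blast
qed

section \<open>Boundedness of the local fractional integrals\<close>

lemma frac_int_eq_kernel_op: "frac_int a \<beta> f = kernel_op (truncated_kernel a \<beta> V_fun) f"
  unfolding frac_int_def[abs_def] kernel_op_def[abs_def] set_lebesgue_integral_def
  by (intro ext Bochner_Integration.integral_cong) (auto simp: truncated_kernel_def indicator_def)

lemma frac_int'_eq_kernel_op: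
  "frac_int' a \<beta> (f :: real ^ 'n \<Rightarrow> _) = kernel_op (truncated_kernel a \<beta> (\<lambda>x y. vol x (dist x y))) f"
  unfolding frac_int'_def[abs_def] kernel_op_def[abs_def] set_lebesgue_integral_def
  by (intro ext Bochner_Integration.integral_cong) (auto simp: truncated_kernel_def indicator_def)

lemma frac_int_exists_iff:
  "frac_int_exists a \<beta> f \<longleftrightarrow> (AE x in gauss. integrable gauss (\<lambda>y. truncated_kernel a \<beta> V_fun x y *\<^sub>R f y))"
proof -
  have "(\<lambda>y. indicator (ball x (a * m_fun x)) y *\<^sub>R (f y /\<^sub>R (V_fun x y powr (1 - \<beta>))))
    = (\<lambda>y. truncated_kernel a \<beta> V_fun x y *\<^sub>R f y)" for x
    by (intro ext) (auto simp: truncated_kernel_def indicator_def)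
  then show ?thesis by (simp add: frac_int_exists_def set_integrable_def)
qed

lemma frac_int'_exists_iff:
  "frac_int'_exists a \<beta> (f :: real ^ 'n \<Rightarrow> _) \<longleftrightarrow>
    (AE x in gauss. integrable gauss (\<lambda>y. truncated_kernel a \<beta> (\<lambda>x y. vol x (dist x y)) x y *\<^sub>R f y))"
proof -
  have "(\<lambda>y. indicator (ball x (a * m_fun x)) y *\<^sub>R
      (f y /\<^sub>R ((exp (- (norm x)\<^sup>2) * dist x y ^ CARD('n)) powr (1 - \<beta>))))
    = (\<lambda>y. truncated_kernel a \<beta> (\<lambda>x y. vol x (dist x y)) x y *\<^sub>R f y)" for x
    by (intro ext) (auto simp: truncated_kernel_def indicator_def)
  then show ?thesis by (simp add: frac_int'_exists_def set_integrable_def)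
qed

lemma H1_integrable: "f \<in> H1 r \<Longrightarrow> integrable gauss f"
  by (rule Lp_1_nn_integral(2)) (simp add: H1_def)

theorem theorem3p2:
  fixes a \<beta> p q :: real
  assumes "0 < a" and "0 < \<beta>" and "\<beta> < 1"
    and "1 < p" and "p < q" and "1 / q = 1 / p - \<beta>"
  shows
    "(\<forall>r>1.
        (\<forall>f \<in> (H1 r :: (real ^ 'n \<Rightarrow> complex) set).
           frac_int_exists a \<beta> f \<and> frac_int'_exists a \<beta> f) \<and>
        bounded_op (H1 r :: (real ^ 'n \<Rightarrow> complex) set) (\<lambda>f. ereal (H1_norm r f))
          (Lp (1 / (1 - \<beta>))) (\<lambda>f. ereal (Lp_norm (1 / (1 - \<beta>)) f)) (frac_int a \<beta>) \<and>
        bounded_op (H1 r :: (real ^ 'n \<Rightarrow> complex) set) (\<lambda>f. ereal (H1_norm r f))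
          (Lp (1 / (1 - \<beta>))) (\<lambda>f. ereal (Lp_norm (1 / (1 - \<beta>)) f)) (frac_int' a \<beta>))
     \<and>
     ((\<forall>f \<in> {f \<in> (Lp (1 / \<beta>) :: (real ^ 'n \<Rightarrow> real) set). AE x in gauss. 0 \<le> f x}.
         frac_int_exists a \<beta> f \<and> frac_int'_exists a \<beta> f) \<and>
      bounded_op {f \<in> (Lp (1 / \<beta>) :: (real ^ 'n \<Rightarrow> real) set). AE x in gauss. 0 \<le> f x}
        (\<lambda>f. ereal (Lp_norm (1 / \<beta>) f)) (BLO a) (BLO_norm a) (frac_int a \<beta>) \<and>
      bounded_op {f \<in> (Lp (1 / \<beta>) :: (real ^ 'n \<Rightarrow> real) set). AE x in gauss. 0 \<le> f x}
        (\<lambda>f. ereal (Lp_norm (1 / \<beta>) f)) (BLO a) (BLO_norm a) (frac_int' a \<beta>))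
     \<and>
     ((\<forall>f \<in> (Lp (1 / \<beta>) :: (real ^ 'n \<Rightarrow> complex) set).
         frac_int_exists a \<beta> f \<and> frac_int'_exists a \<beta> f) \<and>
      bounded_op (Lp (1 / \<beta>) :: (real ^ 'n \<Rightarrow> complex) set)
        (\<lambda>f. ereal (Lp_norm (1 / \<beta>) f)) BMO BMO_norm (frac_int a \<beta>) \<and>
      bounded_op (Lp (1 / \<beta>) :: (real ^ 'n \<Rightarrow> complex) set)
        (\<lambda>f. ereal (Lp_norm (1 / \<beta>) f)) BMO BMO_norm (frac_int' a \<beta>))"
proof -
  let ?k = "truncated_kernel a \<beta> V_fun :: real ^ 'n \<Rightarrow> real ^ 'n \<Rightarrow> real"
  let ?k' = "truncated_kernel a \<beta> (\<lambda>x y :: real ^ 'n. vol x (dist x y))"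
  obtain A C A' C' where "fractional_kernel \<beta> A C A' C' ?k"
    using local_volume.fractional_kernel_truncated[OF local_volume_V_fun assms(1-3)] by blast
  then interpret K: fractional_kernel \<beta> A C A' C' ?k .
  obtain B D B' D' where "fractional_kernel \<beta> B D B' D' ?k'"
    using local_volume.fractional_kernel_truncated[OF local_volume_power assms(1-3)] by blast
  then interpret K': fractional_kernel \<beta> B D B' D' ?k' .
  show ?thesis
    unfolding frac_int_eq_kernel_op[abs_def] frac_int'_eq_kernel_op[abs_def]
      frac_int_exists_iff frac_int'_exists_iff
    by (intro conjI allI impI ballI K.AE_integrable K'.AE_integrable K.H1_bounded K'.H1_bounded
          K.BLO_bounded[OF assms(1)] K'.BLO_bounded[OF assms(1)] K.BMO_bounded K'.BMO_bounded)
       (auto intro: H1_integrable K.Lp_integrable)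
qed

end
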